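(* Let $E=\{\xi\in\mathbb{R}^{2\times2}:(\lambda_1(\xi),\lambda_2(\xi))\in\Lambda_E,\ \det\xi>0\}$, where $\Lambda_E\subseteq\{(x_1,x_2)\in\mathbb{R}^2:0<x_1\le x_2\}$, and assume that $$\Gamma:=\{(a_1+t(b_1-a_1),a_2+t(b_2-a_2)):\ t\in[0,1]\}\subseteq\Lambda_E,$$ with $a_1<b_1$, $a_2<b_2$, and either $a_1<a_2$ or $b_1<b_2$. Let $$K:=\{\xi\in\mathbb{R}^{2\times2}:(\lambda_1(\xi),\lambda_2(\xi))\in\Lambda_K,\ \det\xi>0\},$$ where $$\Lambda_K:=\bigcup_{(\alpha_1,\alpha_2)\in\mathrm{rel\,int}\,\Gamma}\{(x_1,x_2)\in\mathbb{R}^2:\ x_1x_2=\alpha_1\alpha_2,\ 0<x_1\le x_2<\alpha_2\}$$ and $\mathrm{rel\,int}\,\Gamma:=\{(a_1+t(b_1-a_1),a_2+t(b_2-a_2)):\ t\in(0,1)\}$. Let $\Omega\subset\mathbb{R}^2$ be a bounded open set and let $\varphi\in C^1_{piec}(\overline\Omega,\mathbb{R}^2)$ be such that $D\varphi(x)\in E\cup K$ for a.e. $x$ in $\Omega$. Then there exists a map $u\in\varphi+W^{1,\infty}_0(\Omega,\mathbb{R}^2)$ such that $Du(x)\in E$ for a.e. $x$ in $\Omega$.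
   Context: For $\xi\in\mathbb{R}^{2\times 2}$, $0\le\lambda_1(\xi)\le\lambda_2(\xi)$ denote the singular values of $\xi$, i.e. the eigenvalues of $\sqrt{\xi\xi^t}$. Conventions: $C^1_{piec}(\overline\Omega,\mathbb{R}^N)$ is the set of piecewise $C^1$ maps, i.e. maps $u\in W^{1,\infty}(\Omega;\mathbb{R}^N)\cap C(\overline\Omega;\mathbb{R}^N)$ for which there are countably many disjoint open sets $\Omega_k\subset\Omega$ with $\operatorname{meas}(\Omega\setminus\bigcup_k\Omega_k)=0$ such that $u\in C^1(\overline{\Omega_k};\mathbb{R}^N)$ for each $k$. $W^{1,\infty}_0(\Omega;\mathbb{R}^N)=W^{1,\infty}(\Omega;\mathbb{R}^N)\cap W^{1,1}_0(\Omega;\mathbb{R}^N)$. *)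

theory Defs
  imports "HOL-Analysis.Analysis"
begin

definition psd_matrix :: "real^'n^'n \<Rightarrow> bool" where
  "psd_matrix S \<longleftrightarrow> transpose S = S \<and> (\<forall>x. 0 \<le> x \<bullet> (S *v x))"

text \<open>Meaningful for positive semidefinite arguments, where the root exists and is unique.\<close>

definition matrix_sqrt :: "real^'n^'n \<Rightarrow> real^'n^'n" where
  "matrix_sqrt A = (THE S. psd_matrix S \<and> S ** S = A)"

definition eigenvalues :: "real^'n^'n \<Rightarrow> real set" where
  "eigenvalues A = {c. \<exists>v. v \<noteq> 0 \<and> A *v v = c *\<^sub>R v}"

text \<open>A symmetric 2 x 2 matrix has two eigenvalues counted with multiplicity, so
  the smaller and the larger one are the minimum and the maximum of the set of eigenvalues
  (which coincide exactly for a double eigenvalue).\<close>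

definition sing_val1 :: "real^2^2 \<Rightarrow> real" where
  "sing_val1 \<xi> = Min (eigenvalues (matrix_sqrt (\<xi> ** transpose \<xi>)))"

definition sing_val2 :: "real^2^2 \<Rightarrow> real" where
  "sing_val2 \<xi> = Max (eigenvalues (matrix_sqrt (\<xi> ** transpose \<xi>)))"

definition partial_deriv :: "'n \<Rightarrow> (real^'n \<Rightarrow> real) \<Rightarrow> real^'n \<Rightarrow> real" where
  "partial_deriv j f x = frechet_derivative f (at x) (axis j 1)"

primrec times_diff :: "nat \<Rightarrow> (real^'n \<Rightarrow> real) \<Rightarrow> bool" where
  "times_diff 0 f \<longleftrightarrow> continuous_on UNIV f"
| "times_diff (Suc k) f \<longleftrightarrow>
     (\<forall>x. f differentiable (at x)) \<and> (\<forall>j. times_diff k (partial_deriv j f))"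

definition smooth :: "(real^'n \<Rightarrow> real) \<Rightarrow> bool" where
  "smooth f \<longleftrightarrow> (\<forall>k. times_diff k f)"

text \<open>\<open>test_functions \<Omega>\<close> is the space of smooth functions with compact support in \<open>\<Omega>\<close>,
  extended by zero to the whole space.\<close>

definition test_functions :: "(real^'n) set \<Rightarrow> (real^'n \<Rightarrow> real) set" where
  "test_functions \<Omega> =
     {f. smooth f \<and> compact (closure {x. f x \<noteq> 0}) \<and> closure {x. f x \<noteq> 0} \<subseteq> \<Omega>}"

definition locally_integrable_on ::
  "(real^'n \<Rightarrow> 'b::euclidean_space) \<Rightarrow> (real^'n) set \<Rightarrow> bool" where
  "locally_integrable_on f \<Omega> \<longleftrightarrow> (\<forall>C. compact C \<and> C \<subseteq> \<Omega> \<longrightarrow> f absolutely_integrable_on C)"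

text \<open>Maps on \<open>\<Omega>\<close> are represented by total functions whose values outside \<open>\<Omega>\<close> are irrelevant.
  Entry \<open>(i, j)\<close> of the weak gradient is the weak partial derivative of the \<open>i\<close>-th component in
  direction \<open>j\<close>; it is determined up to a null subset of \<open>\<Omega>\<close>.\<close>

definition has_weak_gradient ::
  "(real^'n) set \<Rightarrow> (real^'n \<Rightarrow> real^'m) \<Rightarrow> (real^'n \<Rightarrow> real^'n^'m) \<Rightarrow> bool" where
  "has_weak_gradient \<Omega> u G \<longleftrightarrow>
     locally_integrable_on u \<Omega> \<and> locally_integrable_on G \<Omega> \<and>
     (\<forall>f\<in>test_functions \<Omega>. \<forall>i j.
        (LINT x:\<Omega>|lebesgue. u x $ i * partial_deriv j f x) =
        - (LINT x:\<Omega>|lebesgue. G x $ i $ j * f x))"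

definition ess_bounded_on ::
  "(real^'n \<Rightarrow> 'b::euclidean_space) \<Rightarrow> (real^'n) set \<Rightarrow> bool" where
  "ess_bounded_on f \<Omega> \<longleftrightarrow>
     f \<in> borel_measurable (lebesgue_on \<Omega>) \<and> (\<exists>M. AE x in lebesgue_on \<Omega>. norm (f x) \<le> M)"

definition W1_inf :: "(real^'n) set \<Rightarrow> (real^'n \<Rightarrow> real^'m) set" where
  "W1_inf \<Omega> = {u. ess_bounded_on u \<Omega> \<and> (\<exists>G. has_weak_gradient \<Omega> u G \<and> ess_bounded_on G \<Omega>)}"

text \<open>The closure in the \<open>W\<^sup>1\<^sup>,\<^sup>1\<close> norm of the maps all of whose components are test functions.\<close>

definition W11_0 :: "(real^'n) set \<Rightarrow> (real^'n \<Rightarrow> real^'m) set" where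
  "W11_0 \<Omega> =
     {u. u absolutely_integrable_on \<Omega> \<and>
         (\<exists>G. has_weak_gradient \<Omega> u G \<and> G absolutely_integrable_on \<Omega> \<and>
           (\<exists>\<psi> :: nat \<Rightarrow> real^'n \<Rightarrow> real^'m.
              (\<forall>k i. (\<lambda>x. \<psi> k x $ i) \<in> test_functions \<Omega>) \<and>
              (\<lambda>k. LINT x:\<Omega>|lebesgue. norm (u x - \<psi> k x)) \<longlonglongrightarrow> 0 \<and>
              (\<lambda>k. LINT x:\<Omega>|lebesgue. norm (G x - jacobian (\<psi> k) (at x))) \<longlonglongrightarrow> 0))}"

definition W1_inf_0 :: "(real^'n) set \<Rightarrow> (real^'n \<Rightarrow> real^'m) set" where
  "W1_inf_0 \<Omega> = W1_inf \<Omega> \<inter> W11_0 \<Omega>"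

text \<open>\<open>C\<^sup>1\<close> up to the boundary: the classical gradient on the open set \<open>U\<close> extends continuously
  to the closure of \<open>U\<close>.\<close>

definition C1_closure :: "(real^'n) set \<Rightarrow> (real^'n \<Rightarrow> real^'m) set" where
  "C1_closure U =
     {u. continuous_on (closure U) u \<and>
         (\<exists>G :: real^'n \<Rightarrow> real^'n^'m. continuous_on (closure U) G \<and>
            (\<forall>x\<in>U. (u has_derivative (\<lambda>h. G x *v h)) (at x)))}"

definition C1_piec :: "(real^'n) set \<Rightarrow> (real^'n \<Rightarrow> real^'m) set" where
  "C1_piec \<Omega> =
     {u. u \<in> W1_inf \<Omega> \<and> continuous_on (closure \<Omega>) u \<and>
         (\<exists>\<D>. countable \<D> \<and> disjoint \<D> \<and> (\<forall>U\<in>\<D>. open U \<and> U \<subseteq> \<Omega>) \<and>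
              negligible (\<Omega> - \<Union>\<D>) \<and> (\<forall>U\<in>\<D>. u \<in> C1_closure U))}"

end

theory Submission
  imports Defs
begin

text \<open>
  For \<open>det \<xi> > 0\<close> the singular values are determined by \<open>det \<xi>\<close> and the Frobenius norm of \<open>\<xi>\<close>. Adding a
  multiple of the second column of \<open>\<xi>\<close> to the first one keeps the determinant, so every \<open>\<xi> \<in> K\<close> lies
  on a rank-one segment \<open>\<xi> + t a \<otimes> e\<^sub>1\<close> that stays in an open set containing \<open>K\<close> until it hits \<open>E\<close> exactly.
  The gauge of a flat rectangle has the gradients \<open>e\<^sub>1\<close>, \<open>- e\<^sub>1 / 2\<close>, \<open>\<plusminus> \<delta> e\<^sub>2\<close>. Adding \<open>a\<close> times this gauge to an
  affine map with gradient \<open>\<xi>\<close> yields a gradient in \<open>E\<close> on a fixed fraction of the rectangle and a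
  gradient in the open set on the rest; a cut-off near the boundary of the rectangle reduces \<open>C\<^sup>1\<close> maps to affine ones.
  Filling the unsolved open set with such rectangles up to a small remainder and iterating makes the
  measure of the unsolved part decay geometrically. Since gradients never change again once they
  lie in \<open>E\<close>, they converge almost everywhere, and being bounded they converge in \<open>L\<^sup>1\<close>.
\<close>

section \<open>Singular values and laminates\<close>

text \<open>Two obstacles shape the argument. A perturbation with compact support cannot have
  gradients in a single direction, and \<open>E\<close> is not assumed open. So the gradients meant
  to solve the inclusion are hit exactly, while all others only have to stay in an open set. The
  move opposite to \<open>a\<close> has half its size because at full size both ends would have the
  same norm when the columns of \<xi> are orthogonal, and the second end would leave the open set.
  The weak formulation shapes the rest. The map \<phi> is not assumed Lipschitz on the whole space,
  so the iteration tracks the difference to \<phi>, which is Lipschitz with compact support.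
  \<open>W11_0\<close> asks for smooth approximations, and mollifying these differences supplies
  them. The given weak gradient of \<phi> is an arbitrary representative; it has to be identified
  with the classical gradient on each piece before the inclusion can be tested pointwise. The solved
  fraction of a rectangle is at least 1/48 whatever its shape and size; only the density of
  rectangles in balls depends on the place.\<close>

lemma norm_sq_2: "(norm (x::real^2))\<^sup>2 = (x$1)\<^sup>2 + (x$2)\<^sup>2"
  by (simp add: norm_vec_def L2_set_def sum_2)

lemma norm_sq_22: "(norm (A::real^2^2))\<^sup>2 = (A$1$1)\<^sup>2 + (A$1$2)\<^sup>2 + (A$2$1)\<^sup>2 + (A$2$2)\<^sup>2"
proof -
  have "(norm A)\<^sup>2 = (norm (A$1))\<^sup>2 + (norm (A$2))\<^sup>2"
    by (simp add: norm_vec_def[of A] L2_set_def sum_2)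
  then show ?thesis by (simp add: norm_sq_2)
qed

lemma matrix_eq_2: "A = B \<longleftrightarrow> A$1$1 = B$1$1 \<and> A$1$2 = B$1$2 \<and> A$2$1 = B$2$1 \<and> A$2$2 = B$2$2"
  for A B :: "real^2^2"
  by (auto simp: vec_eq_iff forall_2)

lemma matrix_mult_2: "(A ** B) $ i $ j = A$i$1 * B$1$j + A$i$2 * B$2$j"
  for A B :: "real^2^2"
  by (simp add: matrix_matrix_mult_def sum_2)

lemma matrix_vector_mult_2: "(A *v x) $ i = A$i$1 * x$1 + A$i$2 * x$2"
  for A :: "real^2^2"
  by (simp add: matrix_vector_mult_def sum_2)

lemma transpose_nth: "transpose M $ i $ j = M $ j $ i"
  by (simp add: transpose_def)

lemma psd_matrix_2D:
  assumes "psd_matrix (S::real^2^2)"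
  shows "S$2$1 = S$1$2" "0 \<le> S$1$1" "0 \<le> S$2$2" "0 \<le> det S"
proof -
  let ?a = "S$1$1" and ?b = "S$1$2" and ?c = "S$2$2"
  have tr: "transpose S = S" and pos: "\<And>x. 0 \<le> x \<bullet> (S *v x)"
    using assms by (auto simp: psd_matrix_def)
  show sym: "S$2$1 = ?b"
    using tr by (metis (lifting) transpose_def vec_lambda_beta)
  have q: "0 \<le> ?a * s\<^sup>2 + 2 * ?b * s * t + ?c * t\<^sup>2" for s t
    using pos[of "vector [s, t]"] sym
    by (simp add: inner_vec_def sum_2 matrix_vector_mult_2 power2_eq_square algebra_simps)
  show a: "0 \<le> ?a" using q[of 1 0] by simp
  show c: "0 \<le> ?c" using q[of 0 1] by simp
  \<comment> \<open>At (-b, a) and (c, -b) the form is a diagonal entry times the determinant. If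
    both diagonal entries vanish, (1, 1) and (1, -1) force \<open>?b = 0\<close>.\<close>
  have "0 \<le> ?a * (?a * ?c - ?b\<^sup>2)" using q[of "- ?b" ?a]
    by (simp add: power2_eq_square algebra_simps)
  moreover have "0 \<le> ?c * (?a * ?c - ?b\<^sup>2)" using q[of ?c "- ?b"]
    by (simp add: power2_eq_square algebra_simps)
  moreover have "?b = 0" if "?a = 0" "?c = 0"
    using q[of 1 1] q[of 1 "-1"] that by simp
  ultimately have "0 \<le> ?a * ?c - ?b\<^sup>2"
    using a c by (smt (verit) mult_eq_0_iff zero_le_mult_iff power2_eq_square)
  then show "0 \<le> det S" by (simp add: det_2 sym power2_eq_square)
qed

text \<open>By Cayley--Hamilton, a square root \<open>S\<close> of \<open>A\<close> satisfies \<open>A + det S = tr S \<cdot> S\<close>.\<close>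

lemma matrix_sqrt_2:
  fixes \<xi> :: "real^2^2"
  assumes d: "det \<xi> > 0"
  defines "r \<equiv> sqrt ((norm \<xi>)\<^sup>2 + 2 * det \<xi>)"
  shows "matrix_sqrt (\<xi> ** transpose \<xi>) = (1 / r) *\<^sub>R (\<xi> ** transpose \<xi> + mat (det \<xi>))"
proof -
  let ?A = "\<xi> ** transpose \<xi>"
  let ?S = "(1 / r) *\<^sub>R (?A + mat (det \<xi>))"
  define p q s where "p = ?A$1$1" and "q = ?A$1$2" and "s = ?A$2$2"
  have A: "?A$1$1 = p" "?A$1$2 = q" "?A$2$1 = q" "?A$2$2 = s"
    by (auto simp: p_def q_def s_def matrix_mult_2 transpose_def)
  have dA: "p * s - q\<^sup>2 = (det \<xi>)\<^sup>2" and tA: "p + s = (norm \<xi>)\<^sup>2"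
    and p0: "0 \<le> p" and s0: "0 \<le> s"
    unfolding p_def q_def s_def
    by (simp_all add: matrix_mult_2 transpose_def det_2 norm_sq_22[unfolded power2_eq_square] power2_eq_square algebra_simps)
  \<comment> \<open>The number \<open>r\<close> is the trace of the root: the squared trace of a
    root is the trace of \<open>?A\<close> plus twice the determinant of the root.\<close>
  have r2: "r\<^sup>2 = p + s + 2 * det \<xi>" and r0: "r > 0"
    using d by (auto simp: r_def tA add_nonneg_pos)
  have S: "?S$1$1 = (p + det \<xi>) / r" "?S$1$2 = q / r" "?S$2$1 = q / r" "?S$2$2 = (s + det \<xi>) / r"
    by (auto simp: A mat_def)
  have sq: "?S ** ?S = ?A"
  proof -
    have "(p + det \<xi>) * (p + det \<xi>) + q * q = p * (r * r)"
      "(p + det \<xi>) * q + q * (s + det \<xi>) = q * (r * r)"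
      "(s + det \<xi>) * (s + det \<xi>) + q * q = s * (r * r)"
      using dA r2 by (simp_all add: power2_eq_square algebra_simps)
    then show ?thesis using r0
      unfolding matrix_eq_2 matrix_mult_2[of ?S] S A
      by (simp add: add_divide_distrib[symmetric] divide_eq_eq algebra_simps)
  qed
  have psd: "psd_matrix ?S"
  proof -
    have "transpose ?S = ?S"
      unfolding matrix_eq_2[of "transpose ?S"] transpose_nth[of ?S] S by simp
    moreover have "0 \<le> x \<bullet> (?S *v x)" for x
    proof -
      \<comment> \<open>Completing the square: \<open>p\<close> times the quadratic form of
        \<open>?A\<close> is a nonnegative combination of squares.\<close>
      have "0 \<le> (p * s - q\<^sup>2) * (x$2)\<^sup>2 + (p * x$1 + q * x$2)\<^sup>2" using dA by simp
      also have "\<dots> = p * (p * (x$1)\<^sup>2 + 2 * q * x$1 * x$2 + s * (x$2)\<^sup>2)"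
        by (simp add: power2_eq_square algebra_simps)
      finally have 1: "0 \<le> p * (p * (x$1)\<^sup>2 + 2 * q * x$1 * x$2 + s * (x$2)\<^sup>2)" .
      have "p \<noteq> 0" using dA d by (auto simp: power2_eq_square) (smt (verit) mult_pos_pos zero_le_square)
      then have 2: "0 \<le> p * (x$1)\<^sup>2 + 2 * q * x$1 * x$2 + s * (x$2)\<^sup>2"
        using 1 p0 by (simp add: zero_le_mult_iff)
      have "r * (x \<bullet> (?S *v x)) = p * (x$1)\<^sup>2 + 2 * q * x$1 * x$2 + s * (x$2)\<^sup>2
          + det \<xi> * ((x$1)\<^sup>2 + (x$2)\<^sup>2)"
        using r0 unfolding inner_vec_def sum_2 matrix_vector_mult_2[of ?S] S
        by (simp add: power2_eq_square field_simps)
      also have "\<dots> \<ge> 0" using 2 d by simp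
      finally show ?thesis using r0 by (simp add: zero_le_mult_iff)
    qed
    ultimately show ?thesis by (simp add: psd_matrix_def)
  qed
  \<comment> \<open>Determinant and trace of a positive semidefinite root are nonnegative and their
    squares are known, so both are fixed; \<open>T ** T = ?A\<close> then gives every entry.\<close>
  have uniq: "T = ?S" if T: "psd_matrix T" "T ** T = ?A" for T
  proof -
    define a b c where "a = T$1$1" and "b = T$1$2" and "c = T$2$2"
    have Tc: "T$1$1 = a" "T$1$2 = b" "T$2$1 = b" "T$2$2 = c" and ac: "0 \<le> a" "0 \<le> c"
      and dT: "0 \<le> det T"
      using psd_matrix_2D[OF T(1)] by (auto simp: a_def b_def c_def)
    have eqs: "a * a + b * b = p" "a * b + b * c = q" "b * b + c * c = s"
      using T(2) A unfolding matrix_eq_2 matrix_mult_2[of T] Tc by auto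
    have "(det T)\<^sup>2 = (det \<xi>)\<^sup>2"
      by (metis T(2) det_mul det_transpose power2_eq_square)
    then have D: "a * c - b * b = det \<xi>"
      using dT d by (simp add: det_2 Tc)
    have "(a + c)\<^sup>2 = r\<^sup>2" using eqs D r2 by (simp add: power2_eq_square algebra_simps)
    then have ar: "a + c = r" using ac r0 by (simp add: power2_eq_iff_nonneg)
    have "a * r = p + det \<xi>" "b * r = q" "c * r = s + det \<xi>"
      using eqs D by (simp_all add: ar[symmetric] algebra_simps)
    then show ?thesis using r0 unfolding matrix_eq_2 S Tc by (simp add: eq_divide_eq)
  qed
  show ?thesis unfolding matrix_sqrt_def
  proof (rule the_equality)
    show "psd_matrix ?S \<and> ?S ** ?S = ?A" by (rule conjI[OF psd sq])
    show "T = ?S" if "psd_matrix T \<and> T ** T = ?A" for T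
      by (rule uniq[OF conjunct1[OF that] conjunct2[OF that]])
  qed
qed

lemma eigenvalues_2: "eigenvalues A = {c. (A$1$1 - c) * (A$2$2 - c) = A$1$2 * A$2$1}"
  for A :: "real^2^2"
proof -
  have "c \<in> eigenvalues A \<longleftrightarrow> det (A - mat c) = 0" for c
  proof -
    have "A *v v = c *\<^sub>R v \<longleftrightarrow> (A - mat c) *v v = 0" for v
    proof -
      have "mat c *v v = c *\<^sub>R v"
        by (simp add: vec_eq_iff forall_2 matrix_vector_mult_2 mat_def)
      then show ?thesis by (simp add: matrix_vector_mult_diff_rdistrib)
    qed
    then have "c \<in> eigenvalues A \<longleftrightarrow> (\<exists>v. v \<noteq> 0 \<and> (A - mat c) *v v = 0)"
      by (simp add: eigenvalues_def)
    also have "\<dots> \<longleftrightarrow> \<not> invertible (A - mat c)"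
      by (metis invertible_left_inverse matrix_left_invertible_ker)
    finally show ?thesis by (simp add: invertible_det_nz)
  qed
  then show ?thesis by (auto simp: det_2 mat_def)
qed

text \<open>The root has trace \<open>r\<close> and determinant \<open>det \<xi>\<close>, so its
  eigenvalues are \<open>(r + e) / 2\<close> and \<open>(r - e) / 2\<close>: \<open>r\<close> is the
  sum and \<open>e\<close> the difference of the singular values. Everything below uses singular
  values only through these four facts.\<close>

lemma sing_val_props:
  fixes \<xi> :: "real^2^2"
  assumes d: "det \<xi> > 0"
  shows "sing_val1 \<xi> * sing_val2 \<xi> = det \<xi>"
    "(sing_val1 \<xi>)\<^sup>2 + (sing_val2 \<xi>)\<^sup>2 = (norm \<xi>)\<^sup>2"
    "0 < sing_val1 \<xi>" "sing_val1 \<xi> \<le> sing_val2 \<xi>"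
proof -
  define r where "r = sqrt ((norm \<xi>)\<^sup>2 + 2 * det \<xi>)"
  define e where "e = sqrt ((norm \<xi>)\<^sup>2 - 2 * det \<xi>)"
  let ?A = "\<xi> ** transpose \<xi>"
  define p q s where "p = ?A$1$1" and "q = ?A$1$2" and "s = ?A$2$2"
  have A: "?A$1$1 = p" "?A$1$2 = q" "?A$2$1 = q" "?A$2$2 = s"
    by (auto simp: p_def q_def s_def matrix_mult_2 transpose_def)
  have dA: "p * s - q\<^sup>2 = (det \<xi>)\<^sup>2" and tA: "p + s = (norm \<xi>)\<^sup>2"
    unfolding p_def q_def s_def
    by (simp_all add: matrix_mult_2 transpose_def det_2 norm_sq_22[unfolded power2_eq_square] power2_eq_square algebra_simps)
  have "(norm \<xi>)\<^sup>2 - 2 * det \<xi> = (\<xi>$1$1 - \<xi>$2$2)\<^sup>2 + (\<xi>$1$2 + \<xi>$2$1)\<^sup>2"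
    by (simp add: norm_sq_22[unfolded power2_eq_square] det_2 power2_eq_square algebra_simps)
  then have ge: "0 \<le> (norm \<xi>)\<^sup>2 - 2 * det \<xi>" by simp
  then have e: "e\<^sup>2 = (norm \<xi>)\<^sup>2 - 2 * det \<xi>" "0 \<le> e" by (auto simp: e_def)
  have r: "r\<^sup>2 = (norm \<xi>)\<^sup>2 + 2 * det \<xi>" "0 < r" using d by (auto simp: r_def add_nonneg_pos)
  have re: "r\<^sup>2 - e\<^sup>2 = 4 * det \<xi>" using r e by simp
  then have er: "e < r" using d r(2) e(2) by (smt (verit) power_mono)
  have eig: "c \<in> eigenvalues (matrix_sqrt ?A) \<longleftrightarrow> c = (r + e) / 2 \<or> c = (r - e) / 2" for c
  proof -
    have "c \<in> eigenvalues (matrix_sqrt ?A) \<longleftrightarrow>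
        ((p + det \<xi>) / r - c) * ((s + det \<xi>) / r - c) = (q / r) * (q / r)"
      unfolding matrix_sqrt_2[OF d] r_def[symmetric] eigenvalues_2 by (simp add: A mat_def)
    also have "\<dots> \<longleftrightarrow> (p + det \<xi> - c * r) * (s + det \<xi> - c * r) = q * q"
    proof -
      have "((p + det \<xi>) / r - c) * ((s + det \<xi>) / r - c) =
          ((p + det \<xi> - c * r) * (s + det \<xi> - c * r)) / (r * r)"
        using r(2) by (simp add: field_simps)
      then show ?thesis using r(2) by simp
    qed
    also have "\<dots> \<longleftrightarrow> r\<^sup>2 * (c\<^sup>2 - c * r + det \<xi>) = 0"
    proof -
      have "(p + det \<xi> - c * r) * (s + det \<xi> - c * r) - q * q =
        (p * s - q\<^sup>2) + det \<xi> * (p + s) + (det \<xi>)\<^sup>2 - c * r * (p + s + 2 * det \<xi>) + c\<^sup>2 * r\<^sup>2"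
        by (simp add: power2_eq_square algebra_simps)
      also have "\<dots> = r\<^sup>2 * (c\<^sup>2 - c * r + det \<xi>)"
        unfolding dA tA r(1)[symmetric] using r(1) by (simp add: power2_eq_square algebra_simps)
      finally show ?thesis by auto
    qed
    also have "\<dots> \<longleftrightarrow> (c - (r + e) / 2) * (c - (r - e) / 2) = 0"
    proof -
      have "(c - (r + e) / 2) * (c - (r - e) / 2) = c\<^sup>2 - c * r + (r\<^sup>2 - e\<^sup>2) / 4"
        by (simp add: power2_eq_square field_simps)
      then show ?thesis using r(2) re by simp
    qed
    finally show ?thesis by auto
  qed
  then have set: "eigenvalues (matrix_sqrt ?A) = {(r + e) / 2, (r - e) / 2}"
    by (intro set_eqI) (simp only: insert_iff empty_iff simp_thms)
  have s1: "sing_val1 \<xi> = (r - e) / 2" and s2: "sing_val2 \<xi> = (r + e) / 2"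
    unfolding sing_val1_def sing_val2_def set using e(2) by (auto simp: min_def max_def)
  show "sing_val1 \<xi> * sing_val2 \<xi> = det \<xi>" using re
    by (simp add: s1 s2 power2_eq_square field_simps)
  show "(sing_val1 \<xi>)\<^sup>2 + (sing_val2 \<xi>)\<^sup>2 = (norm \<xi>)\<^sup>2"
    using r e by (simp add: s1 s2 power2_eq_square field_simps)
  show "0 < sing_val1 \<xi>" "sing_val1 \<xi> \<le> sing_val2 \<xi>" using er e(2) by (auto simp: s1 s2)
qed

text \<open>Sum and difference of each pair are nonnegative, and their squares are fixed by the
  product and the sum of squares.\<close>

lemma prod_sum_squares_unique:
  fixes x y p q :: real
  assumes "x * y = p * q" "x\<^sup>2 + y\<^sup>2 = p\<^sup>2 + q\<^sup>2" "0 < x" "x \<le> y" "0 < p" "p \<le> q"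
  shows "x = p" "y = q"
proof -
  have "(x + y)\<^sup>2 = (p + q)\<^sup>2" "(y - x)\<^sup>2 = (q - p)\<^sup>2"
    using assms by (simp_all add: power2_eq_square algebra_simps)
  then have "x + y = p + q" "y - x = q - p"
    using assms by (simp_all add: power2_eq_iff_nonneg)
  then show "x = p" "y = q" by auto
qed

text \<open>For a fixed product the sum of squares grows with the difference, and
  \<open>y < q\<close> forces \<open>p < x\<close>, hence a smaller difference.\<close>

lemma prod_sum_squares_less:
  fixes x y p q :: real
  assumes "x * y = p * q" "0 < x" "x \<le> y" "y < q" "0 < p"
  shows "x\<^sup>2 + y\<^sup>2 < p\<^sup>2 + q\<^sup>2"
proof -
  have "p < x"
  proof (rule ccontr)
    assume "\<not> p < x"
    then have "x * y \<le> p * y" using assms by (intro mult_right_mono) auto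
    also have "\<dots> < p * q" using assms by simp
    finally show False using assms by simp
  qed
  then have "(y - x)\<^sup>2 < (q - p)\<^sup>2" using assms by (intro power_strict_mono) auto
  then show ?thesis using assms by (simp add: power2_eq_square algebra_simps)
qed


text \<open>The rank-one matrix of \<open>b\<close> and \<open>p\<close>: the gradient of a real
  function with gradient \<open>p\<close> times the fixed vector \<open>b\<close>.\<close>

definition outer :: "real^2 \<Rightarrow> real^2 \<Rightarrow> real^2^2" where
  "outer b p = (\<chi> i j. b $ i * p $ j)"

lemma outer_mult_vec: "outer b p *v h = (p \<bullet> h) *\<^sub>R b"
  by (simp add: vec_eq_iff matrix_vector_mult_2 outer_def inner_vec_def sum_2 algebra_simps)

lemma norm_outer: "norm (outer b p) = norm b * norm p"
proof -
  have "(norm (outer b p))\<^sup>2 = (norm b * norm p)\<^sup>2"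
    by (simp add: norm_sq_22 norm_sq_2 power_mult_distrib outer_def) (simp add: algebra_simps)
  then show ?thesis by (simp add: power2_eq_iff_nonneg)
qed

section \<open>The inclusion sets in terms of determinant and norm\<close>

locale segment =
  fixes a1 a2 b1 b2 :: real
  assumes a1: "0 < a1" "a1 \<le> a2" and less: "a1 < b1" "a2 < b2" and b: "b1 \<le> b2"
begin

definition \<alpha>1 where "\<alpha>1 s = a1 + s * (b1 - a1)"
definition \<alpha>2 where "\<alpha>2 s = a2 + s * (b2 - a2)"

text \<open>Singular values on the open segment, expressed by determinant and norm: along a rank-one
  line the determinant and the squared norm are polynomials of low degree, the singular values are
  not.\<close>

definition Elam :: "(real^2^2) set" where
  "Elam = {\<xi>. \<exists>s\<in>{0<..<1}. det \<xi> = \<alpha>1 s * \<alpha>2 s \<and> (norm \<xi>)\<^sup>2 = (\<alpha>1 s)\<^sup>2 + (\<alpha>2 s)\<^sup>2}"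

text \<open>The form with inequalities makes openness evident. The interval allowed for
  \<open>det \<xi>\<close> reflects that the parameter may vary; for a single parameter the
  determinant would be fixed and the set would have no interior.\<close>

definition Klam :: "(real^2^2) set" where
  "Klam = {\<xi>. \<exists>s\<in>{0<..<1}. \<alpha>1 s * \<alpha>2 s < det \<xi> \<and> det \<xi> < b1 * b2
     \<and> (norm \<xi>)\<^sup>2 < (\<alpha>1 s)\<^sup>2 + (\<alpha>2 s)\<^sup>2}"

lemma \<alpha>_mono: "\<alpha>1 s < \<alpha>1 t" "\<alpha>2 s < \<alpha>2 t" if "s < t"
  using that less by (auto simp: \<alpha>1_def \<alpha>2_def)

lemma \<alpha>_ends: "\<alpha>1 0 = a1" "\<alpha>2 0 = a2" "\<alpha>1 1 = b1" "\<alpha>2 1 = b2"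
  by (auto simp: \<alpha>1_def \<alpha>2_def)

lemma \<alpha>_le: "\<alpha>1 s \<le> \<alpha>2 s" if "s \<in> {0..1}"
proof -
  have "(1 - s) * a1 \<le> (1 - s) * a2" "s * b1 \<le> s * b2" using that a1 b
    by (auto intro: mult_left_mono)
  then show ?thesis by (simp add: \<alpha>1_def \<alpha>2_def algebra_simps)
qed

lemma \<alpha>_pos: "0 < \<alpha>1 s" "0 < \<alpha>2 s" if "0 \<le> s"
  using that a1 less by (auto simp: \<alpha>1_def \<alpha>2_def intro!: add_pos_nonneg)

lemma \<alpha>_prod_mono: "\<alpha>1 s * \<alpha>2 s < \<alpha>1 t * \<alpha>2 t" if "0 \<le> s" "s < t"
  using \<alpha>_mono[OF that(2)] \<alpha>_pos[OF that(1)] by (intro mult_strict_mono) auto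

lemma \<alpha>_sq_mono: "(\<alpha>1 s)\<^sup>2 + (\<alpha>2 s)\<^sup>2 < (\<alpha>1 t)\<^sup>2 + (\<alpha>2 t)\<^sup>2" if "0 \<le> s" "s < t"
  using \<alpha>_mono[OF that(2)] \<alpha>_pos[OF that(1)] by (intro add_strict_mono power_strict_mono) auto

lemma continuous_\<alpha>: "continuous_on A \<alpha>1" "continuous_on A \<alpha>2"
  unfolding \<alpha>1_def[abs_def] \<alpha>2_def[abs_def] by (intro continuous_intros)+

text \<open>If the determinant exceeds the product at \<open>s\<close>, raising \<open>s\<close>
  reaches equality before 1, and the bound on the norm only grows. Conversely, lowering
  \<open>s\<close> slightly keeps the strict bound on the norm and makes the product smaller than
  the determinant.\<close>

lemma Klam_iff:
  "\<xi> \<in> Klam \<longleftrightarrow> (\<exists>s\<in>{0<..<1}. det \<xi> = \<alpha>1 s * \<alpha>2 s \<and> (norm \<xi>)\<^sup>2 < (\<alpha>1 s)\<^sup>2 + (\<alpha>2 s)\<^sup>2)"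
    (is "?L \<longleftrightarrow> ?R")
proof
  assume ?L
  then obtain s where s: "0 < s" "s < 1" "\<alpha>1 s * \<alpha>2 s < det \<xi>" "det \<xi> < b1 * b2"
    "(norm \<xi>)\<^sup>2 < (\<alpha>1 s)\<^sup>2 + (\<alpha>2 s)\<^sup>2" by (auto simp: Klam_def)
  have "continuous_on {s..1} (\<lambda>t. \<alpha>1 t * \<alpha>2 t)" by (intro continuous_intros continuous_\<alpha>)
  then obtain t where t: "s \<le> t" "t \<le> 1" "\<alpha>1 t * \<alpha>2 t = det \<xi>"
    using IVT'[of "\<lambda>t. \<alpha>1 t * \<alpha>2 t" s "det \<xi>" 1] s by (auto simp: \<alpha>_ends)
  with s have "s < t" "t < 1"
    by (auto simp: \<alpha>_ends order_le_less)
  with s t show ?R using \<alpha>_sq_mono[of s t] by (intro bexI[of _ t]) auto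
next
  assume ?R
  then obtain s where s: "0 < s" "s < 1" "det \<xi> = \<alpha>1 s * \<alpha>2 s"
    "(norm \<xi>)\<^sup>2 < (\<alpha>1 s)\<^sup>2 + (\<alpha>2 s)\<^sup>2" by auto
  have "isCont (\<lambda>t. (\<alpha>1 t)\<^sup>2 + (\<alpha>2 t)\<^sup>2) s"
    unfolding \<alpha>1_def \<alpha>2_def by (intro continuous_intros)
  then have "\<forall>\<^sub>F t in at_left s. (norm \<xi>)\<^sup>2 < (\<alpha>1 t)\<^sup>2 + (\<alpha>2 t)\<^sup>2"
    using s(4) by (intro order_tendstoD) (auto simp: isCont_def filterlim_at_split)
  then have "\<forall>\<^sub>F t in at_left s. (norm \<xi>)\<^sup>2 < (\<alpha>1 t)\<^sup>2 + (\<alpha>2 t)\<^sup>2 \<and> t \<in> {0<..<s}"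
    using s(1) by (intro eventually_conj eventually_at_left_real) auto
  then obtain t where t: "0 < t" "t < s" "(norm \<xi>)\<^sup>2 < (\<alpha>1 t)\<^sup>2 + (\<alpha>2 t)\<^sup>2"
    using eventually_happens[of _ "at_left s"] by (auto simp: trivial_limit_at_left_real)
  show ?L unfolding Klam_def
    using t s \<alpha>_prod_mono[of t s] \<alpha>_prod_mono[of s 1] by (auto simp: \<alpha>_ends intro!: bexI[of _ t])
qed

lemma continuous_on_det2: "continuous_on A (det :: real^2^2 \<Rightarrow> real)"
  unfolding det_2 by (intro continuous_intros)

lemma open_Klam: "open Klam"
proof -
  have eq: "Klam = (\<Union>s\<in>{0<..<1}. {\<xi>. \<alpha>1 s * \<alpha>2 s < det \<xi>} \<inter> {\<xi>. det \<xi> < b1 * b2}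
     \<inter> {\<xi>. (norm \<xi>)\<^sup>2 < (\<alpha>1 s)\<^sup>2 + (\<alpha>2 s)\<^sup>2})"
    by (auto simp: Klam_def)
  show ?thesis unfolding eq
    by (intro open_UN ballI open_Int open_Collect_less continuous_intros continuous_on_det2)
qed

lemma norm_bound:
  assumes "\<xi> \<in> Klam \<union> Elam"
  shows "norm \<xi> \<le> b1 + b2"
proof -
  obtain s where s: "0 < s" "s < 1" "(norm \<xi>)\<^sup>2 \<le> (\<alpha>1 s)\<^sup>2 + (\<alpha>2 s)\<^sup>2"
  proof -
    from assms have "\<exists>s\<in>{0<..<1}. (norm \<xi>)\<^sup>2 \<le> (\<alpha>1 s)\<^sup>2 + (\<alpha>2 s)\<^sup>2"
      unfolding Un_iff Klam_iff Elam_def mem_Collect_eq 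
      by (elim disjE bexE conjE) (rule bexI[rotated], assumption, simp)+
    then show thesis using that by auto
  qed
  have "(\<alpha>1 s)\<^sup>2 + (\<alpha>2 s)\<^sup>2 < b1\<^sup>2 + b2\<^sup>2" using \<alpha>_sq_mono[of s 1] s by (simp add: \<alpha>_ends)
  also have "\<dots> \<le> (b1 + b2)\<^sup>2" using a1 less by (simp add: power2_sum)
  finally have "(norm \<xi>)\<^sup>2 \<le> (b1 + b2)\<^sup>2" using s by simp
  then show ?thesis using a1 less by (simp add: abs_le_square_iff[symmetric])
qed

text \<open>Adding a multiple of the second column of \<open>\<xi>\<close> to the first one keeps the determinant, so
  that a large multiple raises the norm to the value required in \<open>Elam\<close>; the sign is chosen such
  that the opposite move of half the size keeps the norm below this value.\<close>

lemma Klam_laminate: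
  assumes "\<xi> \<in> Klam"
  obtains a where "\<xi> + outer a (axis 1 1) \<in> Elam" "\<xi> - outer ((1/2) *\<^sub>R a) (axis 1 1) \<in> Klam"
proof -
  obtain s where s: "0 < s" "s < 1" "det \<xi> = \<alpha>1 s * \<alpha>2 s"
    "(norm \<xi>)\<^sup>2 < (\<alpha>1 s)\<^sup>2 + (\<alpha>2 s)\<^sup>2" using assms by (auto simp: Klam_iff)
  define c where "c = (\<chi> i. \<xi> $ i $ 2)"
  \<comment> \<open>\<open>P\<close> and \<open>Q\<close> are the coefficients of the change of the
    squared norm along the move, and \<open>D\<close> is the amount still missing for
    \<open>Elam\<close>. The column \<open>c\<close> is nonzero because the determinant is positive,
    whence \<open>Q > 0\<close>.\<close>
  define P where "P = 2 * \<bar>\<xi>$1$1 * \<xi>$1$2 + \<xi>$2$1 * \<xi>$2$2\<bar>"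
  define Q where "Q = (\<xi>$1$2)\<^sup>2 + (\<xi>$2$2)\<^sup>2"
  define \<sigma> :: real where "\<sigma> = (if \<xi>$1$1 * \<xi>$1$2 + \<xi>$2$1 * \<xi>$2$2 \<ge> 0 then 1 else -1)"
  define D where "D = (\<alpha>1 s)\<^sup>2 + (\<alpha>2 s)\<^sup>2 - (norm \<xi>)\<^sup>2"
  have D: "D > 0" using s by (simp add: D_def)
  have P: "P \<ge> 0" by (simp add: P_def)
  have "det \<xi> > 0" using s \<alpha>_pos[of s] by simp
  then have "\<xi>$1$2 \<noteq> 0 \<or> \<xi>$2$2 \<noteq> 0" by (auto simp: det_2)
  then have Q: "Q > 0" by (auto simp: Q_def sum_power2_gt_zero_iff)
  have \<sigma>2: "\<sigma> * \<sigma> = 1" by (simp add: \<sigma>_def)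
  have det: "det (\<xi> + outer (t *\<^sub>R c) (axis 1 1)) = det \<xi>" for t
    by (simp add: det_2 outer_def c_def axis_def algebra_simps)
  have nrm: "(norm (\<xi> + outer ((\<sigma> * t) *\<^sub>R c) (axis 1 1)))\<^sup>2 = (norm \<xi>)\<^sup>2 + (P * t + Q * t\<^sup>2)" for t
  proof -
    have PP: "P = 2 * (\<sigma> * (\<xi>$1$1 * \<xi>$1$2 + \<xi>$2$1 * \<xi>$2$2))" by (simp add: P_def \<sigma>_def)
    have "(norm (\<xi> + outer ((\<sigma> * t) *\<^sub>R c) (axis 1 1)))\<^sup>2 =
      (norm \<xi>)\<^sup>2 + (2 * (\<sigma> * (\<xi>$1$1 * \<xi>$1$2 + \<xi>$2$1 * \<xi>$2$2)) * t + (\<sigma> * \<sigma>) * Q * t\<^sup>2)"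
      unfolding norm_sq_22 Q_def
      by (simp add: outer_def c_def axis_def power2_eq_square algebra_simps)
    then show ?thesis by (simp add: PP \<sigma>2)
  qed
  have "continuous_on {0..sqrt (D / Q)} (\<lambda>t. P * t + Q * t\<^sup>2)" by (intro continuous_intros)
  \<comment> \<open>At this parameter the quadratic term alone equals \<open>D\<close>, so the
    missing amount is reached no later.\<close>
  moreover have "D \<le> P * sqrt (D / Q) + Q * (sqrt (D / Q))\<^sup>2" using D P Q by simp
  ultimately obtain t where t: "0 \<le> t" "P * t + Q * t\<^sup>2 = D"
    using IVT'[of "\<lambda>t. P * t + Q * t\<^sup>2" 0 D "sqrt (D / Q)"] D Q by auto
  let ?a = "(\<sigma> * t) *\<^sub>R c"
  have 1: "\<xi> + outer ?a (axis 1 1) \<in> Elam"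
    using s by (auto simp: Elam_def det nrm t D_def intro!: bexI[of _ s])
  have 2: "\<xi> - outer ((1/2) *\<^sub>R ?a) (axis 1 1) = \<xi> + outer ((\<sigma> * (- t / 2)) *\<^sub>R c) (axis 1 1)"
    by (simp add: outer_def vec_eq_iff)
  have 3: "\<xi> + outer ((\<sigma> * (- t / 2)) *\<^sub>R c) (axis 1 1) \<in> Klam"
  proof -
    have "t \<noteq> 0" using t D by auto
    then have "P * (- t / 2) \<le> 0" "0 < Q * t\<^sup>2" "0 \<le> P * t" using t P Q by auto
    \<comment> \<open>Strict even for \<open>P = 0\<close>: the quadratic term is quartered, and
      \<open>Q * t\<^sup>2\<close> is positive.\<close>
    then have "P * (- t / 2) + Q * (- t / 2)\<^sup>2 < P * t + Q * t\<^sup>2" by (simp add: power2_eq_square)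
    then have "P * (- t / 2) + Q * (- t / 2)\<^sup>2 < D" using t by simp
    then have "(norm (\<xi> + outer ((\<sigma> * (- t / 2)) *\<^sub>R c) (axis 1 1)))\<^sup>2 < (\<alpha>1 s)\<^sup>2 + (\<alpha>2 s)\<^sup>2"
      unfolding nrm D_def by linarith
    with det[of "\<sigma> * (- t / 2)", unfolded s(3)] show ?thesis
      unfolding Klam_iff using s(1,2) by (intro bexI[of _ s] conjI) simp_all
  qed
  show ?thesis by (rule that[OF 1]) (simp only: 2 3)
qed

lemma Klam_ge:
  assumes "det \<xi> > 0" "s \<in> {0<..<1}" "sing_val1 \<xi> * sing_val2 \<xi> = \<alpha>1 s * \<alpha>2 s" "sing_val2 \<xi> < \<alpha>2 s"
  shows "\<xi> \<in> Klam"
  using assms prod_sum_squares_less[of "sing_val1 \<xi>" "sing_val2 \<xi>" "\<alpha>1 s" "\<alpha>2 s"]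
    sing_val_props[OF assms(1)] \<alpha>_pos[of s]
  unfolding Klam_iff by (intro bexI[of _ s]) auto

lemma Elam_sing_val:
  assumes "\<xi> \<in> Elam"
  obtains s where "s \<in> {0<..<1}" "det \<xi> > 0" "sing_val1 \<xi> = \<alpha>1 s" "sing_val2 \<xi> = \<alpha>2 s"
proof -
  obtain s where s: "0 < s" "s < 1" "det \<xi> = \<alpha>1 s * \<alpha>2 s" "(norm \<xi>)\<^sup>2 = (\<alpha>1 s)\<^sup>2 + (\<alpha>2 s)\<^sup>2"
    using assms by (auto simp: Elam_def)
  moreover have d: "det \<xi> > 0" using s \<alpha>_pos[of s] by simp
  moreover have "sing_val1 \<xi> = \<alpha>1 s" "sing_val2 \<xi> = \<alpha>2 s"
    using prod_sum_squares_unique[of "sing_val1 \<xi>" "sing_val2 \<xi>" "\<alpha>1 s" "\<alpha>2 s"]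
      sing_val_props[OF d] \<alpha>_pos[of s] \<alpha>_le[of s] s by auto
  ultimately show ?thesis using that by auto
qed

end

section \<open>The building block\<close>

lemma jacobian_eq:
  assumes "(u has_derivative (\<lambda>h. A *v h)) (at x)"
  shows "jacobian u (at x) = (A :: real^'n^'m)"
  using frechet_derivative_at[OF assms] by (metis jacobian_def matrix_of_matrix_vector_mul)

text \<open>The norm of a matrix is the Frobenius norm, so this is Cauchy-Schwarz in each
  row.\<close>

lemma norm_matrix_vector_mult_le: "norm (A *v x) \<le> norm A * norm (x :: real^2)" for A :: "real^2^2"
proof -
  have "(norm (A *v x))\<^sup>2 \<le> (norm A * norm x)\<^sup>2"
  proof -
    have "(A$i$1 * x$1 + A$i$2 * x$2)\<^sup>2 \<le> ((A$i$1)\<^sup>2 + (A$i$2)\<^sup>2) * ((x$1)\<^sup>2 + (x$2)\<^sup>2)" for i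
      using zero_le_power2[of "A$i$1 * x$2 - A$i$2 * x$1"]
      by (simp add: power2_eq_square algebra_simps)
    from add_mono[OF this[of 1] this[of 2]] show ?thesis
      unfolding power_mult_distrib norm_sq_22 norm_sq_2 matrix_vector_mult_2
      by (simp add: algebra_simps)
  qed
  then show ?thesis by (simp add: power2_le_iff_abs_le)
qed

text \<open>Derivatives are taken in the full space, so the notion is used for open
  \<open>W\<close>. With \<open>K = UNIV\<close> it means plain continuous
  differentiability.\<close>

definition C1_in :: "(real^2) set \<Rightarrow> (real^2 \<Rightarrow> real^2) \<Rightarrow> (real^2^2) set \<Rightarrow> bool" where
  "C1_in W u K \<longleftrightarrow> (\<forall>x\<in>W. u differentiable (at x) \<and> jacobian u (at x) \<in> K) \<and>
     continuous_on W (\<lambda>x. jacobian u (at x))"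

lemma C1_inI:
  assumes "\<And>x. x \<in> W \<Longrightarrow> (u has_derivative (\<lambda>h. g x *v h)) (at x)"
    "\<And>x. x \<in> W \<Longrightarrow> g x \<in> K" "continuous_on W g"
  shows "C1_in W u K"
proof -
  have "jacobian u (at x) = g x" if "x \<in> W" for x using jacobian_eq assms(1)[OF that] .
  then show ?thesis using assms unfolding C1_in_def
    by (auto simp: differentiable_def cong: continuous_on_cong)
qed

lemma C1_in_derivative:
  "C1_in W u K \<Longrightarrow> x \<in> W \<Longrightarrow> (u has_derivative (\<lambda>h. jacobian u (at x) *v h)) (at x)"
  by (simp add: C1_in_def jacobian_works[symmetric])

lemma C1_in_subset: "C1_in W u K \<Longrightarrow> V \<subseteq> W \<Longrightarrow> C1_in V u K"
  unfolding C1_in_def by (meson continuous_on_subset subset_iff)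

lemma C1_in_UN:
  assumes "\<And>i. i \<in> I \<Longrightarrow> open (W i)" "\<And>i. i \<in> I \<Longrightarrow> C1_in (W i) u K"
  shows "C1_in (\<Union>i\<in>I. W i) u K"
  using assms unfolding C1_in_def by (auto intro: continuous_on_open_UN)

lemma C1_in_Un:
  assumes "open V" "open W" "C1_in V u K" "C1_in W u K"
  shows "C1_in (V \<union> W) u K"
  using C1_in_UN[of "{V, W}" "\<lambda>x. x" u K] assms by auto

lemma C1_in_cong:
  assumes "open W" "\<And>x. x \<in> W \<Longrightarrow> u x = v x" "C1_in W u K"
  shows "C1_in W v K"
proof (rule C1_inI[where g = "\<lambda>x. jacobian u (at x)"])
  show "(v has_derivative (*v) (jacobian u (at x))) (at x)" if "x \<in> W" for x
    using has_derivative_transform_within_open[OF C1_in_derivative[OF assms(3) that] assms(1) that assms(2)] .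
qed (use assms in \<open>auto simp: C1_in_def\<close>)

text \<open>In a cell \<open>C\<close> for \<open>u\<close>, the perturbation \<open>w\<close> solves the inclusion on \<open>T\<close> and leaves \<open>W\<close> for later steps.\<close>

definition cell_data ::
  "real \<Rightarrow> real \<Rightarrow> (real^2^2) set \<Rightarrow> (real^2^2) set \<Rightarrow> (real^2 \<Rightarrow> real^2) \<Rightarrow> (real^2) set \<Rightarrow>
   (real^2 \<Rightarrow> real^2) \<Rightarrow> (real^2) set \<Rightarrow> (real^2) set \<Rightarrow> bool" where
  "cell_data \<epsilon> \<kappa> E K u C w T W \<longleftrightarrow> open T \<and> open W \<and> T \<inter> W = {} \<and> T \<union> W \<subseteq> C \<and>
     negligible (C - (T \<union> W)) \<and> \<kappa> * measure lebesgue C \<le> measure lebesgue T \<and>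
     (\<exists>L. L-lipschitz_on UNIV w) \<and> (\<forall>z. z \<notin> C \<longrightarrow> w z = 0) \<and> (\<forall>z. norm (w z) \<le> \<epsilon>) \<and>
     (\<forall>z\<in>T. \<exists>M\<in>E. ((\<lambda>x. u x + w x) has_derivative (\<lambda>h. M *v h)) (at z)) \<and>
     C1_in W (\<lambda>x. u x + w x) K"

definition cell ::
  "real \<Rightarrow> real \<Rightarrow> (real^2^2) set \<Rightarrow> (real^2^2) set \<Rightarrow> (real^2 \<Rightarrow> real^2) \<Rightarrow> (real^2) set \<Rightarrow> bool" where
  "cell \<epsilon> \<kappa> E K u C \<longleftrightarrow> compact C \<and> (\<exists>w T W. cell_data \<epsilon> \<kappa> E K u C w T W)"

lemma lipschitz_on_scaleR:
  fixes f :: "'a::metric_space \<Rightarrow> real" and h :: "'a \<Rightarrow> 'b::real_normed_vector"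
  assumes f: "L-lipschitz_on S f" and h: "M-lipschitz_on S h"
    and B: "\<And>x. x \<in> S \<Longrightarrow> \<bar>f x\<bar> \<le> B" "\<And>x. x \<in> S \<Longrightarrow> norm (h x) \<le> B'" "0 \<le> B" "0 \<le> B'"
  shows "(B * M + L * B')-lipschitz_on S (\<lambda>x. f x *\<^sub>R h x)"
proof (rule lipschitz_onI)
  have LM: "0 \<le> L" "0 \<le> M" using f h lipschitz_on_nonneg by auto
  show "0 \<le> B * M + L * B'" using LM B by simp
  fix x y assume xy: "x \<in> S" "y \<in> S"
  have "dist (f x *\<^sub>R h x) (f y *\<^sub>R h y) = norm (f x *\<^sub>R (h x - h y) + (f x - f y) *\<^sub>R h y)"
    by (simp add: dist_norm algebra_simps)
  also have "\<dots> \<le> \<bar>f x\<bar> * norm (h x - h y) + \<bar>f x - f y\<bar> * norm (h y)"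
    by (metis norm_scaleR norm_triangle_ineq)
  also have "\<dots> \<le> B * (M * dist x y) + (L * dist x y) * B'"
    using lipschitz_onD[OF f xy] lipschitz_onD[OF h xy] B xy LM
    by (intro add_mono mult_mono) (auto simp: dist_norm)
  finally show "dist (f x *\<^sub>R h x) (f y *\<^sub>R h y) \<le> (B * M + L * B') * dist x y"
    by (simp add: algebra_simps)
qed

text \<open>A segment that leaves the sublevel set of \<open>h\<close> crosses the level \<rho>,
  where \<open>f\<close> already vanishes; the estimate up to the crossing point suffices.\<close>

lemma lipschitz_on_extend_zero:
  fixes f :: "'a::real_normed_vector \<Rightarrow> 'b::real_normed_vector"
  assumes f: "L-lipschitz_on {z. h z \<le> (\<rho>::real)} f" and h: "continuous_on UNIV h"
    and zero: "\<And>z. \<rho> \<le> h z \<Longrightarrow> f z = 0"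
  shows "L-lipschitz_on UNIV f"
proof (rule lipschitz_onI)
  show L: "0 \<le> L" using f lipschitz_on_nonneg by auto
  have mixed: "dist (f x) (f y) \<le> L * dist x y" if hxy: "h x \<le> \<rho>" "\<rho> < h y" for x y
  proof -
    let ?c = "\<lambda>t::real. x + t *\<^sub>R (y - x)"
    have "continuous_on {0..1} (\<lambda>t. h (?c t))"
      by (intro continuous_on_compose2[OF h] continuous_intros) auto
    then obtain t where t: "0 \<le> t" "t \<le> 1" "h (?c t) = \<rho>"
      using IVT'[of "\<lambda>t. h (?c t)" 0 \<rho> 1] hxy by auto
    have "dist (f x) (f y) = dist (f x) (f (?c t))" using zero hxy t by simp
    also have "\<dots> \<le> L * dist x (?c t)" using hxy t by (intro lipschitz_onD[OF f]) auto
    also have "dist x (?c t) = t * dist x y" using t by (simp add: dist_norm norm_minus_commute)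
    also have "L * (t * dist x y) \<le> L * (1 * dist x y)"
      using t L by (intro mult_left_mono mult_right_mono) auto
    finally show ?thesis by simp
  qed
  fix x y :: 'a
  consider "h x \<le> \<rho>" "h y \<le> \<rho>" | "h x \<le> \<rho>" "\<rho> < h y" | "\<rho> < h x" "h y \<le> \<rho>" | "\<rho> < h x" "\<rho> < h y"
    by linarith
  then show "dist (f x) (f y) \<le> L * dist x y"
  proof cases
    case 1 then show ?thesis using lipschitz_onD[OF f] by simp
  next
    case 2 then show ?thesis using mixed by simp
  next
    case 3 then show ?thesis using mixed[of y x] by (simp add: dist_commute)
  next
    case 4 then show ?thesis using zero L by simp
  qed
qed

text \<open>\<open>rgauge \<delta>\<close> is the gauge of a rectangle. It is piecewise linear with the four gradients
  in \<open>slopes \<delta>\<close>, and \<open>sector \<delta> p\<close> is the region with gradient \<open>p\<close>.\<close>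

definition rgauge :: "real \<Rightarrow> real^2 \<Rightarrow> real" where
  "rgauge \<delta> z = max (max (z$1) (- z$1 / 2)) (max (\<delta> * z$2) (- \<delta> * z$2))"

definition slopes :: "real \<Rightarrow> (real^2) set" where
  "slopes \<delta> = {axis 1 1, - (1/2) *\<^sub>R axis 1 1, \<delta> *\<^sub>R axis 2 1, - \<delta> *\<^sub>R axis 2 1}"

definition sector :: "real \<Rightarrow> real^2 \<Rightarrow> (real^2) set" where
  "sector \<delta> p = {z. \<forall>q\<in>slopes \<delta>. q \<noteq> p \<longrightarrow> q \<bullet> z < p \<bullet> z}"

lemma inner_axis_2: "axis i 1 \<bullet> z = z $ i" for z :: "real^2"
  by (simp add: cart_eq_inner_axis inner_commute)

lemma finite_slopes: "finite (slopes \<delta>)" by (simp add: slopes_def)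

lemma slope_le_gauge: "q \<in> slopes \<delta> \<Longrightarrow> q \<bullet> z \<le> rgauge \<delta> z"
  by (auto simp: slopes_def rgauge_def inner_axis_2)

lemma gauge_eq_slope: "\<exists>p\<in>slopes \<delta>. rgauge \<delta> z = p \<bullet> z"
proof -
  have "rgauge \<delta> z = z$1 \<or> rgauge \<delta> z = - z$1 / 2 \<or> rgauge \<delta> z = \<delta> * z$2 \<or> rgauge \<delta> z = - \<delta> * z$2"
    unfolding rgauge_def max_def by presburger
  then show ?thesis by (auto simp: slopes_def inner_axis_2)
qed

lemma gauge_sector:
  assumes "p \<in> slopes \<delta>" "z \<in> sector \<delta> p"
  shows "rgauge \<delta> z = p \<bullet> z"
  using gauge_eq_slope[of \<delta> z] slope_le_gauge[OF assms(1), of z] assms(2)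
  by (force simp: sector_def)

text \<open>Outside all sectors at least two slopes attain the maximum. Such points lie on finitely
  many lines, which is why they can be neglected later.\<close>

lemma not_sector:
  assumes "\<And>p. p \<in> slopes \<delta> \<Longrightarrow> z \<notin> sector \<delta> p"
  shows "\<exists>p\<in>slopes \<delta>. \<exists>q\<in>slopes \<delta>. p \<noteq> q \<and> (p - q) \<bullet> z = 0"
proof -
  obtain p where p: "p \<in> slopes \<delta>" "rgauge \<delta> z = p \<bullet> z" using gauge_eq_slope by blast
  then obtain q where "q \<in> slopes \<delta>" "q \<noteq> p" "p \<bullet> z \<le> q \<bullet> z"
    using assms[OF p(1)] by (auto simp: sector_def not_less)
  then show ?thesis using p slope_le_gauge[of q \<delta> z]
    by (intro bexI[of _ p] bexI[of _ q]) (auto simp: inner_diff_left)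
qed

lemma continuous_on_gauge: "continuous_on A (rgauge \<delta>)"
  unfolding rgauge_def by (intro continuous_intros) auto

lemma open_sector: "open (sector \<delta> p)"
proof -
  have "sector \<delta> p = (\<Inter>q\<in>slopes \<delta> - {p}. {z. q \<bullet> z < p \<bullet> z})" by (auto simp: sector_def)
  then show ?thesis
    by (auto intro!: open_INT open_Collect_less continuous_intros simp: finite_slopes)
qed

lemma gauge_lipschitz: "\<delta> > 0 \<Longrightarrow> (1 + \<delta>)-lipschitz_on UNIV (rgauge \<delta>)"
proof (rule lipschitz_onI)
  fix x y :: "real^2" assume d: "\<delta> > 0"
  have m: "\<bar>max a b - max c d\<bar> \<le> max \<bar>a - c\<bar> \<bar>b - d\<bar>" for a b c d :: real by linarith
  have 1: "\<bar>x$1 - y$1\<bar> \<le> norm (x - y)" and 2: "\<bar>x$2 - y$2\<bar> \<le> norm (x - y)"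
    using component_le_norm_cart[of "x - y"] by auto
  have "\<bar>rgauge \<delta> x - rgauge \<delta> y\<bar> \<le> max (max \<bar>x$1 - y$1\<bar> \<bar>- x$1/2 - - y$1/2\<bar>)
      (max \<bar>\<delta> * x$2 - \<delta> * y$2\<bar> \<bar>- \<delta> * x$2 - - \<delta> * y$2\<bar>)"
    unfolding rgauge_def by (intro order_trans[OF m] max.mono m)
  also have "\<dots> \<le> norm (x - y) + \<delta> * norm (x - y)"
  proof -
    have "\<delta> * x$2 - \<delta> * y$2 = \<delta> * (x$2 - y$2)" by (simp add: algebra_simps)
    then have "\<bar>\<delta> * x$2 - \<delta> * y$2\<bar> \<le> \<delta> * norm (x - y)"
      using d 2 by (simp add: abs_mult)
    moreover have "0 \<le> \<delta> * norm (x - y)" using d by simp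
    ultimately show ?thesis using 1 by linarith
  qed
  finally show "dist (rgauge \<delta> x) (rgauge \<delta> y) \<le> (1 + \<delta>) * dist x y"
    by (simp add: dist_norm dist_real_def algebra_simps)
qed simp

lemma norm_slope_le: "\<delta> > 0 \<Longrightarrow> p \<in> slopes \<delta> \<Longrightarrow> norm p \<le> 1 + \<delta>"
  by (auto simp: slopes_def norm_axis_1)

lemma gauge_norm:
  assumes "\<delta> > 0" "rgauge \<delta> z \<le> \<rho>"
  shows "norm z \<le> (2 + 1 / \<delta>) * \<rho>"
proof -
  have "\<bar>z$1\<bar> \<le> 2 * \<rho>" "\<delta> * \<bar>z$2\<bar> \<le> \<rho>"
    using assms by (auto simp: rgauge_def abs_if split: if_splits)
  moreover have "norm z \<le> \<bar>z$1\<bar> + \<bar>z$2\<bar>" using norm_le_l1_cart[of z] by (simp add: sum_2)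
  moreover have "\<bar>z$2\<bar> \<le> \<rho> / \<delta>" using calculation(2) assms(1) by (simp add: field_simps)
  ultimately show ?thesis by (simp add: algebra_simps)
qed


text \<open>The gradient of \<open>u\<close> is within \<omega> of \<xi> on \<open>B\<close>, which
  contains a rectangle of gauge radius \<rho> around \<open>y\<close>. The left-hand side of the
  condition on \<open>e\<close> is the total error caused by the cut-off, as computed in
  \<open>G_in_K\<close>; convexity of \<open>B\<close> serves the mean value inequality.\<close>

locale box_cell =
  fixes \<delta> \<rho> \<omega> :: real and y a :: "real^2" and \<xi> :: "real^2^2" and u :: "real^2 \<Rightarrow> real^2"
    and B :: "(real^2) set" and E K :: "(real^2^2) set" and e :: real
  assumes pos: "0 < \<delta>" "0 < \<rho>" "0 \<le> \<omega>"
    and E: "\<xi> + outer a (axis 1 1) \<in> E"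
    and K: "\<And>p. p \<in> slopes \<delta> \<Longrightarrow> p \<noteq> axis 1 1 \<Longrightarrow> \<xi> + outer a p \<in> K"
    and ball: "ball \<xi> e \<subseteq> K" "\<omega> * (1 + 2 * (2 + 1 / \<delta>) * (1 + \<delta>)) < e"
    and B: "convex B" "open B" "{z. rgauge \<delta> (z - y) \<le> \<rho>} \<subseteq> B"
    and u: "C1_in B u UNIV" "\<And>z. z \<in> B \<Longrightarrow> norm (jacobian u (at z) - \<xi>) \<le> \<omega>"
begin

abbreviation "C \<equiv> {z. rgauge \<delta> (z - y) \<le> \<rho>}"

definition A where "A z = u y + \<xi> *v (z - y)"
definition \<eta> where "\<eta> z = max 0 (min 1 (2 - 2 * rgauge \<delta> (z - y) / \<rho>))"
text \<open>The first summand replaces \<open>u\<close> by the affine map \<open>A\<close> where the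
  gauge is at most half of \<rho> and fades out towards the boundary. The second is \<open>a\<close>
  times the gauge lowered by half of \<rho> and cut at 0. Thus the oscillation lives only where
  \<open>u\<close> has been made affine, and the cut-off varies only where the oscillation is
  0.\<close>

definition w where
  "w z = \<eta> z *\<^sub>R (A z - u z) + min (rgauge \<delta> (z - y) - \<rho> / 2) 0 *\<^sub>R a"

definition inner_part where
  "inner_part p = {z. z - y \<in> sector \<delta> p \<and> rgauge \<delta> (z - y) < \<rho> / 2}"
definition outer_part where
  "outer_part p = {z. z - y \<in> sector \<delta> p \<and> \<rho> / 2 < rgauge \<delta> (z - y) \<and> rgauge \<delta> (z - y) < \<rho>}"

lemma continuous_on_gauge_shift: "continuous_on S (\<lambda>z. rgauge \<delta> (z - y))"
  by (intro continuous_on_compose2[OF continuous_on_gauge[of UNIV]] continuous_intros) auto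

lemma open_sector_shift: "open {z. z - y \<in> sector \<delta> p}"
proof -
  have "open ((\<lambda>z. z - y) -` sector \<delta> p)"
    by (intro open_vimage open_sector continuous_intros)
  then show ?thesis by (simp add: vimage_def)
qed

lemma open_parts: "open (inner_part p)" "open (outer_part p)"
proof -
  have "inner_part p = {z. z - y \<in> sector \<delta> p} \<inter> {z. rgauge \<delta> (z - y) < \<rho> / 2}"
    "outer_part p = {z. z - y \<in> sector \<delta> p} \<inter> {z. \<rho> / 2 < rgauge \<delta> (z - y)} \<inter> {z. rgauge \<delta> (z - y) < \<rho>}"
    by (auto simp: inner_part_def outer_part_def)
  then show "open (inner_part p)" "open (outer_part p)"
    by (auto intro!: open_Int open_sector_shift open_Collect_less continuous_on_gauge_shift continuous_intros)
qed

lemma y_in_B: "y \<in> B"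
  using B(3) pos by (auto simp: rgauge_def)

lemma u_derivative: "z \<in> B \<Longrightarrow> (u has_derivative (\<lambda>h. jacobian u (at z) *v h)) (at z)"
  by (rule C1_in_derivative[OF u(1)])

lemma A_derivative: "(A has_derivative (\<lambda>h. \<xi> *v h)) (at z)"
  unfolding A_def
  by (rule derivative_eq_intros bounded_linear.has_derivative[OF matrix_vector_mul_bounded_linear] refl | simp)+

text \<open>Mean value inequality on the convex set \<open>B\<close>, where the gradient of
  \<open>A - u\<close> has norm at most \<omega>.\<close>

lemma diff_bound:
  assumes "z \<in> B" "z' \<in> B"
  shows "norm ((A z - u z) - (A z' - u z')) \<le> \<omega> * norm (z - z')"
proof (rule differentiable_bound[OF B(1) _ _ assms])
  fix x assume x: "x \<in> B"
  show "((\<lambda>z. A z - u z) has_derivative (\<lambda>h. (\<xi> - jacobian u (at x)) *v h)) (at x within B)"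
    unfolding matrix_vector_mult_diff_rdistrib
    by (intro has_derivative_diff has_derivative_at_withinI[OF A_derivative]
        has_derivative_at_withinI[OF u_derivative[OF x]])
  show "onorm (\<lambda>h. (\<xi> - jacobian u (at x)) *v h) \<le> \<omega>"
  proof (rule onorm_le)
    fix h
    have "norm ((\<xi> - jacobian u (at x)) *v h) \<le> norm (\<xi> - jacobian u (at x)) * norm h"
      by (rule norm_matrix_vector_mult_le)
    also have "\<dots> \<le> \<omega> * norm h" using u(2)[OF x] by (intro mult_right_mono) (auto simp: norm_minus_commute)
    finally show "norm ((\<xi> - jacobian u (at x)) *v h) \<le> \<omega> * norm h" .
  qed
qed

lemma A_y: "A y = u y" by (simp add: A_def)

lemma C_norm: "z \<in> C \<Longrightarrow> norm (z - y) \<le> (2 + 1 / \<delta>) * \<rho>"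
  using gauge_norm[OF pos(1)] by simp

lemma A_bound: "z \<in> C \<Longrightarrow> norm (A z - u z) \<le> \<omega> * ((2 + 1 / \<delta>) * \<rho>)"
  using diff_bound[of z y] y_in_B B(3) A_y C_norm[of z] pos(3)
  by (auto intro: order_trans mult_left_mono)

text \<open>The map \<open>u\<close> cancels, so the gradient equals
  \<open>\<xi> + outer a p\<close> and is not merely close to it. This matters for the slope
  \<open>axis 1 1\<close>, whose gradient has to lie in \<open>E\<close>.\<close>

lemma inner_derivative:
  assumes "p \<in> slopes \<delta>" "z \<in> inner_part p"
  shows "((\<lambda>x. u x + w x) has_derivative (\<lambda>h. (\<xi> + outer a p) *v h)) (at z)"
proof (rule has_derivative_transform_within_open[OF _ open_parts(1) assms(2)])
  show "((\<lambda>x. A x + (p \<bullet> (x - y) - \<rho> / 2) *\<^sub>R a) has_derivative (\<lambda>h. (\<xi> + outer a p) *v h)) (at z)"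
    by (rule derivative_eq_intros A_derivative refl | simp add: matrix_vector_mult_add_rdistrib outer_mult_vec)+
  show "A x + (p \<bullet> (x - y) - \<rho> / 2) *\<^sub>R a = u x + w x" if "x \<in> inner_part p" for x
  proof -
    have "rgauge \<delta> (x - y) = p \<bullet> (x - y)" "rgauge \<delta> (x - y) < \<rho> / 2"
      using that gauge_sector[OF assms(1)] by (auto simp: inner_part_def)
    moreover from this have "\<eta> x = 1" using pos by (simp add: \<eta>_def min_def field_simps)
    ultimately show ?thesis by (simp add: w_def)
  qed
qed

text \<open>Product rule for \<open>u\<close> plus the cut-off times \<open>A - u\<close>, the
  cut-off being affine with slope proportional to \<open>p\<close> on this part.\<close>

definition G where
  "G p z = jacobian u (at z) + (2 - 2 * (p \<bullet> (z - y)) / \<rho>) *\<^sub>R (\<xi> - jacobian u (at z))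
     + outer (A z - u z) (- (2 / \<rho>) *\<^sub>R p)"

lemma outer_derivative:
  assumes "p \<in> slopes \<delta>" "z \<in> outer_part p"
  shows "((\<lambda>x. u x + w x) has_derivative (\<lambda>h. G p z *v h)) (at z)"
proof (rule has_derivative_transform_within_open[OF _ open_parts(2) assms(2)])
  have zB: "z \<in> B" using assms B(3) by (auto simp: outer_part_def)
  show "((\<lambda>x. u x + (2 - 2 * (p \<bullet> (x - y)) / \<rho>) *\<^sub>R (A x - u x)) has_derivative (\<lambda>h. G p z *v h)) (at z)"
  proof -
    have d1: "((\<lambda>x. 2 - 2 * (p \<bullet> (x - y)) / \<rho>) has_derivative (\<lambda>h. - (2 / \<rho>) * (p \<bullet> h))) (at z)"
      unfolding times_divide_eq_left[symmetric] using pos by (auto intro!: derivative_eq_intros)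
    have d2: "((\<lambda>x. A x - u x) has_derivative (\<lambda>h. \<xi> *v h - jacobian u (at z) *v h)) (at z)"
      by (intro has_derivative_diff A_derivative u_derivative[OF zB])
    show ?thesis
      by (rule has_derivative_eq_rhs[OF has_derivative_add[OF u_derivative[OF zB] has_derivative_scaleR[OF d1 d2]]])
        (rule ext, simp add: G_def matrix_vector_mult_add_rdistrib matrix_vector_mult_diff_rdistrib
          scaleR_matrix_vector_assoc[symmetric] outer_mult_vec; fail)
  qed
  show "u x + (2 - 2 * (p \<bullet> (x - y)) / \<rho>) *\<^sub>R (A x - u x) = u x + w x" if "x \<in> outer_part p" for x
  proof -
    have "rgauge \<delta> (x - y) = p \<bullet> (x - y)" "\<rho> / 2 < rgauge \<delta> (x - y)" "rgauge \<delta> (x - y) < \<rho>"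
      using that gauge_sector[OF assms(1)] by (auto simp: outer_part_def)
    moreover from this have "\<eta> x = 2 - 2 * rgauge \<delta> (x - y) / \<rho>"
      using pos by (simp add: \<eta>_def min_def max_def field_simps)
    ultimately show ?thesis by (simp add: w_def)
  qed
qed

text \<open>The difference \<open>A - u\<close> is of order \<omega> \<rho> and the cut-off has
  slope of order 1 / \<rho>, so the error depends on \<omega> but not on the size of the
  rectangle.\<close>

lemma G_in_K:
  assumes "p \<in> slopes \<delta>" "z \<in> outer_part p"
  shows "G p z \<in> K"
proof -
  have z: "rgauge \<delta> (z - y) = p \<bullet> (z - y)" "\<rho> / 2 < rgauge \<delta> (z - y)" "rgauge \<delta> (z - y) < \<rho>"
      using assms(2) gauge_sector[OF assms(1)] by (auto simp: outer_part_def)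
  then have zC: "z \<in> C" by simp
  define t where "t = 2 - 2 * (p \<bullet> (z - y)) / \<rho>"
  have t: "0 \<le> t" "t \<le> 1" using z pos by (auto simp: t_def field_simps)
  have "norm (G p z - \<xi>) = norm ((1 - t) *\<^sub>R (jacobian u (at z) - \<xi>) + outer (A z - u z) (- (2 / \<rho>) *\<^sub>R p))"
  proof -
    have "G p z = jacobian u (at z) + t *\<^sub>R (\<xi> - jacobian u (at z)) + outer (A z - u z) (- (2 / \<rho>) *\<^sub>R p)"
      by (simp only: G_def t_def)
    then have "G p z - \<xi> = (1 - t) *\<^sub>R (jacobian u (at z) - \<xi>) + outer (A z - u z) (- (2 / \<rho>) *\<^sub>R p)"
      by (simp only:) (simp add: algebra_simps)
    then show ?thesis by (rule arg_cong)
  qed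
  also have "\<dots> \<le> (1 - t) * norm (jacobian u (at z) - \<xi>) + norm (A z - u z) * ((2 / \<rho>) * norm p)"
    using t pos by (intro order_trans[OF norm_triangle_ineq]) (simp add: norm_outer)
  also have "\<dots> \<le> 1 * \<omega> + (\<omega> * ((2 + 1 / \<delta>) * \<rho>)) * ((2 / \<rho>) * (1 + \<delta>))"
    using t pos u(2)[of z] B(3) zC A_bound[OF zC] norm_slope_le[OF pos(1) assms(1)]
    by (intro add_mono mult_mono) auto
  also have "\<dots> = \<omega> * (1 + 2 * (2 + 1 / \<delta>) * (1 + \<delta>))" using pos by (simp add: field_simps)
  also have "\<dots> < e" by (rule ball(2))
  finally show ?thesis using ball(1) by (auto simp: dist_norm norm_minus_commute)
qed

lemma continuous_on_G: "continuous_on (outer_part p) (G p)"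
proof -
  have sub: "outer_part p \<subseteq> B" using B(3) by (auto simp: outer_part_def)
  have J: "continuous_on (outer_part p) (\<lambda>z. jacobian u (at z))"
    using u(1) sub by (auto simp: C1_in_def intro: continuous_on_subset)
  have cu: "continuous_on (outer_part p) u"
    by (rule has_derivative_continuous_on, rule has_derivative_at_withinI, rule u_derivative)
      (use sub in blast)
  have cA: "continuous_on (outer_part p) A"
    by (rule has_derivative_continuous_on, rule has_derivative_at_withinI, rule A_derivative)
  have "continuous_on (outer_part p) (\<lambda>z. outer (A z - u z) (- (2 / \<rho>) *\<^sub>R p))"
    unfolding outer_def by (intro continuous_intros cA cu)
  then show ?thesis unfolding G_def[abs_def] using pos by (intro continuous_intros J) auto
qed

lemma w_zero: "z \<notin> C \<Longrightarrow> w z = 0" and w_zero': "\<rho> \<le> rgauge \<delta> (z - y) \<Longrightarrow> w z = 0"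
proof -
  show *: "w z = 0" if "\<rho> \<le> rgauge \<delta> (z - y)"
  proof -
    have "2 - 2 * rgauge \<delta> (z - y) / \<rho> \<le> 0" "0 \<le> rgauge \<delta> (z - y) - \<rho> / 2"
      using that pos by (auto simp: field_simps)
    then show ?thesis by (simp add: w_def \<eta>_def)
  qed
  show "w z = 0" if "z \<notin> C" using * that by simp
qed

lemma gauge_nonneg: "0 \<le> rgauge \<delta> z"
  by (simp add: rgauge_def max_def)

lemma \<eta>_bound: "\<bar>\<eta> z\<bar> \<le> 1" by (simp add: \<eta>_def)

lemma min_bound: "\<bar>min (rgauge \<delta> (z - y) - \<rho> / 2) 0\<bar> \<le> \<rho>"
  using gauge_nonneg[of "z - y"] pos by (simp add: min_def)

text \<open>The factor \<rho> allows the perturbation to be made uniformly small by shrinking the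
  rectangle, while the gradients on the inner parts stay the same.\<close>

lemma w_bound: "norm (w z) \<le> \<rho> * (\<omega> * (2 + 1 / \<delta>) + norm a)"
proof (cases "z \<in> C")
  case True
  have "norm (w z) \<le> \<bar>\<eta> z\<bar> * norm (A z - u z) + \<bar>min (rgauge \<delta> (z - y) - \<rho> / 2) 0\<bar> * norm a"
    unfolding w_def by (metis norm_scaleR norm_triangle_ineq)
  also have "\<dots> \<le> 1 * (\<omega> * ((2 + 1 / \<delta>) * \<rho>)) + \<rho> * norm a"
    using A_bound[OF True] \<eta>_bound min_bound pos(2)
    by (intro add_mono mult_mono) (auto simp: less_imp_le)
  finally show ?thesis by (simp add: algebra_simps)
next
  case False
  then show ?thesis using w_zero pos by simp
qed

lemma w_lipschitz: "\<exists>L. L-lipschitz_on UNIV w"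
proof -
  have g: "(1 + \<delta>)-lipschitz_on S (\<lambda>z. rgauge \<delta> (z - y))" for S
  proof (rule lipschitz_onI)
    show "dist (rgauge \<delta> (z - y)) (rgauge \<delta> (z' - y)) \<le> (1 + \<delta>) * dist z z'" for z z'
      using lipschitz_onD[OF gauge_lipschitz[OF pos(1)], of "z - y" "z' - y"] by (simp add: dist_norm)
  qed (use pos in simp)
  have "((2 / \<rho>) * (1 + \<delta>))-lipschitz_on C \<eta>"
  proof (rule lipschitz_onI)
    fix z z'
    have m: "\<bar>max 0 (min 1 s) - max 0 (min 1 t)\<bar> \<le> \<bar>s - t\<bar>" for s t :: real by linarith
    have "\<bar>\<eta> z - \<eta> z'\<bar> \<le> \<bar>(2 - 2 * rgauge \<delta> (z - y) / \<rho>) - (2 - 2 * rgauge \<delta> (z' - y) / \<rho>)\<bar>"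
      unfolding \<eta>_def by (rule m)
    also have "\<dots> = \<bar>(2 / \<rho>) * (rgauge \<delta> (z' - y) - rgauge \<delta> (z - y))\<bar>"
    proof -
      have "(2 - 2 * g / \<rho>) - (2 - 2 * g' / \<rho>) = (2 / \<rho>) * (g' - g)" for g g' :: real
        by (simp add: diff_divide_distrib algebra_simps)
      then show ?thesis by (rule arg_cong)
    qed
    also have "\<dots> = (2 / \<rho>) * dist (rgauge \<delta> (z - y)) (rgauge \<delta> (z' - y))"
      unfolding abs_mult dist_real_def using pos by (simp add: abs_minus_commute)
    also have "\<dots> \<le> (2 / \<rho>) * ((1 + \<delta>) * dist z z')"
      using lipschitz_onD[OF g[of UNIV], of z z'] pos by (intro mult_left_mono) auto
    finally show "dist (\<eta> z) (\<eta> z') \<le> (2 / \<rho>) * (1 + \<delta>) * dist z z'"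
      unfolding dist_real_def by (simp only: mult.assoc)
  qed (use pos in simp)
  moreover have "\<omega>-lipschitz_on C (\<lambda>z. A z - u z)"
    using B(3) pos diff_bound by (intro lipschitz_onI) (auto simp: dist_norm)
  ultimately have 1: "(1 * \<omega> + ((2 / \<rho>) * (1 + \<delta>)) * (\<omega> * ((2 + 1 / \<delta>) * \<rho>)))-lipschitz_on C
      (\<lambda>z. \<eta> z *\<^sub>R (A z - u z))"
    using \<eta>_bound A_bound pos by (intro lipschitz_on_scaleR) auto
  have "(1 + \<delta>)-lipschitz_on C (\<lambda>z. min (rgauge \<delta> (z - y) - \<rho> / 2) 0)"
  proof (rule lipschitz_onI)
    fix z z'
    have m: "\<bar>min (s - r) 0 - min (t - r) 0\<bar> \<le> \<bar>s - t\<bar>" for s t r :: real by linarith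
    show "dist (min (rgauge \<delta> (z - y) - \<rho> / 2) 0) (min (rgauge \<delta> (z' - y) - \<rho> / 2) 0) \<le> (1 + \<delta>) * dist z z'"
      using order_trans[OF m] lipschitz_onD[OF g[of UNIV], of z z'] by (simp add: dist_real_def)
  qed (use pos in simp)
  then have 2: "(\<rho> * 0 + (1 + \<delta>) * norm a)-lipschitz_on C (\<lambda>z. min (rgauge \<delta> (z - y) - \<rho> / 2) 0 *\<^sub>R a)"
    using min_bound pos by (intro lipschitz_on_scaleR lipschitz_on_constant) auto
  have "\<exists>L. L-lipschitz_on C w"
    using lipschitz_on_add[OF 1 2] unfolding w_def[abs_def] by blast
  then obtain L where "L-lipschitz_on C w" ..
  \<comment> \<open>Nothing is known about \<open>u\<close> away from \<open>B\<close>, but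
    \<open>w\<close> vanishes outside the rectangle and on its boundary.\<close>
  then have "L-lipschitz_on UNIV w"
    by (rule lipschitz_on_extend_zero[OF _ continuous_on_gauge_shift w_zero'])
  then show ?thesis ..
qed

lemma C_cbox: "C = cbox (y + vector [- 2 * \<rho>, - \<rho> / \<delta>]) (y + vector [\<rho>, \<rho> / \<delta>])"
proof -
  have *: "z \<in> C \<longleftrightarrow> - 2 * \<rho> \<le> z$1 - y$1 \<and> z$1 - y$1 \<le> \<rho> \<and> - \<rho> / \<delta> \<le> z$2 - y$2 \<and> z$2 - y$2 \<le> \<rho> / \<delta>" for z
    using pos by (auto simp: rgauge_def field_simps)
  show ?thesis
    by (intro set_eqI, unfold * mem_box_cart forall_2 vector_add_component vector_2) linarith
qed

lemma measure_C: "measure lebesgue C = 6 * \<rho>\<^sup>2 / \<delta>"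
proof -
  have "measure lebesgue C = (\<Prod>i\<in>UNIV. (y + vector [\<rho>, \<rho> / \<delta>])$i - (y + vector [- 2 * \<rho>, - \<rho> / \<delta>])$i)"
    unfolding C_cbox using pos
    by (subst content_cbox_cart[symmetric]) (auto simp: interval_ne_empty_cart forall_2)
  then show ?thesis using pos by (simp add: UNIV_2 power2_eq_square field_simps)
qed

text \<open>A box with sides \<rho> / 4 and \<rho> / (2 \<delta>) fits into the sector: its first
  coordinate exceeds \<rho> / 4, a bound for the competing slopes. Compared with the area
  \<open>6 * \<rho>\<^sup>2 / \<delta>\<close> of the rectangle this is the fraction 1/48,
  independent of \<delta> and \<rho>.\<close>

lemma measure_inner: "\<rho>\<^sup>2 / (8 * \<delta>) \<le> measure lebesgue (inner_part (axis 1 1))"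
proof -
  let ?l = "y + vector [\<rho> / 4, - \<rho> / (4 * \<delta>)]" and ?r = "y + vector [\<rho> / 2, \<rho> / (4 * \<delta>)]"
  have "box ?l ?r \<subseteq> inner_part (axis 1 1)"
  proof
    fix z assume "z \<in> box ?l ?r"
    then have z: "\<rho> / 4 < z$1 - y$1" "z$1 - y$1 < \<rho> / 2" "- \<rho> / (4 * \<delta>) < z$2 - y$2" "z$2 - y$2 < \<rho> / (4 * \<delta>)"
      by (auto simp: mem_box_cart forall_2)
    then have d: "- \<rho> / 4 < \<delta> * (z$2 - y$2)" "\<delta> * (z$2 - y$2) < \<rho> / 4"
      using pos(1) by (auto simp: field_simps)
    then show "z \<in> inner_part (axis 1 1)"
    proof -
      have X: "0 < z$1 - y$1" using z(1) pos(2) by linarith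
      have "rgauge \<delta> (z - y) < \<rho> / 2"
        unfolding rgauge_def max_less_iff_conj vector_minus_component proof (intro conjI)
        show "- (z$1 - y$1) / 2 < \<rho> / 2" using X pos(2) by (simp add: field_simps)
        show "\<delta> * (z$2 - y$2) < \<rho> / 2" using d(2) pos(2) by linarith
        have "- (\<delta> * (z$2 - y$2)) < \<rho> / 2" using d(1) pos(2) by linarith
        then show "- \<delta> * (z$2 - y$2) < \<rho> / 2" by simp
      qed (rule z(2))
      moreover have "q \<bullet> (z - y) < axis 1 1 \<bullet> (z - y)" if "q \<in> slopes \<delta>" "q \<noteq> axis 1 1" for q
      proof -
        have "- (z$1 - y$1) / 2 < z$1 - y$1" using X by (simp add: field_simps)
        moreover have "\<delta> * (z$2 - y$2) < z$1 - y$1" using z(1) d(2) by linarith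
        moreover have "- (\<delta> * (z$2 - y$2)) < z$1 - y$1" using z(1) d(1) by linarith
        ultimately show ?thesis using that X by (auto simp: slopes_def inner_axis_2 field_simps)
      qed
      ultimately show ?thesis by (simp add: inner_part_def sector_def)
    qed
  qed
  moreover have "bounded (inner_part (axis 1 1))"
  proof (rule bounded_subset)
    show "bounded C" unfolding C_cbox by (rule bounded_cbox)
    show "inner_part (axis 1 1) \<subseteq> C" using pos by (auto simp: inner_part_def)
  qed
  ultimately have "measure lebesgue (box ?l ?r) \<le> measure lebesgue (inner_part (axis 1 1))"
    by (intro measure_mono_fmeasurable lmeasurable_open open_parts) (auto simp: fmeasurableD)
  also have "measure lebesgue (box ?l ?r) = (\<Prod>i\<in>UNIV. ?r$i - ?l$i)"
  proof -
    have "measure lebesgue (box ?l ?r) = measure lebesgue (cbox ?l ?r)"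
      by (simp add: measure_lborel_box_eq measure_lborel_cbox_eq)
    also have "\<dots> = (\<Prod>i\<in>UNIV. ?r$i - ?l$i)" using pos
      by (subst content_cbox_cart[symmetric]) (auto simp: interval_ne_empty_cart forall_2)
    finally show ?thesis .
  qed
  finally show ?thesis using pos by (simp add: UNIV_2 power2_eq_square field_simps)
qed

text \<open>What remains lies on lines where two slopes agree or where some slope takes the value
  \<rho> / 2 or \<rho>.\<close>

lemma negligible_rest:
  "negligible (C - (inner_part (axis 1 1) \<union> ((\<Union>p\<in>slopes \<delta> - {axis 1 1}. inner_part p)
     \<union> (\<Union>p\<in>slopes \<delta>. outer_part p))))" (is "negligible (C - ?U)")
proof -
  let ?N1 = "\<Union>p\<in>slopes \<delta>. \<Union>q\<in>slopes \<delta> - {p}. {z. (p - q) \<bullet> z = (p - q) \<bullet> y}"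
  let ?N2 = "\<Union>p\<in>slopes \<delta>. {z. p \<bullet> z = p \<bullet> y + \<rho> / 2} \<union> {z. p \<bullet> z = p \<bullet> y + \<rho>}"
  have nz: "p \<noteq> 0" if "p \<in> slopes \<delta>" for p
    using that pos(1) by (auto simp: slopes_def axis_eq_0_iff)
  have "C - ?U \<subseteq> ?N1 \<union> ?N2"
  proof
    fix z assume z: "z \<in> C - ?U"
    show "z \<in> ?N1 \<union> ?N2"
    proof (cases "\<exists>p\<in>slopes \<delta>. z - y \<in> sector \<delta> p")
      case True
      then obtain p where p: "p \<in> slopes \<delta>" "z - y \<in> sector \<delta> p" by blast
      then have g: "rgauge \<delta> (z - y) = p \<bullet> z - p \<bullet> y"
        using gauge_sector[OF p] by (simp add: inner_diff_right)
      have "\<not> rgauge \<delta> (z - y) < \<rho> / 2" using z p by (auto simp: inner_part_def)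
      moreover have "\<not> (\<rho> / 2 < rgauge \<delta> (z - y) \<and> rgauge \<delta> (z - y) < \<rho>)"
        using z p by (auto simp: outer_part_def)
      moreover have "rgauge \<delta> (z - y) \<le> \<rho>" using z by auto
      ultimately have "rgauge \<delta> (z - y) = \<rho> / 2 \<or> rgauge \<delta> (z - y) = \<rho>" by linarith
      then have "p \<bullet> z = p \<bullet> y + \<rho> / 2 \<or> p \<bullet> z = p \<bullet> y + \<rho>" using g by linarith
      then have "z \<in> {z. p \<bullet> z = p \<bullet> y + \<rho> / 2} \<union> {z. p \<bullet> z = p \<bullet> y + \<rho>}" by blast
      then show ?thesis using p(1) by blast
    next
      case False
      then obtain p q where "p \<in> slopes \<delta>" "q \<in> slopes \<delta>" "p \<noteq> q" "(p - q) \<bullet> (z - y) = 0"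
        using not_sector[of \<delta> "z - y"] by auto
      then show ?thesis by (auto simp: inner_diff_right)
    qed
  qed
  moreover have "negligible (?N1 \<union> ?N2)"
  proof (intro negligible_Un negligible_Union)
    show "negligible t" if "t \<in> (\<lambda>p. \<Union>q\<in>slopes \<delta> - {p}. {z. (p - q) \<bullet> z = (p - q) \<bullet> y}) ` slopes \<delta>" for t
      using that finite_slopes by (auto intro!: negligible_Union negligible_hyperplane)
    show "negligible t"
      if "t \<in> (\<lambda>p. {z. p \<bullet> z = p \<bullet> y + \<rho> / 2} \<union> {z. p \<bullet> z = p \<bullet> y + \<rho>}) ` slopes \<delta>" for t
      using that nz by (auto intro!: negligible_Un negligible_hyperplane)
  qed (use finite_slopes in auto)
  ultimately show ?thesis by (rule negligible_subset[rotated])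
qed

lemma cell: "cell (\<rho> * (\<omega> * (2 + 1 / \<delta>) + norm a)) (1 / 48) E K u C"
proof -
  \<comment> \<open>The inner parts with the other slopes and the whole transition zone are left to
    later stages.\<close>
  let ?W1 = "\<Union>p\<in>slopes \<delta> - {axis 1 1}. inner_part p"
  let ?W2 = "\<Union>p\<in>slopes \<delta>. outer_part p"
  have e1: "axis 1 1 \<in> slopes \<delta>" by (simp add: slopes_def)
  have C1: "C1_in ?W1 (\<lambda>x. u x + w x) K"
  proof (rule C1_in_UN[OF open_parts(1)])
    fix p assume p: "p \<in> slopes \<delta> - {axis 1 1}"
    show "C1_in (inner_part p) (\<lambda>x. u x + w x) K"
      using p K inner_derivative by (intro C1_inI[where g = "\<lambda>_. \<xi> + outer a p"]) auto
  qed
  have C2: "C1_in ?W2 (\<lambda>x. u x + w x) K"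
  proof (rule C1_in_UN[OF open_parts(2)])
    fix p assume p: "p \<in> slopes \<delta>"
    show "C1_in (outer_part p) (\<lambda>x. u x + w x) K"
      using p G_in_K outer_derivative continuous_on_G by (intro C1_inI[where g = "G p"]) auto
  qed
  have oW: "open (?W1 \<union> ?W2)" by (intro open_Un open_UN ballI open_parts)
  have disj: "inner_part (axis 1 1) \<inter> (?W1 \<union> ?W2) = {}"
    using e1 by (auto simp: inner_part_def outer_part_def sector_def) (metis less_asym)
  have sub: "inner_part (axis 1 1) \<union> (?W1 \<union> ?W2) \<subseteq> C"
    using pos by (auto simp: inner_part_def outer_part_def)
  have meas: "1 / 48 * measure lebesgue C \<le> measure lebesgue (inner_part (axis 1 1))"
    using measure_inner by (simp add: measure_C)
  have cpt: "compact C" unfolding C_cbox by (rule compact_cbox)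
  have inE: "\<forall>z\<in>inner_part (axis 1 1). \<exists>M\<in>E. ((\<lambda>x. u x + w x) has_derivative (\<lambda>h. M *v h)) (at z)"
    using inner_derivative[OF e1] E by blast
  show ?thesis unfolding cell_def cell_data_def
    using cpt open_parts(1)[of "axis 1 1"] oW disj sub negligible_rest meas w_lipschitz w_zero w_bound inE
      C1_in_Un[OF _ _ C1 C2] open_parts
    by (intro conjI exI[of _ w] exI[of _ "inner_part (axis 1 1)"] exI[of _ "?W1 \<union> ?W2"]) (simp_all add: open_UN)
qed

end

section \<open>Exhaustion by disjoint cells\<close>

text \<open>The density \<open>\<theta>\<close> of admissible sets in a small ball may degenerate towards the boundary of \<open>U\<close>.
  It is bounded below on a compact set carrying most of the measure of \<open>U\<close>, which is enough to
  remove a fixed fraction of the rest repeatedly.\<close>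

lemma finite_disjoint_exhaustion:
  fixes U :: "'a::euclidean_space set" and \<C> :: "'a set set"
  assumes U: "open U" "bounded U"
    and loc: "\<And>x. x \<in> U \<Longrightarrow> \<exists>r>0. \<exists>\<theta>>0. \<forall>y s. 0 < s \<longrightarrow> cball y s \<subseteq> ball x r \<longrightarrow>
        (\<exists>C\<in>\<C>. C \<subseteq> cball y s \<and> \<theta> * measure lebesgue (cball y s) \<le> measure lebesgue C)"
    and cpt: "\<And>C. C \<in> \<C> \<Longrightarrow> compact C"
    and e: "0 < e"
  obtains F where "finite F" "F \<subseteq> \<C>" "\<And>C. C \<in> F \<Longrightarrow> C \<subseteq> U" "pairwise disjnt F"
    "measure lebesgue (U - \<Union>F) < e"
proof -
  let ?\<mu> = "measure (lebesgue :: 'a measure)"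
  define adm where "adm F \<longleftrightarrow> finite F \<and> F \<subseteq> \<C> \<and> (\<forall>C\<in>F. C \<subseteq> U) \<and> pairwise disjnt F" for F
  have Um: "U \<in> lmeasurable" using U by (intro lmeasurable_open)
  \<comment> \<open>This closed subset of a bounded set is compact, and the discarded rest has less
    than half of the tolerated measure \<open>e\<close>.\<close>
  obtain C0 where C0: "closed C0" "C0 \<subseteq> U" "U - C0 \<in> lmeasurable"
    "emeasure lebesgue (U - C0) < ennreal (e / 2)"
    using sets_lebesgue_inner_closed[of U "e / 2"] Um e by (auto simp: fmeasurableD)
  then have C0c: "compact C0" using U bounded_subset compact_eq_bounded_closed by blast
  have UC0: "?\<mu> (U - C0) < e / 2"
    using C0(3,4) e by (simp add: emeasure_eq_measure2 ennreal_less_iff)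
  define Q where "Q x r \<theta> \<longleftrightarrow> 0 < r \<and> 0 < \<theta> \<and> (\<forall>y s. 0 < s \<longrightarrow> cball y s \<subseteq> ball x r \<longrightarrow>
        (\<exists>C\<in>\<C>. C \<subseteq> cball y s \<and> \<theta> * ?\<mu> (cball y s) \<le> ?\<mu> C))" for x r \<theta>
  have "\<forall>x\<in>C0. \<exists>r \<theta>. Q x r \<theta>"
  proof
    fix x assume "x \<in> C0"
    then have "x \<in> U" using C0(2) by blast
    from loc[OF this] show "\<exists>r \<theta>. Q x r \<theta>" unfolding Q_def by (elim exE conjE) (intro exI conjI)
  qed
  then obtain r \<theta> where r\<theta>: "\<And>x. x \<in> C0 \<Longrightarrow> Q x (r x) (\<theta> x)" by metis
  obtain X where X: "X \<subseteq> C0" "finite X" "C0 \<subseteq> (\<Union>x\<in>X. ball x (r x))"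
  proof (rule compactE_image[OF C0c, of C0 "\<lambda>x. ball x (r x)"])
    show "C0 \<subseteq> (\<Union>x\<in>C0. ball x (r x))" using r\<theta> unfolding Q_def by fastforce
  qed auto
  \<comment> \<open>The least density over the finite subcover; the inserted 1 covers an empty
    \<open>X\<close> and ensures \<open>t \<le> 1\<close>.\<close>
  define t where "t = Min (insert 1 (\<theta> ` X))"
  have t0: "0 < t" using X r\<theta> by (auto simp: t_def Q_def subset_iff)
  have t1: "t \<le> 1" using X by (simp add: t_def)
  have cell: "\<exists>C\<in>\<C>. C \<subseteq> cball y s \<and> t * ?\<mu> (cball y s) \<le> ?\<mu> C"
    if "x \<in> X" "0 < s" "cball y s \<subseteq> ball x (r x)" for x y s
  proof -
    have "t \<le> \<theta> x" using X that by (simp add: t_def)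
    then have "t * ?\<mu> (cball y s) \<le> \<theta> x * ?\<mu> (cball y s)" by (intro mult_right_mono) auto
    moreover have "Q x (r x) (\<theta> x)" using r\<theta> X(1) that(1) by blast
    then have "\<exists>C\<in>\<C>. C \<subseteq> cball y s \<and> \<theta> x * ?\<mu> (cball y s) \<le> ?\<mu> C"
      using that(2,3) unfolding Q_def by simp
    then obtain C where "C\<in>\<C>" "C \<subseteq> cball y s" "\<theta> x * ?\<mu> (cball y s) \<le> ?\<mu> C"
      by (elim bexE conjE)
    ultimately show ?thesis by (intro bexI[of _ C]) auto
  qed
  \<comment> \<open>As long as the rest measures at least \<open>e\<close>, at least half of it lies
    in \<open>C0\<close>. Finitely many Vitali balls catch half of that, and each contains an
    admissible set of density \<open>t\<close>; hence the factor \<open>1 - t / 4\<close>.\<close>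
  have step: "\<exists>F'. adm F' \<and> ?\<mu> (U - \<Union>F') \<le> (1 - t / 4) * ?\<mu> (U - \<Union>F)"
    if F: "adm F" and big: "e \<le> ?\<mu> (U - \<Union>F)" for F
  proof -
    have cF: "closed (\<Union>F)" using F cpt by (auto simp: adm_def intro!: closed_Union compact_imp_closed)
    then have oV: "open (U - \<Union>F)" using U by (intro open_Diff)
    have Vm: "U - \<Union>F \<in> lmeasurable" using U oV by (intro lmeasurable_open) (auto intro: bounded_subset)
    define S where "S = C0 - \<Union>F"
    have Sm: "S \<in> lmeasurable" unfolding S_def
      using C0c cF fmeasurable_Diff[of C0 lebesgue "\<Union>F"] by (simp add: lmeasurable_compact borel_closed)
    have Sbig: "?\<mu> (U - \<Union>F) / 2 \<le> ?\<mu> S"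
    proof -
      have "?\<mu> (U - \<Union>F) \<le> ?\<mu> (S \<union> (U - C0))"
        using C0 Sm Vm by (intro measure_mono_fmeasurable fmeasurable.Un)
          (auto simp: S_def fmeasurableD)
      also have "\<dots> \<le> ?\<mu> S + ?\<mu> (U - C0)" using C0 Sm by (intro measure_Un_le) (auto simp: fmeasurableD)
      finally show ?thesis using UC0 big by simp
    qed
    \<comment> \<open>Each ball lies in one ball of the subcover, for the sake of the density, and
      avoids the earlier sets, for the sake of disjointness.\<close>
    define I where "I = {(y, s). 0 < s \<and> cball y s \<subseteq> U - \<Union>F \<and> (\<exists>x\<in>X. cball y s \<subseteq> ball x (r x))}"
    obtain D where D: "countable D" "D \<subseteq> I"
       "pairwise (\<lambda>i j. disjnt (cball (fst i) (snd i)) (cball (fst j) (snd j))) D"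
       "negligible (S - (\<Union>i \<in> D. cball (fst i) (snd i)))"
    proof (rule Vitali_covering_theorem_cballs[of I snd S fst])
      show "0 < snd i" if "i \<in> I" for i using that by (auto simp: I_def)
      show "\<exists>i. i \<in> I \<and> y \<in> cball (fst i) (snd i) \<and> snd i < d" if y: "y \<in> S" and d: "0 < d" for y d
      proof -
        obtain x where x: "x \<in> X" "y \<in> ball x (r x)" using X y by (auto simp: S_def)
        have "open ((U - \<Union>F) \<inter> ball x (r x))" using oV by auto
        moreover have "y \<in> (U - \<Union>F) \<inter> ball x (r x)" using x y C0 by (auto simp: S_def)
        ultimately obtain s where s: "s > 0" "cball y s \<subseteq> (U - \<Union>F) \<inter> ball x (r x)"
          using open_contains_cball by meson
        let ?s = "min s (d / 2)"
        have "cball y ?s \<subseteq> cball y s" by auto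
        then have "cball y ?s \<subseteq> U - \<Union>F" "cball y ?s \<subseteq> ball x (r x)" using s(2) by auto
        then have "(y, ?s) \<in> I" using s(1) x(1) d unfolding I_def by auto
        then show ?thesis using s d by (intro exI[of _ "(y, ?s)"]) auto
      qed
    qed
    let ?B = "\<lambda>i. cball (fst i) (snd i)"
    have BV: "?B i \<subseteq> U - \<Union>F" if "i \<in> D" for i using subsetD[OF D(2) that] by (simp add: I_def split_beta)
    obtain D' where D': "D' \<subseteq> D" "finite D'" "?\<mu> S / 2 \<le> ?\<mu> (\<Union>(?B ` D'))"
    proof -
      have pos: "0 < ?\<mu> S" using Sbig big e by simp
      have m: "\<Union>(?B ` D) \<in> lmeasurable"
      proof (rule bounded_set_imp_lmeasurable)
        show "bounded (\<Union>(?B ` D))" using BV U(2) by (meson Diff_subset UN_least bounded_subset subset_trans)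
        show "\<Union>(?B ` D) \<in> sets lebesgue" using D(1) by (intro sets.countable_UN'') auto
      qed
      have "?\<mu> S \<le> ?\<mu> (\<Union>(?B ` D) \<union> (S - \<Union>(?B ` D)))"
        using Sm m by (intro measure_mono_fmeasurable fmeasurable.Un fmeasurable_Diff)
          (auto simp: fmeasurableD)
      also have "\<dots> \<le> ?\<mu> (\<Union>(?B ` D)) + ?\<mu> (S - \<Union>(?B ` D))"
        using Sm m by (intro measure_Un_le) (auto simp: fmeasurableD)
      also have "?\<mu> (S - \<Union>(?B ` D)) = 0" using D(4) negligible_imp_measure0 by blast
      finally have le: "?\<mu> S \<le> ?\<mu> (\<Union>(?B ` D))" by simp
      obtain \<D>' where \<D>': "\<D>' \<subseteq> ?B ` D" "finite \<D>'" "?\<mu> (\<Union>(?B ` D)) - ?\<mu> S / 2 < ?\<mu> (\<Union>\<D>')"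
      proof (rule measure_countable_Union_approachable[of "?B ` D" "?\<mu> S / 2" "?\<mu> U"])
        show "?\<mu> (\<Union>\<D>') \<le> ?\<mu> U" if "\<D>' \<subseteq> ?B ` D" "finite \<D>'" for \<D>'
        proof (rule measure_mono_fmeasurable[OF _ _ Um])
          show "\<Union>\<D>' \<subseteq> U" using that(1) BV by fastforce
          show "\<Union>\<D>' \<in> sets lebesgue" using that by (intro sets.finite_Union) auto
        qed
      qed (use D pos in auto)
      obtain J where J: "J \<subseteq> D" "finite J" "\<D>' = ?B ` J"
        using finite_subset_image[OF \<D>'(2,1)] by metis
      have "?\<mu> S / 2 \<le> ?\<mu> (\<Union>(?B ` J))" using \<D>'(3) le unfolding J(3) by linarith
      then show ?thesis by (rule that[OF J(1,2)])
    qed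
    have "\<forall>i\<in>D'. \<exists>C\<in>\<C>. C \<subseteq> ?B i \<and> t * ?\<mu> (?B i) \<le> ?\<mu> C"
    proof
      fix i assume "i \<in> D'"
      then have "i \<in> I" using D'(1) D(2) by blast
      then obtain x where "x \<in> X" "0 < snd i" "?B i \<subseteq> ball x (r x)"
        by (auto simp: I_def split_beta)
      then show "\<exists>C\<in>\<C>. C \<subseteq> ?B i \<and> t * ?\<mu> (?B i) \<le> ?\<mu> C" by (rule cell)
    qed
    then obtain c where c: "\<And>i. i \<in> D' \<Longrightarrow> c i \<in> \<C> \<and> c i \<subseteq> ?B i \<and> t * ?\<mu> (?B i) \<le> ?\<mu> (c i)"
      by metis
    have dis: "disjnt (c i) (c j)" if "i \<in> D'" "j \<in> D'" "i \<noteq> j" for i j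
    proof -
      have "disjnt (?B i) (?B j)" using D(3) D'(1) that by (auto simp: pairwise_def)
      then show ?thesis using c[OF that(1)] c[OF that(2)] by (auto simp: disjnt_def)
    qed
    have cm: "c i \<in> lmeasurable" if "i \<in> D'" for i using c[OF that] cpt by (auto intro: lmeasurable_compact)
    define F' where "F' = F \<union> c ` D'"
    have cU: "c i \<subseteq> U - \<Union>F" if "i \<in> D'" for i
      using c[OF that] BV[of i] D'(1) that by auto
    have "adm F'"
      unfolding adm_def F'_def
    proof (intro conjI)
      show "pairwise disjnt (F \<union> c ` D')"
        unfolding pairwise_def
      proof (intro ballI impI)
        fix A B assume AB: "A \<in> F \<union> c ` D'" "B \<in> F \<union> c ` D'" "A \<noteq> B"
        have FF: "disjnt A B" if "A \<in> F" "B \<in> F" using F AB(3) that by (auto simp: adm_def pairwise_def)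
        have Fc: "disjnt A (c i)" if "A \<in> F" "i \<in> D'" for A i using cU that by (fastforce simp: disjnt_def)
        have cc: "disjnt (c i) (c j)" if "i \<in> D'" "j \<in> D'" "A = c i" "B = c j" for i j
          using dis[OF that(1,2)] AB(3) that by blast
        from AB(1,2) show "disjnt A B"
          by (elim UnE imageE) (metis FF Fc cc disjnt_sym)+
      qed
      show "finite (F \<union> c ` D')" using F D' by (simp add: adm_def)
      show "F \<union> c ` D' \<subseteq> \<C>" using F c by (auto simp: adm_def)
      show "\<forall>C\<in>F \<union> c ` D'. C \<subseteq> U" using F cU unfolding adm_def by blast
    qed
    moreover have "?\<mu> (U - \<Union>F') \<le> (1 - t / 4) * ?\<mu> (U - \<Union>F)"
    proof -
      have um: "\<Union>(c ` D') \<in> lmeasurable" using D' cm by (intro fmeasurable.finite_UN) auto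
      have "U - \<Union>F' = (U - \<Union>F) - \<Union>(c ` D')" by (auto simp: F'_def)
      then have "?\<mu> (U - \<Union>F') = ?\<mu> (U - \<Union>F) - ?\<mu> (\<Union>(c ` D'))"
        using um Vm cU by (simp add: measurable_measure_Diff fmeasurableD UN_least)
      also have "?\<mu> (\<Union>(c ` D')) = (\<Sum>i\<in>D'. ?\<mu> (c i))"
      proof (rule measure_finite_Union)
        show "c ` D' \<subseteq> sets lebesgue" using cm by (blast intro: fmeasurableD)
        show "disjoint_family_on c D'"
          using dis unfolding disjoint_family_on_def disjnt_def by blast
        show "emeasure lebesgue (c i) \<noteq> \<infinity>" if "i \<in> D'" for i
          using fmeasurableD2[OF cm[OF that]] unfolding infinity_ennreal_def .
      qed (use D' in auto)
      finally have 1: "?\<mu> (U - \<Union>F') = ?\<mu> (U - \<Union>F) - (\<Sum>i\<in>D'. ?\<mu> (c i))" .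
      have "t * ?\<mu> (\<Union>(?B ` D')) \<le> t * (\<Sum>i\<in>D'. ?\<mu> (?B i))"
        using D' t0 by (intro mult_left_mono measure_UNION_le) auto
      also have "\<dots> \<le> (\<Sum>i\<in>D'. ?\<mu> (c i))" unfolding sum_distrib_left using c by (intro sum_mono) auto
      finally have "t * ?\<mu> (\<Union>(?B ` D')) \<le> (\<Sum>i\<in>D'. ?\<mu> (c i))" .
      then have "t * (?\<mu> (U - \<Union>F) / 4) \<le> (\<Sum>i\<in>D'. ?\<mu> (c i))"
      proof -
        have "?\<mu> (U - \<Union>F) / 4 \<le> ?\<mu> (\<Union>(?B ` D'))" using D'(3) Sbig by linarith
        then have "t * (?\<mu> (U - \<Union>F) / 4) \<le> t * ?\<mu> (\<Union>(?B ` D'))"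
          using t0 by (intro mult_left_mono) auto
        also note \<open>\<dots> \<le> (\<Sum>i\<in>D'. ?\<mu> (c i))\<close>
        finally show ?thesis .
      qed
      then show ?thesis using 1 by (simp add: algebra_simps)
    qed
    ultimately show ?thesis by blast
  qed
  \<comment> \<open>The first alternative absorbs the case that the tolerance is reached early,
    after which the family is kept.\<close>
  have iter: "\<exists>F. adm F \<and> (?\<mu> (U - \<Union>F) < e \<or> ?\<mu> (U - \<Union>F) \<le> (1 - t / 4) ^ n * ?\<mu> U)" for n
  proof (induction n)
    case 0
    then show ?case by (intro exI[of _ "{}"]) (auto simp: adm_def)
  next
    case (Suc n)
    then obtain F where F: "adm F" "?\<mu> (U - \<Union>F) < e \<or> ?\<mu> (U - \<Union>F) \<le> (1 - t / 4) ^ n * ?\<mu> U"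
      by blast
    show ?case
    proof (cases "?\<mu> (U - \<Union>F) < e")
      case False
      then obtain F' where F': "adm F'" "?\<mu> (U - \<Union>F') \<le> (1 - t / 4) * ?\<mu> (U - \<Union>F)"
        using step F(1) by force
      note F'(2)
      also have "(1 - t / 4) * ?\<mu> (U - \<Union>F) \<le> (1 - t / 4) * ((1 - t / 4) ^ n * ?\<mu> U)"
        using F(2) False t1 by (intro mult_left_mono) auto
      finally show ?thesis using F'(1) by (auto simp: mult.assoc)
    qed (use F in blast)
  qed
  have "(\<lambda>n. (1 - t / 4) ^ n * ?\<mu> U) \<longlonglongrightarrow> 0 * ?\<mu> U"
    using t0 t1 by (intro tendsto_intros LIMSEQ_power_zero) auto
  then have "\<forall>\<^sub>F n in sequentially. (1 - t / 4) ^ n * ?\<mu> U < e"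
    using e by (intro order_tendstoD) auto
  then obtain n where n: "(1 - t / 4) ^ n * ?\<mu> U < e" by (auto simp: eventually_sequentially)
  obtain F where "adm F" "?\<mu> (U - \<Union>F) < e" using iter[of n] n by force
  then show ?thesis using that[of F] by (auto simp: adm_def)
qed

section \<open>Iteration\<close>

lemma cell_mono: "cell \<epsilon> \<kappa> E K u C \<Longrightarrow> \<epsilon> \<le> \<epsilon>' \<Longrightarrow> cell \<epsilon>' \<kappa> E K u C"
proof -
  assume "cell \<epsilon> \<kappa> E K u C" and le: "\<epsilon> \<le> \<epsilon>'"
  then obtain w T W where c: "compact C" "cell_data \<epsilon> \<kappa> E K u C w T W" by (auto simp: cell_def)
  have "cell_data \<epsilon>' \<kappa> E K u C w T W"
    using c(2) unfolding cell_data_def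
    by (elim conjE) (intro conjI; blast intro: order_trans[OF _ le])
  then show ?thesis using c(1) by (auto simp: cell_def)
qed

lemma measure_cball_le: "0 < s \<Longrightarrow> measure lebesgue (cball (y::real^2) s) \<le> 4 * s\<^sup>2"
proof -
  assume s: "0 < s"
  let ?l = "y - vector [s, s]" and ?r = "y + vector [s, s]"
  have "cball y s \<subseteq> cbox ?l ?r"
  proof
    fix z assume "z \<in> cball y s"
    then have "\<bar>(z - y)$1\<bar> \<le> s" "\<bar>(z - y)$2\<bar> \<le> s"
      using component_le_norm_cart[of "z - y"] by (auto simp: dist_norm norm_minus_commute intro: order_trans)
    then show "z \<in> cbox ?l ?r" by (simp add: mem_box_cart forall_2 abs_le_iff algebra_simps)
  qed
  then have "measure lebesgue (cball y s) \<le> measure lebesgue (cbox ?l ?r)"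
    by (intro measure_mono_fmeasurable) auto
  also have "\<dots> = (\<Prod>i\<in>UNIV. ?r$i - ?l$i)" using s
    by (subst content_cbox_cart[symmetric]) (auto simp: interval_ne_empty_cart forall_2)
  also have "\<dots> = 4 * s\<^sup>2" by (simp add: UNIV_2 power2_eq_square)
  finally show ?thesis .
qed

text \<open>None of the parameters depends on the ball \<open>cball y s\<close>: \<delta> makes the
  slopes in the second direction harmless, \<omega> bounds the oscillation of the gradient, and
  \<open>r\<close> controls both this oscillation and the size of the perturbation. A rectangle of
  the same shape, scaled with \<open>s\<close>, then fits into every such ball, which gives the
  density.\<close>

lemma cell_local:
  assumes K: "open K" and V: "open V" "C1_in V u K" "x \<in> V" and \<epsilon>: "0 < \<epsilon>"
    and lam: "\<And>\<xi>. \<xi> \<in> K \<Longrightarrow> \<exists>a. \<xi> + outer a (axis 1 1) \<in> E \<and> \<xi> - outer ((1/2) *\<^sub>R a) (axis 1 1) \<in> K"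
  shows "\<exists>r>0. \<exists>\<theta>>0. \<forall>y s. 0 < s \<longrightarrow> cball y s \<subseteq> ball x r \<longrightarrow>
        (\<exists>C\<in>{C. cell \<epsilon> (1/48) E K u C}. C \<subseteq> cball y s \<and> \<theta> * measure lebesgue (cball y s) \<le> measure lebesgue C)"
proof -
  define \<xi> where "\<xi> = jacobian u (at x)"
  have \<xi>: "\<xi> \<in> K" using V by (simp add: C1_in_def \<xi>_def)
  obtain a where a: "\<xi> + outer a (axis 1 1) \<in> E" "\<xi> - outer ((1/2) *\<^sub>R a) (axis 1 1) \<in> K"
    using lam[OF \<xi>] by blast
  obtain e where e: "0 < e" "ball \<xi> e \<subseteq> K" using K \<xi> open_contains_ball by blast
  \<comment> \<open>Small enough that \<open>outer a p\<close> has norm below \<open>e\<close> for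
    the slopes \<open>p\<close> of length \<delta>; the added 1 allows \<open>a = 0\<close>.\<close>
  define \<delta> where "\<delta> = e / (2 * (norm a + 1))"
  have \<delta>: "0 < \<delta>" using e by (simp add: \<delta>_def add_nonneg_pos)
  have a\<delta>: "norm a * \<delta> < e"
  proof -
    have "norm a * \<delta> \<le> (norm a + 1) * \<delta>" using \<delta> by (intro mult_right_mono) auto
    also have "\<dots> = e / 2"
    proof -
      have "m * (e / (2 * m)) = e / 2" if "m \<noteq> 0" for m :: real using that by simp
      moreover have "norm a + 1 \<noteq> 0" using norm_ge_zero[of a] by linarith
      ultimately show ?thesis unfolding \<delta>_def by blast
    qed
    finally show ?thesis using e by simp
  qed
  \<comment> \<open>By \<open>gauge_norm\<close> a rectangle of gauge radius \<rho> lies in a ball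
    of radius \<open>c * \<rho>\<close>.\<close>
  define c where "c = 2 + 1 / \<delta>"
  have c: "2 < c" using \<delta> by (simp add: c_def)
  define q where "q = 1 + 2 * c * (1 + \<delta>)"
  have q: "0 < q" using c \<delta> by (simp add: q_def add_pos_pos)
  define \<omega> where "\<omega> = e / (2 * q)"
  have \<omega>: "0 < \<omega>" "\<omega> * q < e" using e q by (simp_all add: \<omega>_def)
  have "open (V \<inter> (\<lambda>z. jacobian u (at z)) -` ball \<xi> \<omega>)"
    using V by (intro continuous_open_preimage) (auto simp: C1_in_def)
  moreover have "x \<in> V \<inter> (\<lambda>z. jacobian u (at z)) -` ball \<xi> \<omega>" using V \<omega> by (simp add: \<xi>_def)
  ultimately obtain r1 where r1: "0 < r1" "ball x r1 \<subseteq> V \<inter> (\<lambda>z. jacobian u (at z)) -` ball \<xi> \<omega>"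
    using open_contains_ball by meson
  define Q where "Q = \<omega> * c + norm a"
  have Q: "0 < Q" using \<omega> c by (simp add: Q_def add_pos_nonneg)
  define r where "r = min r1 (\<epsilon> / Q)"
  have r: "0 < r" using r1 \<epsilon> Q by (simp add: r_def)
  \<comment> \<open>The area \<open>6 * \<rho>\<^sup>2 / \<delta>\<close> with
    \<open>\<rho> = s / c\<close>, divided by the bound \<open>4 * s\<^sup>2\<close> for the
    disc.\<close>
  define \<theta> where "\<theta> = 6 / (4 * \<delta> * c\<^sup>2)"
  have \<theta>: "0 < \<theta>" using \<delta> c by (simp add: \<theta>_def)
  have "\<exists>C\<in>{C. cell \<epsilon> (1/48) E K u C}. C \<subseteq> cball y s \<and> \<theta> * measure lebesgue (cball y s) \<le> measure lebesgue C"
    if s: "0 < s" and sub: "cball y s \<subseteq> ball x r" for y s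
  proof -
    define \<rho> where "\<rho> = s / c"
    have \<rho>: "0 < \<rho>" "c * \<rho> = s" using s c by (simp_all add: \<rho>_def)
    let ?C = "{z. rgauge \<delta> (z - y) \<le> \<rho>}"
    have CB: "?C \<subseteq> cball y s"
      using gauge_norm[OF \<delta>] \<rho> by (auto simp: c_def[symmetric] dist_norm norm_minus_commute)
    interpret box_cell \<delta> \<rho> \<omega> y a \<xi> u "ball x r1" E K e
    proof
      show "\<xi> + outer a p \<in> K" if "p \<in> slopes \<delta>" "p \<noteq> axis 1 1" for p
      proof -
        have "p = - (1/2) *\<^sub>R axis 1 1 \<or> norm (outer a p) = norm a * \<delta>"
          using that \<delta> by (auto simp: slopes_def norm_outer)
        then show ?thesis
        proof
          assume "p = - (1/2) *\<^sub>R axis 1 1"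
          then have "\<xi> + outer a p = \<xi> - outer ((1/2) *\<^sub>R a) (axis 1 1)"
            by (simp add: outer_def vec_eq_iff)
          then show ?thesis using a(2) by simp
        next
          assume "norm (outer a p) = norm a * \<delta>"
          then have "\<xi> + outer a p \<in> ball \<xi> e" using a\<delta> by (simp add: dist_norm)
          then show ?thesis using e(2) by blast
        qed
      qed
      show "\<omega> * (1 + 2 * (2 + 1 / \<delta>) * (1 + \<delta>)) < e" using \<omega>(2) by (simp add: q_def c_def)
      show "{z. rgauge \<delta> (z - y) \<le> \<rho>} \<subseteq> ball x r1" using CB sub by (auto simp: r_def)
      show "C1_in (ball x r1) u UNIV" using V(2) r1 by (auto simp: C1_in_def intro: continuous_on_subset)
      show "norm (jacobian u (at z) - \<xi>) \<le> \<omega>" if "z \<in> ball x r1" for z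
        using r1 that by (auto simp: dist_norm norm_minus_commute)
    qed (use \<delta> \<rho> \<omega> a e in auto)
    have "s < r" using sub s zero_le_dist[of y x] unfolding cball_subset_ball_iff by linarith
    then have "\<rho> * (\<omega> * (2 + 1 / \<delta>) + norm a) \<le> \<epsilon>"
    proof -
      have "\<rho> \<le> s" using \<rho> c mult_right_mono[of 1 c \<rho>] by simp
      then have "\<rho> * Q \<le> (\<epsilon> / Q) * Q" using \<open>s < r\<close> Q by (intro mult_right_mono) (auto simp: r_def)
      then show ?thesis using Q by (simp add: Q_def c_def)
    qed
    then have "cell \<epsilon> (1/48) E K u ?C" using cell cell_mono by blast
    moreover have "\<theta> * measure lebesgue (cball y s) \<le> measure lebesgue ?C"
    proof -
      have "\<theta> * measure lebesgue (cball y s) \<le> \<theta> * (4 * s\<^sup>2)"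
        using \<theta> measure_cball_le[OF s] by (intro mult_left_mono) auto
      also have "\<dots> = 6 * \<rho>\<^sup>2 / \<delta>"
        using c unfolding \<theta>_def \<rho>(2)[symmetric] by (simp add: power_mult_distrib)
      finally show ?thesis unfolding measure_C .
    qed
    ultimately show ?thesis using CB by blast
  qed
  then show ?thesis using r \<theta> by blast
qed

text \<open>The inclusion is solved on \<open>S\<close> and remains to be solved on \<open>V\<close>.\<close>

definition stage ::
  "(real^2^2) set \<Rightarrow> (real^2^2) set \<Rightarrow> (real^2 \<Rightarrow> real^2) \<Rightarrow> (real^2) set \<Rightarrow>
   (real^2 \<Rightarrow> real^2) \<Rightarrow> (real^2) set \<Rightarrow> (real^2) set \<Rightarrow> bool" where
  "stage E K \<phi> U u V S \<longleftrightarrow> open V \<and> open S \<and> V \<subseteq> U \<and> S \<subseteq> U \<and> V \<inter> S = {} \<and> negligible (U - (V \<union> S)) \<and>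
     (\<exists>L. L-lipschitz_on UNIV (\<lambda>x. u x - \<phi> x)) \<and>
     (\<exists>C. compact C \<and> C \<subseteq> U \<and> (\<forall>x. x \<notin> C \<longrightarrow> u x = \<phi> x)) \<and>
     C1_in V u K \<and> (\<forall>x\<in>S. \<exists>M\<in>E. (u has_derivative (\<lambda>h. M *v h)) (at x))"

lemma lipschitz_on_sum:
  fixes f :: "'i \<Rightarrow> 'a::metric_space \<Rightarrow> 'b::real_normed_vector"
  assumes "finite I" "\<And>i. i \<in> I \<Longrightarrow> \<exists>L. L-lipschitz_on S (f i)"
  shows "\<exists>L. L-lipschitz_on S (\<lambda>x. \<Sum>i\<in>I. f i x)"
  using assms
proof (induction I)
  case empty
  then show ?case using lipschitz_on_constant by auto
next
  case (insert i I)
  then obtain L M where "L-lipschitz_on S (f i)" "M-lipschitz_on S (\<lambda>x. \<Sum>i\<in>I. f i x)" by blast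
  from lipschitz_on_add[OF this] show ?case using insert.hyps by auto
qed

text \<open>Disjoint cells cover at least half of \<open>V\<close> and each solves 1/48 of itself,
  so a fraction 1/96 of \<open>V\<close> leaves the unsolved part. All changes happen in cells
  inside \<open>V\<close>, so the solved set is never touched again.\<close>

lemma stage_step:
  assumes K: "open K"
    and lam: "\<And>\<xi>. \<xi> \<in> K \<Longrightarrow> \<exists>a. \<xi> + outer a (axis 1 1) \<in> E \<and> \<xi> - outer ((1/2) *\<^sub>R a) (axis 1 1) \<in> K"
    and U: "bounded U" and st: "stage E K \<phi> U u V S" and \<epsilon>: "0 < \<epsilon>"
  obtains u' V' S' where "stage E K \<phi> U u' V' S'" "V' \<subseteq> V" "S \<subseteq> S'"
    "measure lebesgue V' \<le> (95/96) * measure lebesgue V"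
    "\<And>x. norm (u' x - u x) \<le> \<epsilon>" "\<And>x. x \<notin> V \<Longrightarrow> u' x = u x"
proof (cases "measure lebesgue V = 0")
  \<comment> \<open>A null unsolved part leaves no positive tolerance for the exhaustion, so the
    stage is repeated.\<close>
  case True
  then show ?thesis using st \<epsilon> by (intro that[of u V S]) auto
next
  case False
  let ?\<mu> = "measure (lebesgue :: (real^2) measure)"
  have V: "open V" "V \<subseteq> U" "C1_in V u K" and S: "open S" "S \<subseteq> U" "V \<inter> S = {}" "negligible (U - (V \<union> S))"
    and SE: "\<And>x. x \<in> S \<Longrightarrow> \<exists>M\<in>E. (u has_derivative (\<lambda>h. M *v h)) (at x)"
    using st by (auto simp: stage_def)
  have Vm: "V \<in> lmeasurable" using V U bounded_subset by (auto intro: lmeasurable_open)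
  have pos: "0 < ?\<mu> V" using False by (simp add: zero_less_measure_iff)
  obtain F where F: "finite F" "F \<subseteq> {C. cell \<epsilon> (1/48) E K u C}" "\<And>C. C \<in> F \<Longrightarrow> C \<subseteq> V"
    "pairwise disjnt F" "?\<mu> (V - \<Union>F) < ?\<mu> V / 2"
  proof (rule finite_disjoint_exhaustion[of V "{C. cell \<epsilon> (1/48) E K u C}" "?\<mu> V / 2"])
    show "bounded V" using V U bounded_subset by blast
  qed (use V(1) pos cell_local[OF K V(1,3) _ \<epsilon> lam] in \<open>auto simp: cell_def\<close>)
  have cpt: "compact C" if "C \<in> F" for C using that F(2) by (auto simp: cell_def)
  have "\<forall>C\<in>F. \<exists>w T W. cell_data \<epsilon> (1/48) E K u C w T W" using F(2) by (auto simp: cell_def)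
  then obtain w T W where *: "\<And>C. C \<in> F \<Longrightarrow> cell_data \<epsilon> (1/48) E K u C (w C) (T C) (W C)" by metis
  have oT: "open (T C)" and oW: "open (W C)" and TW: "T C \<inter> W C = {}" "T C \<subseteq> C" "W C \<subseteq> C"
    and neg: "negligible (C - (T C \<union> W C))" and mT: "(1/48) * ?\<mu> C \<le> ?\<mu> (T C)"
    and lip: "\<exists>L. L-lipschitz_on UNIV (w C)" and w0: "\<And>z. z \<notin> C \<Longrightarrow> w C z = 0" and we: "\<And>z. norm (w C z) \<le> \<epsilon>"
    and TE: "\<And>z. z \<in> T C \<Longrightarrow> \<exists>M\<in>E. ((\<lambda>x. u x + w C x) has_derivative (\<lambda>h. M *v h)) (at z)"
    and WK: "C1_in (W C) (\<lambda>x. u x + w C x) K" if "C \<in> F" for C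
    using *[OF that] by (auto simp: cell_data_def)
  define u' where "u' x = u x + (\<Sum>C\<in>F. w C x)" for x
  have dis: "z \<notin> D" if "C \<in> F" "D \<in> F" "D \<noteq> C" "z \<in> C" for C D z
    using F(4) that unfolding pairwise_def disjnt_def by blast
  \<comment> \<open>The cells are disjoint, so at a point of \<open>C\<close> all other
    perturbations vanish.\<close>
  have u'C: "u' z = u z + w C z" if "C \<in> F" "z \<in> C" for C z
  proof -
    have "(\<Sum>D\<in>F. w D z) = (\<Sum>D\<in>F. if D = C then w C z else 0)"
      using dis[OF that(1) _ _ that(2)] w0 by (intro sum.cong) auto
    then show ?thesis using F(1) that(1) by (simp add: u'_def)
  qed
  have u'out: "u' z = u z" if "z \<notin> \<Union>F" for z
    using w0 that by (auto simp: u'_def intro!: sum.neutral)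
  define V' where "V' = (V - \<Union>F) \<union> (\<Union>C\<in>F. W C)"
  define S' where "S' = S \<union> (\<Union>C\<in>F. T C)"
  have cF: "closed (\<Union>F)" using F(1) cpt by (auto intro!: closed_Union compact_imp_closed)
  have FV: "\<Union>F \<subseteq> V" using F(3) by blast
  have V'V: "V' \<subseteq> V" using TW(3) FV by (fastforce simp: V'_def)
  have oV: "open (V - \<Union>F)" using V(1) cF by (rule open_Diff)
  have "stage E K \<phi> U u' V' S'"
    unfolding stage_def
  proof (intro conjI)
    show "open V'" unfolding V'_def using oV oW by auto
    show "open S'" unfolding S'_def using S(1) oT by (intro open_Un open_UN ballI)
    show "V' \<subseteq> U" using V'V V by blast
    show "S' \<subseteq> U"
      unfolding S'_def using S(2) subset_trans[OF TW(2) subset_trans[OF F(3) V(2)]]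
      by (intro Un_least UN_least)
    show "V' \<inter> S' = {}"
    proof -
      have "V' \<inter> S = {}" using V'V S(3) by blast
      moreover have "V' \<inter> T C = {}" if C: "C \<in> F" for C
      proof -
        have "(V - \<Union>F) \<inter> T C = {}" using TW(2)[OF C] C by blast
        moreover have "W D \<inter> T C = {}" if "D \<in> F" for D
          using TW[OF C] TW(3)[OF that] dis[OF C that] by (cases "D = C") blast+
        ultimately show ?thesis by (auto simp: V'_def)
      qed
      ultimately show ?thesis by (auto simp: S'_def)
    qed
    show "negligible (U - (V' \<union> S'))"
    proof (rule negligible_subset)
      show "negligible ((U - (V \<union> S)) \<union> (\<Union>C\<in>F. C - (T C \<union> W C)))"
        using S(4) neg F(1) by (auto intro!: negligible_Un negligible_Union)
      show "U - (V' \<union> S') \<subseteq> (U - (V \<union> S)) \<union> (\<Union>C\<in>F. C - (T C \<union> W C))"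
        unfolding V'_def S'_def by blast
    qed
    obtain L where "L-lipschitz_on UNIV (\<lambda>x. u x - \<phi> x)" using st by (auto simp: stage_def)
    moreover obtain M where "M-lipschitz_on UNIV (\<lambda>x. \<Sum>C\<in>F. w C x)"
      using lipschitz_on_sum[OF F(1), of UNIV w] lip by blast
    ultimately have "(L + M)-lipschitz_on UNIV (\<lambda>x. (u x - \<phi> x) + (\<Sum>C\<in>F. w C x))"
      by (rule lipschitz_on_add)
    then show "\<exists>L. L-lipschitz_on UNIV (\<lambda>x. u' x - \<phi> x)"
      unfolding u'_def by (intro exI[of _ "L + M"]) (simp add: algebra_simps)
    obtain C where C: "compact C" "C \<subseteq> U" "\<And>x. x \<notin> C \<Longrightarrow> u x = \<phi> x" using st by (auto simp: stage_def)
    show "\<exists>C. compact C \<and> C \<subseteq> U \<and> (\<forall>x. x \<notin> C \<longrightarrow> u' x = \<phi> x)"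
      using C cpt F(1) FV V(2) u'out
      by (intro exI[of _ "C \<union> \<Union>F"]) (auto intro!: compact_Un compact_Union)
    show "C1_in V' u' K"
      unfolding V'_def
    proof (intro C1_in_Un oV open_UN ballI oW C1_in_UN)
      show "C1_in (V - \<Union>F) u' K"
        using u'out by (intro C1_in_cong[OF oV _ C1_in_subset[OF V(3)]]) auto
      show "C1_in (W C) u' K" if "C \<in> F" for C
        using u'C[OF that] TW(3)[OF that] by (intro C1_in_cong[OF oW[OF that] _ WK[OF that]]) auto
    qed
    show "\<forall>x\<in>S'. \<exists>M\<in>E. (u' has_derivative (*v) M) (at x)"
    proof
      fix x assume "x \<in> S'"
      then consider "x \<in> S" | C where "C \<in> F" "x \<in> T C" by (auto simp: S'_def)
      then show "\<exists>M\<in>E. (u' has_derivative (*v) M) (at x)"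
      proof cases
        case 1
        then obtain M where M: "M \<in> E" "(u has_derivative (*v) M) (at x)" using SE by blast
        have "(u' has_derivative (*v) M) (at x)"
          using u'out S(3) FV
          by (intro has_derivative_transform_within_open[OF M(2) S(1) 1]) (metis disjoint_iff subsetD)
        then show ?thesis using M(1) by blast
      next
        case 2
        then obtain M where M: "M \<in> E" "((\<lambda>x. u x + w C x) has_derivative (*v) M) (at x)" using TE by blast
        have "(u' has_derivative (*v) M) (at x)"
          using u'C[OF 2(1)] TW(2)[OF 2(1)]
          by (intro has_derivative_transform_within_open[OF M(2) oT[OF 2(1)] 2(2)]) auto
        then show ?thesis using M(1) by blast
      qed
    qed
  qed
  moreover have "S \<subseteq> S'" by (auto simp: S'_def)
  moreover have "?\<mu> V' \<le> (95/96) * ?\<mu> V"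
  proof -
    have Cm: "C \<in> lmeasurable" if "C \<in> F" for C using cpt[OF that] by (rule lmeasurable_compact)
    have Tm: "T C \<in> lmeasurable" if "C \<in> F" for C
      using oT[OF that] TW(2)[OF that] cpt[OF that] by (meson lmeasurable_open bounded_subset compact_imp_bounded)
    have Fm: "\<Union>F \<in> lmeasurable" using F(1) cpt by (auto intro!: lmeasurable_compact compact_Union)
    have UTm: "(\<Union>C\<in>F. T C) \<in> lmeasurable" using F(1) Tm by (intro fmeasurable.finite_UN) auto
    have "?\<mu> (V - \<Union>F) = ?\<mu> V - ?\<mu> (\<Union>F)"
      using Vm Fm FV by (intro measurable_measure_Diff) (auto simp: fmeasurableD)
    then have "?\<mu> V / 2 \<le> ?\<mu> (\<Union>F)" using F(5) by linarith
    also have "?\<mu> (\<Union>F) \<le> (\<Sum>C\<in>F. ?\<mu> C)" using F(1) Cm by (intro measure_Union_le) (auto simp: fmeasurableD)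
    also have "\<dots> \<le> (\<Sum>C\<in>F. 48 * ?\<mu> (T C))" using mT by (intro sum_mono) force
    also have "\<dots> = 48 * ?\<mu> (\<Union>C\<in>F. T C)"
    proof -
      have "?\<mu> (\<Union>C\<in>F. T C) = (\<Sum>C\<in>F. ?\<mu> (T C))"
      proof (rule measure_finite_Union[OF F(1)])
        show "T ` F \<subseteq> sets lebesgue" using Tm by (blast intro: fmeasurableD)
        show "disjoint_family_on T F"
          unfolding disjoint_family_on_def using TW(2) dis by blast
        show "emeasure lebesgue (T C) \<noteq> \<infinity>" if "C \<in> F" for C
          using fmeasurableD2[OF Tm[OF that]] unfolding infinity_ennreal_def .
      qed
      then show ?thesis by (simp add: sum_distrib_left)
    qed
    finally have T: "?\<mu> V / 96 \<le> ?\<mu> (\<Union>C\<in>F. T C)" by simp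
    have TV: "(\<Union>C\<in>F. T C) \<subseteq> V" using TW(2) FV by blast
    have "V' \<subseteq> V - (\<Union>C\<in>F. T C)"
    proof -
      have "x \<notin> T C" if x: "x \<in> V'" and C: "C \<in> F" for x C
      proof
        assume T: "x \<in> T C"
        then have xC: "x \<in> C" using TW(2)[OF C] by blast
        then obtain D where D: "D \<in> F" "x \<in> W D" using x C by (auto simp: V'_def)
        then have "D = C" using dis[OF C D(1) _ xC] TW(3)[OF D(1)] by blast
        then show False using T D TW(1)[OF C] by blast
      qed
      then show ?thesis using V'V by blast
    qed
    then have "?\<mu> V' \<le> ?\<mu> (V - (\<Union>C\<in>F. T C))"
    proof (intro measure_mono_fmeasurable fmeasurable_Diff Vm)
      have "open V'" unfolding V'_def using oV oW by (intro open_Un open_UN ballI)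
      moreover have "bounded V'" using V'V V(2) U by (meson bounded_subset)
      ultimately show "V' \<in> sets lebesgue" by (intro fmeasurableD lmeasurable_open)
    qed (use UTm in \<open>auto simp: fmeasurableD\<close>)
    also have "\<dots> = ?\<mu> V - ?\<mu> (\<Union>C\<in>F. T C)"
      using Vm UTm TV by (intro measurable_measure_Diff) (auto simp: fmeasurableD)
    finally show ?thesis using T by linarith
  qed
  moreover have "norm (u' x - u x) \<le> \<epsilon>" for x
  proof (cases "x \<in> \<Union>F")
    case True
    then obtain C where "C \<in> F" "x \<in> C" by blast
    then show ?thesis using u'C we by simp
  next
    case False
    then show ?thesis using u'out \<epsilon> by simp
  qed
  moreover have "u' x = u x" if "x \<notin> V" for x using u'out FV that by blast
  ultimately show ?thesis using that V'V by blast
qed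


text \<open>The increments \<open>(1/2) ^ n\<close> are prescribed to be summable, which later makes
  the maps converge uniformly; the sets \<open>V n\<close> shrink by the factor 95/96 in
  measure.\<close>

lemma stage_sequence:
  assumes K: "open K"
    and lam: "\<And>\<xi>. \<xi> \<in> K \<Longrightarrow> \<exists>a. \<xi> + outer a (axis 1 1) \<in> E \<and> \<xi> - outer ((1/2) *\<^sub>R a) (axis 1 1) \<in> K"
    and U: "open U" "bounded U" and \<phi>: "C1_in U \<phi> K"
  obtains u :: "nat \<Rightarrow> real^2 \<Rightarrow> real^2" and V S :: "nat \<Rightarrow> (real^2) set" where
    "\<And>n. stage E K \<phi> U (u n) (V n) (S n)" "negligible (U - (\<Union>n. S n))"
    "\<And>n x. norm (u (Suc n) x - u n x) \<le> (1/2) ^ n"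
    "\<And>n m x. n \<le> m \<Longrightarrow> x \<in> S n \<Longrightarrow> u m x = u n x"
proof -
  let ?\<mu> = "measure (lebesgue :: (real^2) measure)"
  define P where "P n s \<longleftrightarrow> (case s of (u, V, S) \<Rightarrow> stage E K \<phi> U u V S)"
    for n :: nat and s :: "(real^2 \<Rightarrow> real^2) \<times> (real^2) set \<times> (real^2) set"
  define R where "R n s s' \<longleftrightarrow> (case s of (u, V, S) \<Rightarrow> case s' of (u', V', S') \<Rightarrow>
      V' \<subseteq> V \<and> S \<subseteq> S' \<and> ?\<mu> V' \<le> (95/96) * ?\<mu> V \<and>
      (\<forall>x. norm (u' x - u x) \<le> (1/2) ^ n) \<and> (\<forall>x. x \<notin> V \<longrightarrow> u' x = u x))"
    for n :: nat and s s' :: "(real^2 \<Rightarrow> real^2) \<times> (real^2) set \<times> (real^2) set"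
  have "\<exists>f. \<forall>n. P n (f n) \<and> R n (f n) (f (Suc n))"
  proof (rule dependent_nat_choice)
    have "\<exists>L. L-lipschitz_on UNIV (\<lambda>x. \<phi> x - \<phi> x)"
      using lipschitz_on_constant[of UNIV "0 :: real^2"] by auto
    then have "stage E K \<phi> U \<phi> U {}" using U \<phi> by (auto simp: stage_def)
    then show "\<exists>s. P 0 s" by (auto simp: P_def)
  next
    fix s n assume "P n s"
    then obtain u V S where s: "s = (u, V, S)" "stage E K \<phi> U u V S" by (cases s) (auto simp: P_def)
    obtain u' V' S' where "stage E K \<phi> U u' V' S'" "V' \<subseteq> V" "S \<subseteq> S'"
      "?\<mu> V' \<le> (95/96) * ?\<mu> V" "\<And>x. norm (u' x - u x) \<le> (1/2) ^ n" "\<And>x. x \<notin> V \<Longrightarrow> u' x = u x"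
      using stage_step[OF K lam U(2) s(2), of "(1/2) ^ n"] by auto
    then show "\<exists>s'. P (Suc n) s' \<and> R n s s'"
      by (intro exI[of _ "(u', V', S')"]) (simp add: P_def R_def s(1))
  qed
  then obtain f where f: "\<And>n. P n (f n)" "\<And>n. R n (f n) (f (Suc n))" by blast
  define u V S where "u n = fst (f n)" and "V n = fst (snd (f n))" and "S n = snd (snd (f n))" for n
  have st: "stage E K \<phi> U (u n) (V n) (S n)" for n
    using f(1)[of n] by (simp add: P_def u_def V_def S_def split_beta)
  have stp: "V (Suc n) \<subseteq> V n" "S n \<subseteq> S (Suc n)" "?\<mu> (V (Suc n)) \<le> (95/96) * ?\<mu> (V n)"
    "\<And>x. norm (u (Suc n) x - u n x) \<le> (1/2) ^ n" "\<And>x. x \<notin> V n \<Longrightarrow> u (Suc n) x = u n x" for n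
    using f(2)[of n] by (simp_all add: R_def u_def V_def S_def split_beta)
  have VS: "open (V n)" "V n \<inter> S n = {}" "negligible (U - (V n \<union> S n))" "V n \<subseteq> U" for n
    using st[of n] by (simp_all add: stage_def)
  have Vm: "V n \<in> lmeasurable" for n using VS(1,4)[of n] U(2) bounded_subset by (auto intro: lmeasurable_open)
  have const: "u m x = u n x" if nm: "n \<le> m" and x: "x \<in> S n" for n m x
    using nm
  proof (induction m rule: dec_induct)
    case (step m)
    have "S n \<subseteq> S m" using lift_Suc_mono_le[of S, OF stp(2) step.hyps(1)] .
    then have "x \<notin> V m" using x VS(2)[of m] by blast
    then show ?case using stp(5) step.IH by simp
  qed simp
  have Vlim: "?\<mu> (V n) \<le> (95/96) ^ n * ?\<mu> (V 0)" for n
  proof (induction n)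
    case (Suc n)
    then show ?case using stp(3)[of n] by simp
  qed simp
  have "?\<mu> (\<Inter>n. V n) = 0"
  proof (rule antisym)
    have "?\<mu> (\<Inter>n. V n) \<le> (95/96) ^ n * ?\<mu> (V 0)" for n
    proof -
      have "?\<mu> (\<Inter>n. V n) \<le> ?\<mu> (V n)" using Vm VS(1)
        by (intro measure_mono_fmeasurable) (auto intro!: sets.countable_INT'' simp: fmeasurableD)
      then show ?thesis using Vlim[of n] by linarith
    qed
    moreover have "(\<lambda>n. (95/96) ^ n * ?\<mu> (V 0)) \<longlonglongrightarrow> 0 * ?\<mu> (V 0)"
      by (intro tendsto_intros LIMSEQ_power_zero) auto
    ultimately show "?\<mu> (\<Inter>n. V n) \<le> 0"
      using LIMSEQ_le_const[of "\<lambda>n. (95/96) ^ n * ?\<mu> (V 0)" "0 * ?\<mu> (V 0)" "?\<mu> (\<Inter>n. V n)"] by auto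
  qed simp
  moreover have "(\<Inter>n. V n) \<in> lmeasurable"
  proof (rule fmeasurableI2[OF Vm[of 0]])
    show "(\<Inter>n. V n) \<in> sets lebesgue" using Vm by (intro sets.countable_INT'') (auto simp: fmeasurableD)
  qed auto
  ultimately have "negligible (\<Inter>n. V n)" by (simp add: negligible_iff_measure)
  \<comment> \<open>A point of \<open>U\<close> outside every \<open>S n\<close> lies in all
    \<open>V n\<close> or in one of the null sets lost at some stage.\<close>
  then have "negligible ((\<Inter>n. V n) \<union> (\<Union>n. U - (V n \<union> S n)))"
    using VS(3) by (intro negligible_Un negligible_countable_Union) auto
  then have "negligible (U - (\<Union>n. S n))" by (rule negligible_subset) auto
  then show ?thesis using that[OF st _ stp(4) const] by blast
qed

section \<open>Weak gradients of Lipschitz maps\<close>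

lemma difference_quotient_tendsto:
  fixes f :: "'a::real_normed_vector \<Rightarrow> real"
  assumes f: "(f has_derivative f') (at x)" and h: "h \<longlonglongrightarrow> 0" "\<And>n. h n \<noteq> 0"
  shows "(\<lambda>n. (f (x + h n *\<^sub>R v) - f x) / h n) \<longlonglongrightarrow> f' v"
proof -
  have "((\<lambda>t. f (x + t *\<^sub>R v)) has_derivative (\<lambda>t. f' (t *\<^sub>R v))) (at (0::real))"
    by (rule has_derivative_compose[where f = "\<lambda>t. x + t *\<^sub>R v" and f' = "\<lambda>t. t *\<^sub>R v" and g = f])
      (auto intro!: derivative_eq_intros f)
  moreover have "(\<lambda>t. f' (t *\<^sub>R v)) = (*) (f' v)"
    using has_derivative_bounded_linear[OF f] by (auto simp: bounded_linear.linear linear_cmul mult.commute)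
  ultimately have "((\<lambda>t. f (x + t *\<^sub>R v)) has_field_derivative f' v) (at 0)"
    by (simp add: has_field_derivative_def)
  then have "(\<lambda>t. (f (x + t *\<^sub>R v) - f x) / t) \<midarrow>0\<rightarrow> f' v" by (simp add: DERIV_def)
  then show ?thesis using h LIMSEQ_SEQ_conv[of 0 "\<lambda>t. (f (x + t *\<^sub>R v) - f x) / t" "f' v"] by auto
qed

lemma frechet_eq_partial:
  fixes f :: "real^'n \<Rightarrow> real"
  assumes "f differentiable (at x)"
  shows "frechet_derivative f (at x) h = (\<Sum>j\<in>UNIV. h $ j * partial_deriv j f x)"
proof -
  have lin: "linear (frechet_derivative f (at x))"
    using assms by (simp add: frechet_derivative_works has_derivative_linear)
  have "frechet_derivative f (at x) h = frechet_derivative f (at x) (\<Sum>j\<in>UNIV. h $ j *\<^sub>R axis j 1)"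
    by (simp add: basis_expansion scalar_mult_eq_scaleR[symmetric])
  also have "\<dots> = (\<Sum>j\<in>UNIV. h $ j * partial_deriv j f x)"
    using lin by (simp add: linear_sum linear_cmul partial_deriv_def)
  finally show ?thesis .
qed

lemma partial_deriv_eq: "(f has_derivative f') (at x) \<Longrightarrow> partial_deriv j f x = f' (axis j 1)"
  unfolding partial_deriv_def by (simp add: frechet_derivative_at[symmetric])

lemma derivative_zero_outside:
  fixes f :: "'a::real_normed_vector \<Rightarrow> real"
  assumes "closed C" "\<And>y. y \<notin> C \<Longrightarrow> f y = 0" "x \<notin> C"
  shows "(f has_derivative (\<lambda>_. 0)) (at x)"
  by (rule has_derivative_transform_within_open[OF has_derivative_const open_Compl[OF assms(1)], of x 0])
    (simp_all add: assms)

lemma partial_deriv_zero_outside: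
  "closed C \<Longrightarrow> (\<And>y. y \<notin> C \<Longrightarrow> f y = 0) \<Longrightarrow> x \<notin> C \<Longrightarrow> partial_deriv j f x = 0"
  by (simp add: partial_deriv_eq[OF derivative_zero_outside])

lemma partial_deriv_mult:
  assumes "f differentiable (at x)" "g differentiable (at x)"
  shows "partial_deriv j (\<lambda>x. f x * g x) x = partial_deriv j f x * g x + f x * partial_deriv j g x"
proof -
  have "((\<lambda>x. f x * g x) has_derivative
      (\<lambda>h. f x * frechet_derivative g (at x) h + frechet_derivative f (at x) h * g x)) (at x)"
    using assms by (intro has_derivative_mult) (auto simp: frechet_derivative_works)
  from partial_deriv_eq[OF this, of j] show ?thesis by (simp add: partial_deriv_def)
qed

lemma partial_deriv_component:
  assumes "v differentiable (at x)"
  shows "partial_deriv j (\<lambda>x. v x $ i) x = jacobian v (at x) $ i $ j"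
    "(\<lambda>x. v x $ i) differentiable (at x)"
proof -
  have d: "(v has_derivative frechet_derivative v (at x)) (at x)"
    using assms by (simp add: frechet_derivative_works)
  then have c: "((\<lambda>x. v x $ i) has_derivative (\<lambda>h. frechet_derivative v (at x) h $ i)) (at x)"
    using bounded_linear.has_derivative[OF bounded_linear_vec_nth] by blast
  then show "(\<lambda>x. v x $ i) differentiable (at x)" by (auto simp: differentiable_def)
  show "partial_deriv j (\<lambda>x. v x $ i) x = jacobian v (at x) $ i $ j"
    using partial_deriv_eq[OF c] by (simp add: jacobian_def matrix_def)
qed

lemma lebesgue_integral_translate:
  fixes f :: "'a::euclidean_space \<Rightarrow> real"
  assumes "f \<in> borel_measurable borel"
  shows "(\<integral>x. f (x + c) \<partial>lebesgue) = (\<integral>x. f x \<partial>lebesgue)"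
proof -
  have "(\<integral>x. f (x + c) \<partial>lebesgue) = (\<integral>x. f (c + x) \<partial>lborel)"
    using assms by (subst integral_completion) (auto simp: add.commute)
  also have "\<dots> = (\<integral>x. f x \<partial>distr lborel borel ((+) c))"
    using assms by (subst integral_distr) auto
  also have "\<dots> = (\<integral>x. f x \<partial>lebesgue)"
    using assms by (simp add: lborel_distr_plus integral_completion)
  finally show ?thesis .
qed

lemma integrable_bounded_support:
  fixes f :: "'a::euclidean_space \<Rightarrow> real"
  assumes "f \<in> borel_measurable lebesgue" "AE x in lebesgue. \<bar>f x\<bar> \<le> B" "\<And>x. x \<notin> S \<Longrightarrow> f x = 0" "bounded S"
  shows "integrable lebesgue f"
proof -
  obtain R where R: "S \<subseteq> cball 0 R"
    using bounded_subset_ballD[OF assms(4), of 0] ball_subset_cball by blast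
  have "integrable lebesgue (\<lambda>x. B * indicator (cball 0 R) x :: real)"
    using emeasure_bounded_finite[OF bounded_cball]
    by (intro integrable_mult_right integrable_real_indicator) auto
  then show ?thesis
  proof (rule Bochner_Integration.integrable_bound[OF _ assms(1)])
    show "AE x in lebesgue. norm (f x) \<le> norm (B * indicator (cball 0 R) x :: real)"
      using assms(2)
    proof eventually_elim
      case (elim x)
      then show ?case using assms(3)[of x] R by (cases "x \<in> S") auto
    qed
  qed
qed

lemma bounded_support_imp_bounded:
  fixes f :: "'a::heine_borel \<Rightarrow> 'b::real_normed_vector"
  assumes "continuous_on UNIV f" "bounded S" "\<And>x. x \<notin> S \<Longrightarrow> f x = 0"
  obtains B where "\<And>x. norm (f x) \<le> B" "0 \<le> B"
proof -
  have "bounded (f ` closure S)"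
    using assms by (intro compact_imp_bounded compact_continuous_image)
      (auto intro: continuous_on_subset simp: compact_closure)
  then obtain B where B: "\<And>x. x \<in> closure S \<Longrightarrow> norm (f x) \<le> B" by (auto simp: bounded_iff)
  have "norm (f x) \<le> \<bar>B\<bar>" for x
  proof (cases "x \<in> S")
    case True
    then have "norm (f x) \<le> B" using B closure_subset by blast
    then show ?thesis by linarith
  qed (use assms(3) in auto)
  then show ?thesis by (rule that) simp
qed

text \<open>Difference quotients are bounded by \<open>L\<close>, vanish outside a fixed ball and
  have integral 0 by translation invariance; dominated convergence passes all this on to the
  derivative.\<close>

lemma lipschitz_partial:
  fixes w :: "real^'n \<Rightarrow> real"
  assumes lip: "L-lipschitz_on UNIV w" and supp: "bounded S" "\<And>x. x \<notin> S \<Longrightarrow> w x = 0"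
    and N: "negligible N" "\<And>x. x \<notin> N \<Longrightarrow> w differentiable (at x)"
  shows "partial_deriv j w \<in> borel_measurable lebesgue" "integrable lebesgue (partial_deriv j w)"
    "(\<integral>x. partial_deriv j w x \<partial>lebesgue) = 0" "AE x in lebesgue. \<bar>partial_deriv j w x\<bar> \<le> L"
proof -
  \<comment> \<open>Steps of length at most 1 keep the supports of all quotients in the ball of
    radius \<open>R + 1\<close>.\<close>
  define h :: "nat \<Rightarrow> real" where "h n = 1 / (real n + 1)" for n
  have h: "h \<longlonglongrightarrow> 0" "\<And>n. h n \<noteq> 0" "\<And>n. 0 < h n" "\<And>n. h n \<le> 1"
    unfolding h_def using LIMSEQ_inverse_real_of_nat by (auto simp: inverse_eq_divide add.commute)
  let ?e = "axis j 1 :: real^'n"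
  define d where "d n x = (w (x + h n *\<^sub>R ?e) - w x) / h n" for n x
  have wm: "w \<in> borel_measurable borel"
    using lip by (intro borel_measurable_continuous_onI lipschitz_on_continuous_on)
  have dm: "d n \<in> borel_measurable borel" for n
    unfolding d_def[abs_def] using wm by measurable
  have dml: "d n \<in> borel_measurable lebesgue" for n using dm[of n] by (intro measurable_completion) simp
  have dL: "\<bar>d n x\<bar> \<le> L" for n x
  proof -
    have "\<bar>w (x + h n *\<^sub>R ?e) - w x\<bar> \<le> L * h n"
      using lipschitz_onD[OF lip, of "x + h n *\<^sub>R ?e" x] h(3)[of n] by (simp add: dist_norm)
    then show ?thesis using h(3)[of n] by (simp add: d_def field_simps)
  qed
  have AEN: "AE x in lebesgue. x \<notin> N" using N(1) by (simp add: AE_not_in negligible_iff_null_sets)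
  have lim: "(\<lambda>n. d n x) \<longlonglongrightarrow> partial_deriv j w x" if "x \<notin> N" for x
    using difference_quotient_tendsto[OF _ h(1,2)] N(2)[OF that]
    by (auto simp: d_def partial_deriv_def frechet_derivative_works)
  \<comment> \<open>This limit is measurable as a function on the whole space; the partial
    derivative agrees with it off \<open>N\<close>, and Lebesgue measure is complete.\<close>
  define D where "D x = lim (\<lambda>n. d n x)" for x
  have "D \<in> borel_measurable lebesgue" unfolding D_def[abs_def] using dml by measurable
  moreover have "AE x in lebesgue. D x = partial_deriv j w x"
    using AEN by eventually_elim (simp add: D_def limI[OF lim])
  ultimately show pm: "partial_deriv j w \<in> borel_measurable lebesgue" by (rule borel_measurable_AE)
  show bd: "AE x in lebesgue. \<bar>partial_deriv j w x\<bar> \<le> L"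
    using AEN
  proof eventually_elim
    case (elim x)
    have "(\<lambda>n. \<bar>d n x\<bar>) \<longlonglongrightarrow> \<bar>partial_deriv j w x\<bar>" using lim[OF elim] by (intro tendsto_intros)
    then show ?case by (rule LIMSEQ_le_const2) (use dL in auto)
  qed
  obtain R where R: "S \<subseteq> cball 0 R"
    using bounded_subset_ballD[OF supp(1), of 0] ball_subset_cball by blast
  have d0: "d n x = 0" if "x \<notin> cball 0 (R + 1)" for n x
  proof -
    have "norm x \<le> norm (x + h n *\<^sub>R ?e) + h n" using h(3)[of n] norm_triangle_ineq4[of "x + h n *\<^sub>R ?e" "h n *\<^sub>R ?e"] by simp
    then have "x + h n *\<^sub>R ?e \<notin> cball 0 R" "x \<notin> cball 0 R" using that h(4)[of n] by auto
    then have "w (x + h n *\<^sub>R ?e) = 0" "w x = 0" using R supp(2) by blast+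
    then show ?thesis by (simp add: d_def)
  qed
  let ?g = "\<lambda>x. L * indicator (cball 0 (R + 1)) x :: real"
  have gi: "integrable lebesgue ?g"
    using emeasure_bounded_finite[OF bounded_cball]
    by (intro integrable_mult_right integrable_real_indicator) auto
  have dg: "norm (d n x) \<le> ?g x" for n x using dL[of n x] d0[of x n] by (auto simp: indicator_def)
  have AElim: "AE x in lebesgue. (\<lambda>n. d n x) \<longlonglongrightarrow> partial_deriv j w x"
    using AEN by eventually_elim (rule lim)
  show "integrable lebesgue (partial_deriv j w)"
    by (rule integrable_dominated_convergence[OF pm dml gi AElim]) (use dg in auto)
  have "(\<lambda>n. \<integral>x. d n x \<partial>lebesgue) \<longlonglongrightarrow> (\<integral>x. partial_deriv j w x \<partial>lebesgue)"
    by (rule integral_dominated_convergence[OF pm dml gi AElim]) (use dg in auto)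
  moreover have "(\<integral>x. d n x \<partial>lebesgue) = 0" for n
  proof -
    have wl: "w \<in> borel_measurable lebesgue" using wm by (intro measurable_completion) simp
    obtain B where B': "\<And>x. norm (w x) \<le> B" "0 \<le> B"
      using bounded_support_imp_bounded[OF lipschitz_on_continuous_on[OF lip] supp] by blast
    have wi: "integrable lebesgue w"
      using integrable_bounded_support[OF wl _ supp(2,1), of B] B' by auto
    have wti: "integrable lebesgue (\<lambda>x. w (x + h n *\<^sub>R ?e))"
    proof (rule integrable_bounded_support[where S = "cball 0 (R + 1)" and B = B])
      show "(\<lambda>x. w (x + h n *\<^sub>R ?e)) \<in> borel_measurable lebesgue"
        using wm by (intro measurable_completion) simp
      show "w (x + h n *\<^sub>R ?e) = 0" if "x \<notin> cball 0 (R + 1)" for x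
      proof -
        have "norm x \<le> norm (x + h n *\<^sub>R ?e) + h n" using h(3)[of n] norm_triangle_ineq4[of "x + h n *\<^sub>R ?e" "h n *\<^sub>R ?e"] by simp
        then have "x + h n *\<^sub>R ?e \<notin> cball 0 R" using that h(4)[of n] by auto
        then show ?thesis using R supp(2) by blast
      qed
    qed (use B' in auto)
    show ?thesis unfolding d_def
      using wi wti lebesgue_integral_translate[OF wm, of "h n *\<^sub>R ?e"] by simp
  qed
  ultimately show "(\<integral>x. partial_deriv j w x \<partial>lebesgue) = 0"
    using LIMSEQ_unique[OF _ tendsto_const] by auto
qed

text \<open>The partial derivatives are continuous and vanish off a compact set, hence are bounded;
  the mean value inequality does the rest.\<close>

lemma C1_compact_support_lipschitz:
  fixes f :: "real^'n \<Rightarrow> real"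
  assumes d: "\<And>x. f differentiable (at x)" and c: "\<And>j. continuous_on UNIV (partial_deriv j f)"
    and supp: "compact C" "\<And>x. x \<notin> C \<Longrightarrow> f x = 0"
  shows "\<exists>L. L-lipschitz_on UNIV f"
proof -
  have "\<exists>B. \<forall>x\<in>C. \<bar>partial_deriv j f x\<bar> \<le> B" for j
    using compact_continuous_image[OF continuous_on_subset[OF c[of j]] supp(1)] compact_imp_bounded
    by (fastforce simp: bounded_iff)
  then obtain b where b: "\<And>j x. x \<in> C \<Longrightarrow> \<bar>partial_deriv j f x\<bar> \<le> b j" by metis
  have b': "\<bar>partial_deriv j f x\<bar> \<le> \<bar>b j\<bar>" for j x
  proof (cases "x \<in> C")
    case False
    then show ?thesis
      using partial_deriv_zero_outside[OF compact_imp_closed[OF supp(1)] supp(2)] by simp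
  qed (use b[of x j] in linarith)
  have "(\<Sum>j\<in>UNIV. \<bar>b j\<bar>)-lipschitz_on UNIV f"
  proof (rule bounded_derivative_imp_lipschitz)
    show "(f has_derivative frechet_derivative f (at x)) (at x within UNIV)" for x
      using d by (simp add: frechet_derivative_works)
    show "onorm (frechet_derivative f (at x)) \<le> (\<Sum>j\<in>UNIV. \<bar>b j\<bar>)" for x
    proof (rule onorm_le)
      fix h
      have "norm (frechet_derivative f (at x) h) \<le> (\<Sum>j\<in>UNIV. \<bar>h $ j\<bar> * \<bar>partial_deriv j f x\<bar>)"
        unfolding frechet_eq_partial[OF d] by (auto simp: abs_mult intro: order_trans[OF sum_abs])
      also have "\<dots> \<le> (\<Sum>j\<in>UNIV. norm h * \<bar>b j\<bar>)"
        using b' component_le_norm_cart[of h] by (intro sum_mono mult_mono) auto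
      finally show "norm (frechet_derivative f (at x) h) \<le> (\<Sum>j\<in>UNIV. \<bar>b j\<bar>) * norm h"
        by (simp add: sum_distrib_left mult.commute)
    qed
  qed (auto intro: sum_nonneg)
  then show ?thesis ..
qed

lemma smooth_D:
  assumes "smooth f"
  shows "f differentiable (at x)" "smooth (partial_deriv j f)" "continuous_on UNIV f"
proof -
  have k: "times_diff k f" for k using assms by (simp add: smooth_def)
  show "f differentiable (at x)" using k[of "Suc 0"] by simp
  show "smooth (partial_deriv j f)" unfolding smooth_def using k[of "Suc l" for l] by simp
  show "continuous_on UNIV f" using k[of 0] by simp
qed

lemma test_function_D:
  assumes "f \<in> test_functions \<Omega>"
  shows "smooth f" "compact (closure {x. f x \<noteq> 0})" "closure {x. f x \<noteq> 0} \<subseteq> \<Omega>"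
    "x \<notin> closure {x. f x \<noteq> 0} \<Longrightarrow> f x = 0" "x \<notin> closure {x. f x \<noteq> 0} \<Longrightarrow> partial_deriv j f x = 0"
proof -
  show "smooth f" "compact (closure {x. f x \<noteq> 0})" "closure {x. f x \<noteq> 0} \<subseteq> \<Omega>"
    using assms by (auto simp: test_functions_def)
  have z: "f x = 0" if "x \<notin> closure {x. f x \<noteq> 0}" for x
    using that closure_subset[of "{x. f x \<noteq> 0}"] by auto
  then show "x \<notin> closure {x. f x \<noteq> 0} \<Longrightarrow> f x = 0" .
  show "x \<notin> closure {x. f x \<noteq> 0} \<Longrightarrow> partial_deriv j f x = 0"
    by (rule partial_deriv_zero_outside[OF closed_closure z])
qed

lemma test_function_lipschitz:
  assumes "f \<in> test_functions \<Omega>"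
  shows "\<exists>L. L-lipschitz_on UNIV f"
proof (rule C1_compact_support_lipschitz)
  note f = test_function_D[OF assms]
  show "f differentiable (at x)" for x by (rule smooth_D(1)[OF f(1)])
  show "continuous_on UNIV (partial_deriv j f)" for j by (rule smooth_D(3)[OF smooth_D(2)[OF f(1)]])
  show "compact (closure {x. f x \<noteq> 0})" by (rule f(2))
  show "f x = 0" if "x \<notin> closure {x. f x \<noteq> 0}" for x by (rule f(4)[OF that])
qed

lemma borel_measurable_matrixI:
  fixes G :: "'a \<Rightarrow> real^'n^'m"
  assumes "\<And>i j. (\<lambda>x. G x $ i $ j) \<in> borel_measurable M"
  shows "G \<in> borel_measurable M"
proof (subst borel_measurable_euclidean_space, intro ballI)
  fix b :: "real^'n^'m" assume "b \<in> Basis"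
  then obtain i j where "b = axis i (axis j 1)" by (auto simp: Basis_vec_def)
  then show "(\<lambda>x. G x \<bullet> b) \<in> borel_measurable M" using assms by (simp add: inner_axis)
qed

lemma norm_matrix_le:
  fixes A :: "real^'n^'m"
  assumes "\<And>i j. \<bar>A $ i $ j\<bar> \<le> L"
  shows "norm A \<le> (\<Sum>b\<in>(Basis :: (real^'n^'m) set). L)"
proof -
  have "norm A \<le> (\<Sum>b\<in>Basis. \<bar>A \<bullet> b\<bar>)" by (rule norm_le_l1)
  also have "\<dots> \<le> (\<Sum>b\<in>(Basis :: (real^'n^'m) set). L)"
    using assms by (intro sum_mono) (auto simp: Basis_vec_def inner_axis)
  finally show ?thesis .
qed

lemma bounded_absolutely_integrable_on:
  fixes g :: "'a::euclidean_space \<Rightarrow> 'b::euclidean_space"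
  assumes "g \<in> borel_measurable lebesgue" "AE x in lebesgue. norm (g x) \<le> B" "S \<in> lmeasurable"
  shows "g absolutely_integrable_on S"
  unfolding set_integrable_def
proof (rule Bochner_Integration.integrable_bound)
  show "integrable lebesgue (\<lambda>x. B * indicator S x :: real)"
    using assms(3) by (intro integrable_mult_right integrable_real_indicator) (auto simp: fmeasurable_def)
  show "(\<lambda>x. indicator S x *\<^sub>R g x) \<in> borel_measurable lebesgue"
    using assms by (intro borel_measurable_scaleR borel_measurable_indicator) (auto simp: fmeasurableD)
  show "AE x in lebesgue. norm (indicator S x *\<^sub>R g x) \<le> norm (B * indicator S x)"
    using assms(2) by eventually_elim (auto simp: indicator_def)
qed

lemma continuous_imp_measurable_lebesgue:
  fixes f :: "'a::euclidean_space \<Rightarrow> 'b::euclidean_space"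
  shows "continuous_on UNIV f \<Longrightarrow> f \<in> borel_measurable lebesgue"
  by (intro measurable_completion) (simp add: borel_measurable_continuous_onI)

lemma set_lebesgue_integral_support:
  fixes F :: "'a \<Rightarrow> real"
  shows "(\<And>x. x \<notin> \<Omega> \<Longrightarrow> F x = 0) \<Longrightarrow> (LINT x:\<Omega>|M. F x) = (\<integral>x. F x \<partial>M)"
  unfolding set_lebesgue_integral_def by (rule Bochner_Integration.integral_cong) (auto simp: indicator_def)

text \<open>The product is Lipschitz with support in that of \<open>f\<close>, so its partial
  derivative has integral 0, and the product rule splits it. Differentiability of \<open>v\<close>
  is required only inside \<Omega>, since \<open>f\<close> vanishes near every other point.\<close>

lemma integral_by_parts:
  fixes v f :: "real^'n \<Rightarrow> real"
  assumes w: "\<exists>L. L-lipschitz_on UNIV (\<lambda>x. v x * f x)" and f: "f \<in> test_functions \<Omega>"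
    and N: "negligible N" "\<And>x. x \<notin> N \<Longrightarrow> x \<in> \<Omega> \<Longrightarrow> v differentiable (at x)"
    and int: "integrable lebesgue (\<lambda>x. v x * partial_deriv j f x)"
  shows "(LINT x:\<Omega>|lebesgue. v x * partial_deriv j f x) = - (LINT x:\<Omega>|lebesgue. partial_deriv j v x * f x)"
proof -
  let ?C = "closure {x. f x \<noteq> 0}"
  note tf = test_function_D[OF f]
  have vf0: "v x * f x = 0" if "x \<notin> ?C" for x using tf(4)[OF that] by simp
  obtain L where L: "L-lipschitz_on UNIV (\<lambda>x. v x * f x)" using w ..
  have dw: "(\<lambda>x. v x * f x) differentiable (at x)" if "x \<notin> N" for x
  proof (cases "x \<in> ?C")
    case True
    then have "v differentiable (at x)" using N(2) that tf(3) by blast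
    then show ?thesis using smooth_D(1)[OF tf(1)] by (rule differentiable_mult)
  next
    case False
    have "((\<lambda>x. v x * f x) has_derivative (\<lambda>_. 0)) (at x)"
      by (rule derivative_zero_outside[OF closed_closure vf0 False])
    then show ?thesis by (auto simp: differentiable_def)
  qed
  have eq: "partial_deriv j (\<lambda>x. v x * f x) x = partial_deriv j v x * f x + v x * partial_deriv j f x"
    if "x \<notin> N" for x
  proof (cases "x \<in> ?C")
    case True
    then have "v differentiable (at x)" using N(2) that tf(3) by blast
    then show ?thesis using smooth_D(1)[OF tf(1)] by (rule partial_deriv_mult)
  next
    case False
    have "partial_deriv j (\<lambda>x. v x * f x) x = 0"
      by (rule partial_deriv_zero_outside[OF closed_closure vf0 False])
    then show ?thesis using tf(4)[OF False] tf(5)[OF False] by simp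
  qed
  have AEN: "AE x in lebesgue. x \<notin> N" using N(1) by (simp add: AE_not_in negligible_iff_null_sets)
  note lp = lipschitz_partial[OF L compact_imp_bounded[OF tf(2)] vf0 N(1) dw, of j]
  have i1: "integrable lebesgue (partial_deriv j (\<lambda>x. v x * f x))"
    and z: "(\<integral>x. partial_deriv j (\<lambda>x. v x * f x) x \<partial>lebesgue) = 0"
    and pm: "partial_deriv j (\<lambda>x. v x * f x) \<in> borel_measurable lebesgue"
    using lp by auto
  \<comment> \<open>Besides the value of the integral, this identity supplies the measurability of
    its right-hand side.\<close>
  have AEeq: "AE x in lebesgue. partial_deriv j (\<lambda>x. v x * f x) x - v x * partial_deriv j f x = partial_deriv j v x * f x"
    using AEN by eventually_elim (simp add: eq)
  have m: "(\<lambda>x. partial_deriv j v x * f x) \<in> borel_measurable lebesgue"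
    by (rule borel_measurable_AE[OF _ AEeq]) (use pm int in auto)
  have "(\<integral>x. partial_deriv j v x * f x \<partial>lebesgue) =
      (\<integral>x. partial_deriv j (\<lambda>x. v x * f x) x - v x * partial_deriv j f x \<partial>lebesgue)"
    using AEeq by (intro integral_cong_AE m) (use pm int in auto)
  also have "\<dots> = - (\<integral>x. v x * partial_deriv j f x \<partial>lebesgue)" using i1 int z by simp
  finally have fin: "(\<integral>x. v x * partial_deriv j f x \<partial>lebesgue) = - (\<integral>x. partial_deriv j v x * f x \<partial>lebesgue)"
    by simp
  have out: "x \<notin> ?C" if "x \<notin> \<Omega>" for x using that tf(3) by blast
  have z1: "v x * partial_deriv j f x = 0" and z2: "partial_deriv j v x * f x = 0" if "x \<notin> \<Omega>" for x
    using tf(4,5)[OF out[OF that]] by simp_all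
  have "(LINT x:\<Omega>|lebesgue. v x * partial_deriv j f x) = (\<integral>x. v x * partial_deriv j f x \<partial>lebesgue)"
    by (rule set_lebesgue_integral_support) (rule z1)
  moreover have "(LINT x:\<Omega>|lebesgue. partial_deriv j v x * f x) = (\<integral>x. partial_deriv j v x * f x \<partial>lebesgue)"
    by (rule set_lebesgue_integral_support) (rule z2)
  ultimately show ?thesis using fin by simp
qed

lemma lipschitz_component: "L-lipschitz_on S v \<Longrightarrow> L-lipschitz_on S (\<lambda>x. v x $ i)"
  for v :: "'a::metric_space \<Rightarrow> real^'m"
  unfolding lipschitz_on_def by (meson dist_vec_nth_le order_trans)

lemma lipschitz_jacobian:
  fixes v :: "real^'n \<Rightarrow> real^'m"
  assumes lip: "L-lipschitz_on UNIV v" and supp: "bounded S" "\<And>x. x \<notin> S \<Longrightarrow> v x = 0"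
    and N: "negligible N" "\<And>x. x \<notin> N \<Longrightarrow> v differentiable (at x)"
  shows "(\<lambda>x. jacobian v (at x)) \<in> borel_measurable lebesgue"
    "\<exists>B. AE x in lebesgue. norm (jacobian v (at x)) \<le> B"
    "(\<lambda>x. jacobian v (at x) $ i $ j) \<in> borel_measurable lebesgue"
proof -
  have AEN: "AE x in lebesgue. x \<notin> N" using N(1) by (simp add: AE_not_in negligible_iff_null_sets)
  note lp = lipschitz_partial[OF lipschitz_component[OF lip] supp(1) _ N(1) partial_deriv_component(2)[OF N(2)]]
  show comp: "(\<lambda>x. jacobian v (at x) $ i $ j) \<in> borel_measurable lebesgue" for i j
  proof -
    have "AE x in lebesgue. partial_deriv j (\<lambda>x. v x $ i) x = jacobian v (at x) $ i $ j"
      using AEN by eventually_elim (simp add: partial_deriv_component(1) N(2))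
    then show ?thesis
      by (rule borel_measurable_AE[rotated]) (use lp(1) supp(2) in auto)
  qed
  show "(\<lambda>x. jacobian v (at x)) \<in> borel_measurable lebesgue"
    by (rule borel_measurable_matrixI[OF comp])
  have "AE x in lebesgue. \<bar>partial_deriv j (\<lambda>x. v x $ i) x\<bar> \<le> L" for i j
    using lp(4) supp(2) by auto
  then have "AE x in lebesgue. \<forall>i j. \<bar>partial_deriv j (\<lambda>x. v x $ i) x\<bar> \<le> L"
    by (simp add: AE_all_countable)
  then have "AE x in lebesgue. norm (jacobian v (at x)) \<le> (\<Sum>b\<in>(Basis :: (real^'n^'m) set). L)"
    using AEN
  proof eventually_elim
    case (elim x)
    then show ?case by (intro norm_matrix_le) (simp add: partial_deriv_component(1)[OF N(2), symmetric])
  qed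
  then show "\<exists>B. AE x in lebesgue. norm (jacobian v (at x)) \<le> B" ..
qed

text \<open>Each component is covered by \<open>integral_by_parts\<close>; the values of
  \<open>jacobian\<close> on the null set \<open>N\<close> do not affect the integrals.\<close>

lemma lipschitz_has_weak_gradient:
  fixes v :: "real^'n \<Rightarrow> real^'m"
  assumes lip: "L-lipschitz_on UNIV v" and supp: "bounded S" "\<And>x. x \<notin> S \<Longrightarrow> v x = 0"
    and N: "negligible N" "\<And>x. x \<notin> N \<Longrightarrow> v differentiable (at x)"
  shows "has_weak_gradient \<Omega> v (\<lambda>x. jacobian v (at x))"
  unfolding has_weak_gradient_def locally_integrable_on_def
proof (intro conjI allI impI ballI)
  have cv: "continuous_on UNIV v" by (rule lipschitz_on_continuous_on[OF lip])
  obtain B where B: "\<And>x. norm (v x) \<le> B" "0 \<le> B"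
    using bounded_support_imp_bounded[OF cv supp] by blast
  fix C assume C: "compact C \<and> C \<subseteq> \<Omega>"
  show "v absolutely_integrable_on C"
    using B C by (intro bounded_absolutely_integrable_on[OF continuous_imp_measurable_lebesgue[OF cv]])
      (auto intro: lmeasurable_compact)
  show "(\<lambda>x. jacobian v (at x)) absolutely_integrable_on C"
    using lipschitz_jacobian(1,2)[OF lip supp N] C
    by (auto intro: bounded_absolutely_integrable_on lmeasurable_compact)
next
  have cv: "continuous_on UNIV v" by (rule lipschitz_on_continuous_on[OF lip])
  obtain B where B: "\<And>x. norm (v x) \<le> B" "0 \<le> B"
    using bounded_support_imp_bounded[OF cv supp] by blast
  have AEN: "AE x in lebesgue. x \<notin> N" using N(1) by (simp add: AE_not_in negligible_iff_null_sets)
  fix f i j assume f: "f \<in> test_functions \<Omega>"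
  note tf = test_function_D[OF f]
  obtain M where M: "M-lipschitz_on UNIV f" using test_function_lipschitz[OF f] ..
  obtain B' where B': "\<And>x. norm (f x) \<le> B'" "0 \<le> B'"
    using bounded_support_imp_bounded[OF smooth_D(3)[OF tf(1)] compact_imp_bounded[OF tf(2)] tf(4)] by blast
  have vi: "\<bar>v x $ i\<bar> \<le> B" for x using component_le_norm_cart[of "v x" i] B(1)[of x] by linarith
  have "\<exists>L. L-lipschitz_on UNIV (\<lambda>x. v x $ i * f x)"
    using lipschitz_on_scaleR[OF lipschitz_component[OF lip] M, where B = B and B' = B'] B B' vi by auto
  moreover have "integrable lebesgue (\<lambda>x. v x $ i * partial_deriv j f x)"
  proof -
    have c: "continuous_on UNIV (\<lambda>x. v x $ i * partial_deriv j f x)"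
      by (intro continuous_intros cv smooth_D(3)[OF smooth_D(2)[OF tf(1)]])
    have z: "v x $ i * partial_deriv j f x = 0" if "x \<notin> S" for x using supp(2)[OF that] by simp
    obtain B where "\<And>x. norm (v x $ i * partial_deriv j f x) \<le> B"
      using bounded_support_imp_bounded[OF c supp(1) z] by blast
    then show ?thesis
      by (intro integrable_bounded_support[OF continuous_imp_measurable_lebesgue[OF c] _ z supp(1)]) auto
  qed
  ultimately have "(LINT x:\<Omega>|lebesgue. v x $ i * partial_deriv j f x) =
      - (LINT x:\<Omega>|lebesgue. partial_deriv j (\<lambda>x. v x $ i) x * f x)"
    using N partial_deriv_component(2) by (intro integral_by_parts[OF _ f N(1)]) auto
  also have "(LINT x:\<Omega>|lebesgue. partial_deriv j (\<lambda>x. v x $ i) x * f x) =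
      (LINT x:\<Omega>|lebesgue. jacobian v (at x) $ i $ j * f x)"
  proof -
    have z: "x \<notin> closure {x. f x \<noteq> 0}" if "x \<notin> \<Omega>" for x using that tf(3) by blast
    have "(\<lambda>x. jacobian v (at x) $ i $ j) \<in> borel_measurable lebesgue"
      by (rule lipschitz_jacobian(3)[OF lip supp N])
    moreover have "partial_deriv j (\<lambda>x. v x $ i) \<in> borel_measurable lebesgue"
      using lipschitz_partial(1)[OF lipschitz_component[OF lip] supp(1) _ N(1) partial_deriv_component(2)[OF N(2)]]
        supp(2) by auto
    moreover have "f \<in> borel_measurable lebesgue"
      by (rule continuous_imp_measurable_lebesgue[OF smooth_D(3)[OF tf(1)]])
    ultimately have "(\<integral>x. partial_deriv j (\<lambda>x. v x $ i) x * f x \<partial>lebesgue) =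
      (\<integral>x. jacobian v (at x) $ i $ j * f x \<partial>lebesgue)"
    proof (intro integral_cong_AE)
      show "AE x in lebesgue. partial_deriv j (\<lambda>x. v x $ i) x * f x = jacobian v (at x) $ i $ j * f x"
        using AEN by eventually_elim (simp add: partial_deriv_component(1) N(2))
    qed auto
    moreover have z1: "partial_deriv j (\<lambda>x. v x $ i) x * f x = 0"
      and z2: "jacobian v (at x) $ i $ j * f x = 0" if "x \<notin> \<Omega>" for x
      using tf(4)[OF z[OF that]] by simp_all
    moreover have "(LINT x:\<Omega>|lebesgue. partial_deriv j (\<lambda>x. v x $ i) x * f x) =
        (\<integral>x. partial_deriv j (\<lambda>x. v x $ i) x * f x \<partial>lebesgue)"
      by (rule set_lebesgue_integral_support) (rule z1)
    moreover have "(LINT x:\<Omega>|lebesgue. jacobian v (at x) $ i $ j * f x) =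
        (\<integral>x. jacobian v (at x) $ i $ j * f x \<partial>lebesgue)"
      by (rule set_lebesgue_integral_support) (rule z2)
    ultimately show ?thesis by simp
  qed
  finally show "(LINT x:\<Omega>|lebesgue. v x $ i * partial_deriv j f x) =
      - (LINT x:\<Omega>|lebesgue. jacobian v (at x) $ i $ j * f x)" .
qed

text \<open>Although \<open>v\<close> is arbitrary outside \<open>U\<close>, its product with
  \<open>f\<close> is continuously differentiable everywhere: \<open>U\<close> and the complement of
  the support of \<open>f\<close> are two open sets that cover the space.\<close>

lemma classical_integral_by_parts:
  fixes v f :: "real^'n \<Rightarrow> real"
  assumes U: "open U" and v: "\<And>x. x \<in> U \<Longrightarrow> v differentiable (at x)"
    and c: "\<And>j. continuous_on U (partial_deriv j v)" and f: "f \<in> test_functions U"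
  shows "(LINT x:U|lebesgue. v x * partial_deriv j f x) = - (LINT x:U|lebesgue. partial_deriv j v x * f x)"
proof (rule integral_by_parts[OF _ f negligible_empty])
  note tf = test_function_D[OF f]
  let ?C = "closure {x. f x \<noteq> 0}"
  have vf0: "v x * f x = 0" if "x \<notin> ?C" for x using tf(4)[OF that] by simp
  have cont_ext: "continuous_on UNIV g" if "continuous_on U g" "\<And>x. x \<notin> ?C \<Longrightarrow> g x = 0"
    for g :: "real^'n \<Rightarrow> real"
  proof -
    have "continuous_on (- ?C) g" 
      by (rule continuous_on_eq[OF continuous_on_const[of _ 0]]) (simp add: that(2))
    then have "continuous_on (U \<union> - ?C) g" using that(1) U by (intro continuous_on_open_Un) auto
    moreover have "U \<union> - ?C = UNIV" using tf(3) by blast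
    ultimately show ?thesis by simp
  qed
  have cv: "continuous_on U v"
    using v by (intro differentiable_imp_continuous_on) (simp add: differentiable_on_def differentiable_at_withinI)
  have cf: "continuous_on U f" "continuous_on U (partial_deriv j f)" for j
    by (rule continuous_on_subset[OF smooth_D(3)[OF tf(1)] subset_UNIV],
        rule continuous_on_subset[OF smooth_D(3)[OF smooth_D(2)[OF tf(1)]] subset_UNIV])
  have dw: "(\<lambda>x. v x * f x) differentiable (at x)" for x
  proof (cases "x \<in> ?C")
    case True
    then have "x \<in> U" using tf(3) by blast
    then show ?thesis by (intro differentiable_mult v smooth_D(1)[OF tf(1)])
  next
    case False
    have "((\<lambda>x. v x * f x) has_derivative (\<lambda>_. 0)) (at x)"
      by (rule derivative_zero_outside[OF closed_closure vf0 False])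
    then show ?thesis by (auto simp: differentiable_def)
  qed
  show "\<exists>L. L-lipschitz_on UNIV (\<lambda>x. v x * f x)"
  proof (rule C1_compact_support_lipschitz[OF dw _ tf(2)])
    show "continuous_on UNIV (partial_deriv j (\<lambda>x. v x * f x))" for j
    proof (rule cont_ext)
      have "continuous_on U (\<lambda>x. partial_deriv j v x * f x + v x * partial_deriv j f x)"
        by (intro continuous_intros c cv cf)
      then show "continuous_on U (partial_deriv j (\<lambda>x. v x * f x))"
        using partial_deriv_mult[OF v smooth_D(1)[OF tf(1)]] by (auto cong: continuous_on_cong)
      show "partial_deriv j (\<lambda>x. v x * f x) x = 0" if "x \<notin> ?C" for x
        by (rule partial_deriv_zero_outside[OF closed_closure vf0 that])
    qed
  qed (rule vf0)
  have z: "v x * partial_deriv j f x = 0" if "x \<notin> ?C" for x using tf(5)[OF that] by simp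
  have c1: "continuous_on UNIV (\<lambda>x. v x * partial_deriv j f x)"
    by (intro cont_ext[OF _ z] continuous_intros cv cf)
  obtain B where "\<And>x. norm (v x * partial_deriv j f x) \<le> B"
    using bounded_support_imp_bounded[OF c1 compact_imp_bounded[OF tf(2)] z] by blast
  then show "integrable lebesgue (\<lambda>x. v x * partial_deriv j f x)"
    by (intro integrable_bounded_support[OF continuous_imp_measurable_lebesgue[OF c1] _ z
          compact_imp_bounded[OF tf(2)]]) auto
qed (use v in auto)

section \<open>Smooth bumps and mollification\<close>

text \<open>The definition asks for continuity only at the last order; at lower orders it follows
  from differentiability.\<close>

lemma times_diff_mono: "times_diff (Suc k) f \<Longrightarrow> times_diff k f"
proof (induction k arbitrary: f)
  case 0
  then have "f differentiable_on UNIV" by (simp add: differentiable_on_def)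
  then show ?case by (simp add: differentiable_imp_continuous_on)
next
  case (Suc k)
  then show ?case by simp
qed

lemma times_diff_const: "times_diff k (\<lambda>_ :: real^'n. c)"
proof (induction k arbitrary: c)
  case (Suc k)
  have "partial_deriv j (\<lambda>_ :: real^'n. c) = (\<lambda>_. 0)" for j :: 'n
    using partial_deriv_eq[OF has_derivative_const] by (intro ext) auto
  then show ?case using Suc by simp
qed simp

lemma partial_deriv_add:
  assumes "f differentiable (at x)" "g differentiable (at x)"
  shows "partial_deriv j (\<lambda>x. f x + g x) x = partial_deriv j f x + partial_deriv j g x"
proof -
  have "((\<lambda>x. f x + g x) has_derivative
      (\<lambda>h. frechet_derivative f (at x) h + frechet_derivative g (at x) h)) (at x)"
    using assms by (intro has_derivative_add) (auto simp: frechet_derivative_works)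
  from partial_deriv_eq[OF this, of j] show ?thesis by (simp add: partial_deriv_def)
qed

lemma times_diff_add: "times_diff k f \<Longrightarrow> times_diff k g \<Longrightarrow> times_diff k (\<lambda>x. f x + g x)"
proof (induction k arbitrary: f g)
  case 0
  then show ?case by (simp add: continuous_on_add)
next
  case (Suc k)
  have "partial_deriv j (\<lambda>x. f x + g x) = (\<lambda>x. partial_deriv j f x + partial_deriv j g x)" for j
    using Suc.prems by (intro ext partial_deriv_add) auto
  then show ?case using Suc by (auto intro: differentiable_add)
qed

lemma times_diff_mult: "times_diff k f \<Longrightarrow> times_diff k g \<Longrightarrow> times_diff k (\<lambda>x. f x * g x)"
proof (induction k arbitrary: f g)
  case 0
  then show ?case by (simp add: continuous_on_mult)
next
  case (Suc k)
  have "partial_deriv j (\<lambda>x. f x * g x) = (\<lambda>x. partial_deriv j f x * g x + f x * partial_deriv j g x)" for j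
    using Suc.prems by (intro ext partial_deriv_mult) auto
  moreover have "times_diff k (\<lambda>x. partial_deriv j f x * g x + f x * partial_deriv j g x)" for j
    using Suc.prems Suc.IH times_diff_mono by (intro times_diff_add Suc.IH) auto
  ultimately show ?case using Suc.prems by (auto intro: differentiable_mult)
qed

lemma times_diff_prod: "finite I \<Longrightarrow> (\<And>i. i \<in> I \<Longrightarrow> times_diff k (f i)) \<Longrightarrow> times_diff k (\<lambda>x. \<Prod>i\<in>I. f i x)"
  by (induction I rule: finite_induct) (auto intro: times_diff_const times_diff_mult)

text \<open>The family \<open>flat p\<close> for polynomials \<open>p\<close> is closed under differentiation,
  so that all its members are smooth.\<close>

definition flat :: "real poly \<Rightarrow> real \<Rightarrow> real" where
  "flat p t = (if t > 0 then poly p (1 / t) * exp (- (1 / t)) else 0)"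

text \<open>With \<open>y = 1 / t\<close> this is the fact that the exponential beats every
  polynomial at infinity.\<close>

lemma flat_tendsto_0: "(flat p \<longlongrightarrow> 0) (at 0)"
proof -
  have "((\<lambda>y. \<Sum>i\<le>degree p. coeff p i * (y ^ i / exp y)) \<longlongrightarrow> (\<Sum>i\<le>degree p. coeff p i * 0)) at_top"
    by (intro tendsto_intros tendsto_power_div_exp_0)
  then have "((\<lambda>y. poly p y * exp (- y)) \<longlongrightarrow> 0) at_top"
    by (simp add: poly_altdef sum_divide_distrib exp_minus field_simps)
  then have "((\<lambda>t. poly p (inverse t) * exp (- inverse t)) \<longlongrightarrow> 0) (at_right 0)"
    by (rule filterlim_compose[OF _ filterlim_inverse_at_top_right])
  moreover have "\<forall>\<^sub>F t in at_right (0::real). poly p (inverse t) * exp (- inverse t) = flat p t"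
    using eventually_at_right_less by eventually_elim (simp add: flat_def inverse_eq_divide)
  ultimately have "(flat p \<longlongrightarrow> 0) (at_right 0)" by (rule Lim_transform_eventually)
  moreover have "\<forall>\<^sub>F t in at_left (0::real). 0 = flat p t"
    unfolding eventually_at_filter by (simp add: flat_def)
  then have "(flat p \<longlongrightarrow> 0) (at_left 0)" by (rule Lim_transform_eventually[OF tendsto_const])
  ultimately show ?thesis by (simp add: filterlim_split_at)
qed

text \<open>For \<open>y = 1 / t\<close> the derivative of \<open>y\<close> is minus its square,
  which produces the polynomial. At 0 the difference quotient is itself a member of the family, for
  the polynomial \<open>pCons 0 p\<close>, and tends to 0.\<close>

lemma flat_DERIV: "(flat p has_field_derivative flat ([:0, 0, 1:] * (p - pderiv p)) t) (at t)"
proof -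
  consider "t > 0" | "t = 0" | "t < 0" by linarith
  then show ?thesis
  proof cases
    case 1
    have "((\<lambda>t. poly p (1 / t) * exp (- (1 / t))) has_field_derivative
        flat ([:0, 0, 1:] * (p - pderiv p)) t) (at t)"
      using 1 by (auto intro!: derivative_eq_intros simp: flat_def field_simps power2_eq_square)
    then show ?thesis
      by (rule has_field_derivative_transform_within_open[of _ _ _ "{0<..}"]) (use 1 in \<open>auto simp: flat_def\<close>)
  next
    case 2
    have "(\<lambda>h. (flat p (0 + h) - flat p 0) / h) = flat (pCons 0 p)"
      by (intro ext) (simp add: flat_def)
    then have "(flat p has_field_derivative 0) (at 0)"
      using flat_tendsto_0[of "pCons 0 p"] by (simp add: DERIV_def)
    then show ?thesis using 2 by (simp add: flat_def)
  next
    case 3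
    show ?thesis
      by (rule has_field_derivative_transform_within_open[of "\<lambda>_. 0" _ _ "{..<0}"])
        (use 3 in \<open>auto simp: flat_def\<close>)
  qed
qed

text \<open>The induction leaves the polynomial free because every derivative changes it. The affine
  argument serves both flanks of a bump.\<close>

lemma times_diff_flat: "times_diff k (\<lambda>x :: real^'n. flat p (c + s * x $ i))"
proof (induction k arbitrary: p)
  case 0
  have "continuous_on UNIV (flat p)"
    using flat_DERIV DERIV_continuous_on by (metis has_field_derivative_at_within)
  then show ?case by (auto intro!: continuous_on_compose2[of UNIV "flat p"] continuous_intros)
next
  case (Suc k)
  let ?q = "[:0, 0, 1:] * (p - pderiv p)"
  have d: "((\<lambda>x :: real^'n. flat p (c + s * x $ i)) has_derivative
      (\<lambda>h. flat ?q (c + s * x $ i) * (s * h $ i))) (at x)" for x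
  proof -
    have "((\<lambda>x :: real^'n. c + s * x $ i) has_derivative (\<lambda>h. s * h $ i)) (at x)"
      by (auto intro!: derivative_eq_intros bounded_linear.has_derivative[OF bounded_linear_vec_nth])
    moreover have "(flat p has_derivative (*) (flat ?q (c + s * x $ i))) (at (c + s * x $ i))"
      using flat_DERIV[of p "c + s * x $ i"] by (simp only: has_field_derivative_def)
    ultimately show ?thesis by (rule has_derivative_compose)
  qed
  have "partial_deriv j (\<lambda>x :: real^'n. flat p (c + s * x $ i)) =
      (\<lambda>x. flat ?q (c + s * x $ i) * (s * (axis j 1 :: real^'n) $ i))" for j
    using partial_deriv_eq[OF d] by (intro ext) auto
  moreover have "times_diff k (\<lambda>x :: real^'n. flat ?q (c + s * x $ i) * (s * (axis j 1 :: real^'n) $ i))" for j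
    by (intro times_diff_mult Suc.IH times_diff_const)
  ultimately show ?case using d by (auto simp: differentiable_def)
qed

text \<open>The parameter \<open>s\<close> steepens the flanks: as it tends to infinity, the bump
  tends to the indicator of the open box.\<close>

definition bump :: "real^'n \<Rightarrow> real^'n \<Rightarrow> real \<Rightarrow> real^'n \<Rightarrow> real" where
  "bump a b s x = (\<Prod>i\<in>UNIV. flat 1 (s * (x $ i - a $ i)) * flat 1 (s * (b $ i - x $ i)))"

lemma smooth_bump: "smooth (bump a b s)"
proof -
  have "times_diff k (\<lambda>x. \<Prod>i\<in>UNIV. flat 1 (- s * a $ i + s * x $ i) * flat 1 (s * b $ i + (- s) * x $ i))" for k
    by (intro times_diff_prod times_diff_mult times_diff_flat) auto
  then show ?thesis unfolding smooth_def bump_def[abs_def] by (simp add: algebra_simps)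
qed

lemma flat_1_bounds: "0 \<le> flat 1 t" "flat 1 t \<le> 1" "0 < flat 1 t \<longleftrightarrow> 0 < t"
  by (auto simp: flat_def)

lemma bump_bounds: "0 \<le> bump a b s x" "bump a b s x \<le> 1"
  unfolding bump_def by (intro prod_nonneg prod_le_1 ballI conjI mult_nonneg_nonneg mult_le_one flat_1_bounds)+

lemma bump_pos_iff:
  assumes "0 < s"
  shows "bump a b s x \<noteq> 0 \<longleftrightarrow> x \<in> box a b"
proof -
  have "flat 1 t \<noteq> 0 \<longleftrightarrow> 0 < t" for t using flat_1_bounds[of t] by auto
  then show ?thesis using assms by (auto simp: bump_def mem_box_cart zero_less_mult_iff)
qed

lemma bump_test_function:
  assumes "0 < s" "cbox a b \<subseteq> \<Omega>"
  shows "bump a b s \<in> test_functions \<Omega>"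
proof -
  have sub: "{x. bump a b s x \<noteq> 0} \<subseteq> cbox a b"
    using box_subset_cbox by (auto simp: bump_pos_iff[OF assms(1)])
  have "closure {x. bump a b s x \<noteq> 0} \<subseteq> \<Omega>"
    using closure_minimal[OF sub closed_cbox] assms(2) by blast
  moreover have "compact (closure {x. bump a b s x \<noteq> 0})"
    using bounded_subset[OF bounded_cbox sub] by (simp add: compact_closure)
  ultimately show ?thesis unfolding test_functions_def using smooth_bump by simp
qed

lemma bump_tendsto_indicator: "(\<lambda>n. bump a b (real n + 1) x) \<longlonglongrightarrow> indicator (box a b) x"
proof (cases "x \<in> box a b")
  case True
  have lim: "(\<lambda>n. flat 1 ((real n + 1) * t)) \<longlonglongrightarrow> 1" if "t > 0" for t
  proof -
    have "(\<lambda>n. exp (- (inverse (real (Suc n)) * inverse t))) \<longlonglongrightarrow> exp (- (0 * inverse t))"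
      by (intro tendsto_intros LIMSEQ_inverse_real_of_nat)
    moreover have "flat 1 ((real n + 1) * t) = exp (- (inverse (real (Suc n)) * inverse t))" for n
      using that by (simp add: flat_def inverse_eq_divide add.commute)
    ultimately show ?thesis by simp
  qed
  have "(\<lambda>n. bump a b (real n + 1) x) \<longlonglongrightarrow> (\<Prod>i\<in>(UNIV::'a set). 1 * 1)"
    unfolding bump_def using True by (intro tendsto_intros lim) (auto simp: mem_box_cart)
  then show ?thesis using True by simp
next
  case False
  then have "bump a b (real n + 1) x = 0" for n using bump_pos_iff[of "real n + 1" a b x] by auto
  then show ?thesis using False by simp
qed

text \<open>Passes to the gauge integral over a box, the form in which differentiation under the
  integral sign is applied below.\<close>

lemma integral_support_cbox:
  fixes g :: "'a::euclidean_space \<Rightarrow> real"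
  assumes "continuous_on UNIV g" "\<And>x. x \<notin> cbox a b \<Longrightarrow> g x = 0"
  shows "(\<integral>x. g x \<partial>lebesgue) = integral (cbox a b) g"
proof -
  have "g absolutely_integrable_on cbox a b"
    by (rule absolutely_integrable_continuous[OF continuous_on_subset[OF assms(1) subset_UNIV]])
  then have "(LINT x:cbox a b|lebesgue. g x) = integral (cbox a b) g" by (rule set_lebesgue_integral_eq_integral)
  then show ?thesis by (simp add: set_lebesgue_integral_support[OF assms(2)])
qed

section \<open>Convolution with a smooth kernel\<close>

definition convolve :: "(real^'n \<Rightarrow> real) \<Rightarrow> (real^'n \<Rightarrow> real) \<Rightarrow> real^'n \<Rightarrow> real" where
  "convolve w K x = (\<integral>z. w z * K (x - z) \<partial>lebesgue)"

lemma smooth_derivative: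
  assumes "smooth K"
  shows "(K has_derivative (\<lambda>h. \<Sum>j\<in>UNIV. h $ j * partial_deriv j K x)) (at x)"
proof -
  have "(K has_derivative frechet_derivative K (at x)) (at x)"
    using smooth_D(1)[OF assms] by (simp add: frechet_derivative_works)
  then show ?thesis using frechet_eq_partial[OF smooth_D(1)[OF assms]]
    by (metis (no_types, lifting) ext)
qed

text \<open>Differentiation under the integral over a box outside of which \<open>w\<close>
  vanishes. The derivative falls on the kernel, so continuity of \<open>w\<close> is enough.\<close>

lemma convolve_derivative:
  fixes w K :: "real^'n \<Rightarrow> real"
  assumes w: "continuous_on UNIV w" "\<And>z. z \<notin> cbox a b \<Longrightarrow> w z = 0" and K: "smooth K"
  shows "convolve w K differentiable (at x)" "partial_deriv j (convolve w K) x = convolve w (partial_deriv j K) x"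
proof -
  \<comment> \<open>The derivative in the first argument as a bounded linear form, jointly
    continuous as the differentiation under the integral demands.\<close>
  define D :: "real^'n \<Rightarrow> real^'n \<Rightarrow> (real^'n) \<Rightarrow>\<^sub>L real" where
    "D y z = w z *\<^sub>R (\<Sum>j\<in>UNIV. partial_deriv j K (y - z) *\<^sub>R blinfun_inner_left (axis j 1))" for y z
  have Dapp: "blinfun_apply (D y z) h = w z * (\<Sum>j\<in>UNIV. h $ j * partial_deriv j K (y - z))" for y z h
    by (simp add: D_def blinfun.bilinear_simps blinfun.sum_left blinfun_inner_left.rep_eq inner_axis mult.commute)
  note cK = smooth_D(3)[OF K] and cP = smooth_D(3)[OF smooth_D(2)[OF K]]
  have conv: "convolve w f y = integral (cbox a b) (\<lambda>z. w z * f (y - z))" if "continuous_on UNIV f" for f y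
    unfolding convolve_def
    by (rule integral_support_cbox)
      (auto intro!: continuous_intros w continuous_on_compose2[OF that] simp: w(2))
  have der: "((\<lambda>y. integral (cbox a b) (\<lambda>z. w z * K (y - z))) has_derivative
      blinfun_apply (integral (cbox a b) (D x))) (at x within UNIV)"
  proof (rule leibniz_rule)
    show "((\<lambda>y. w z * K (y - z)) has_derivative blinfun_apply (D y z)) (at y within UNIV)" for y z
      unfolding Dapp
      by (auto intro!: derivative_eq_intros has_derivative_compose[OF _ smooth_derivative[OF K]])
    show "(\<lambda>z. w z * K (y - z)) integrable_on cbox a b" for y
      by (intro integrable_continuous continuous_intros continuous_on_compose2[OF cK]
          continuous_on_subset[OF w(1)]) auto
    show "continuous_on (UNIV \<times> cbox a b) (\<lambda>(y, z). D y z)"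
      unfolding D_def split_beta
      by (intro continuous_intros continuous_on_compose2[OF cP] continuous_on_compose2[OF w(1)]) auto
  qed auto
  have eq: "convolve w K = (\<lambda>y. integral (cbox a b) (\<lambda>z. w z * K (y - z)))"
    using conv[OF cK] by blast
  have der': "(convolve w K has_derivative blinfun_apply (integral (cbox a b) (D x))) (at x)"
    unfolding eq using der by simp
  then show "convolve w K differentiable (at x)" by (auto simp: differentiable_def)
  have Dint: "D x integrable_on cbox a b"
    unfolding D_def
    by (intro integrable_continuous continuous_intros continuous_on_compose2[OF cP]
        continuous_on_subset[OF w(1)]) auto
  have "partial_deriv j (convolve w K) x = blinfun_apply (integral (cbox a b) (D x)) (axis j 1)"
    by (rule partial_deriv_eq[OF der'])
  also have "\<dots> = integral (cbox a b) (\<lambda>z. blinfun_apply (D x z) (axis j 1))"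
    by (rule blinfun_apply_integral[OF Dint])
  also have "(\<lambda>z. blinfun_apply (D x z) (axis j 1)) = (\<lambda>z. w z * partial_deriv j K (x - z))"
    unfolding Dapp by (simp add: axis_def if_distrib[of "\<lambda>t. t * _"] cong: if_cong)
  finally show "partial_deriv j (convolve w K) x = convolve w (partial_deriv j K) x"
    using conv[OF cP] by simp
qed

text \<open>Every partial derivative is again a convolution of \<open>w\<close> with a smooth
  kernel, so the induction keeps \<open>w\<close> and varies \<open>K\<close>.\<close>

lemma smooth_convolve:
  fixes w K :: "real^'n \<Rightarrow> real"
  assumes w: "continuous_on UNIV w" "\<And>z. z \<notin> cbox a b \<Longrightarrow> w z = 0" and K: "smooth K"
  shows "smooth (convolve w K)"
proof -
  have "times_diff k (convolve w K)" for k
    using K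
  proof (induction k arbitrary: K)
    case 0
    have "convolve w K differentiable_on UNIV"
      using convolve_derivative(1)[OF w 0] by (simp add: differentiable_on_def)
    then show ?case by (simp add: differentiable_imp_continuous_on)
  next
    case (Suc k)
    have "partial_deriv j (convolve w K) = convolve w (partial_deriv j K)" for j
      using convolve_derivative(2)[OF w Suc.prems] by blast
    then show ?case using Suc.IH[OF smooth_D(2)[OF Suc.prems]] convolve_derivative(1)[OF w Suc.prems] by simp
  qed
  then show ?thesis by (simp add: smooth_def)
qed

lemma lebesgue_integral_affine:
  fixes F :: "'a::euclidean_space \<Rightarrow> real"
  assumes F: "F \<in> borel_measurable borel" and c: "c \<noteq> 0"
  shows "(\<integral>z. F z \<partial>lebesgue) = \<bar>c\<bar> ^ DIM('a) * (\<integral>y. F (t + c *\<^sub>R y) \<partial>lebesgue)"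
proof -
  have m: "(\<lambda>y. F (t + c *\<^sub>R y)) \<in> borel_measurable borel" using F by measurable
  have "(\<integral>z. F z \<partial>lebesgue) = (\<integral>z. F z \<partial>lborel)" using F by (subst integral_completion) auto
  also have "\<dots> = (\<integral>z. F z \<partial>density (distr lborel borel (\<lambda>x. t + c *\<^sub>R x)) (\<lambda>_. ennreal (\<bar>c\<bar> ^ DIM('a))))"
    using lborel_affine[OF c, of t] by simp
  also have "\<dots> = (\<integral>z. \<bar>c\<bar> ^ DIM('a) *\<^sub>R F z \<partial>distr lborel borel (\<lambda>x. t + c *\<^sub>R x))"
    using F by (subst integral_density) auto
  also have "\<dots> = (\<integral>y. \<bar>c\<bar> ^ DIM('a) *\<^sub>R F (t + c *\<^sub>R y) \<partial>lborel)"
    using F by (subst integral_distr) auto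
  also have "\<dots> = \<bar>c\<bar> ^ DIM('a) * (\<integral>y. F (t + c *\<^sub>R y) \<partial>lebesgue)"
    using m by (subst integral_completion) auto
  finally show ?thesis .
qed

lemma integrable_continuous_bounded_support:
  fixes f :: "'a::euclidean_space \<Rightarrow> real"
  assumes "continuous_on UNIV f" "bounded S" "\<And>x. x \<notin> S \<Longrightarrow> f x = 0"
  shows "integrable lebesgue f"
proof -
  obtain B where "\<And>x. norm (f x) \<le> B"
    using bounded_support_imp_bounded[OF assms] by blast
  then show ?thesis
    by (intro integrable_bounded_support[OF continuous_imp_measurable_lebesgue[OF assms(1)] _ assms(3,2)]) auto
qed

definition unit_bump :: "real^'n \<Rightarrow> real" where
  "unit_bump = bump (\<chi> i. - 1) (\<chi> i. 1) 1"

text \<open>The parameter is the reciprocal of the usual width: for positive \<open>m\<close> the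
  mass 1 sits on a cube of half side \<open>1 / m\<close>.\<close>

definition mollifier :: "real \<Rightarrow> real^'n \<Rightarrow> real" where
  "mollifier m x = m ^ CARD('n) * (unit_bump (m *\<^sub>R x) / (\<integral>y. unit_bump (y :: real^'n) \<partial>lebesgue))"

lemma mollifier_scale: "mollifier m x = m ^ CARD('n) * mollifier 1 (m *\<^sub>R x)" for x :: "real^'n"
  by (simp add: mollifier_def)

lemma smooth_mollifier: "smooth (mollifier m :: real^'n \<Rightarrow> real)"
proof -
  let ?c = "\<integral>y. unit_bump (y :: real^'n) \<partial>lebesgue"
  have "times_diff k (\<lambda>x :: real^'n. (m ^ CARD('n) / ?c) *
      (\<Prod>i\<in>UNIV. flat 1 (1 + m * x $ i) * flat 1 (1 + (- m) * x $ i)))" for k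
    by (intro times_diff_prod times_diff_mult times_diff_flat times_diff_const) auto
  moreover have "(\<lambda>x :: real^'n. (m ^ CARD('n) / ?c) *
      (\<Prod>i\<in>UNIV. flat 1 (1 + m * x $ i) * flat 1 (1 + (- m) * x $ i))) = mollifier m"
    by (simp add: mollifier_def unit_bump_def bump_def fun_eq_iff add.commute)
  ultimately show ?thesis by (simp add: smooth_def)
qed

lemma mollifier_outside: "x \<notin> cbox (\<chi> i. - 1) (\<chi> i. 1) \<Longrightarrow> mollifier 1 x = 0" for x :: "real^'n"
  using bump_pos_iff[of 1 "\<chi> i. - 1" "\<chi> i. 1" x] box_subset_cbox[of "\<chi> i. - 1" "\<chi> i. 1 :: real^'n"]
  by (auto simp: mollifier_def unit_bump_def)

lemma partial_mollifier_outside: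
  "x \<notin> cbox (\<chi> i. - 1) (\<chi> i. 1) \<Longrightarrow> partial_deriv j (mollifier 1) x = 0" for x :: "real^'n"
  by (rule partial_deriv_zero_outside[OF closed_cbox mollifier_outside])

lemma integrable_mult_mollifier:
  fixes f :: "real^'n \<Rightarrow> real"
  assumes "continuous_on UNIV f"
  shows "integrable lebesgue (\<lambda>y. f y * mollifier 1 y)"
    "integrable lebesgue (\<lambda>y. f y * partial_deriv j (mollifier 1) y)"
    "integrable lebesgue (\<lambda>y. f y * \<bar>partial_deriv j (mollifier 1) y\<bar>)"
  using smooth_D(3)[OF smooth_mollifier] smooth_D(3)[OF smooth_D(2)[OF smooth_mollifier]]
  by (auto intro!: integrable_continuous_bounded_support[where S = "cbox (\<chi> i. - 1) (\<chi> i. 1)"]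
      continuous_intros assms simp: mollifier_outside partial_mollifier_outside)

text \<open>A nonnegative function with integral 0 vanishes almost everywhere, which would make the
  nonempty open cube a null set.\<close>

lemma unit_bump_integral_pos: "0 < (\<integral>y. unit_bump (y :: real^'n) \<partial>lebesgue)"
proof -
  let ?B = "box (\<chi> i. - 1) (\<chi> i. 1) :: (real^'n) set"
  have z: "unit_bump x = 0" if "x \<notin> ?B" for x :: "real^'n"
    using that bump_pos_iff[of 1 "\<chi> i. - 1" "\<chi> i. 1" x] by (auto simp: unit_bump_def)
  have c: "continuous_on UNIV (unit_bump :: real^'n \<Rightarrow> real)"
    unfolding unit_bump_def by (rule smooth_D(3)[OF smooth_bump])
  have i: "integrable lebesgue (unit_bump :: real^'n \<Rightarrow> real)"
    by (rule integrable_continuous_bounded_support[OF c bounded_box z])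
  have nn: "0 \<le> unit_bump x" for x :: "real^'n" unfolding unit_bump_def by (rule bump_bounds)
  have "(\<integral>y. unit_bump (y :: real^'n) \<partial>lebesgue) \<noteq> 0"
  proof
    assume "(\<integral>y. unit_bump (y :: real^'n) \<partial>lebesgue) = 0"
    then have "AE x in lebesgue. unit_bump (x :: real^'n) = 0"
      using integral_nonneg_eq_0_iff_AE[OF i] nn by auto
    then have "negligible {x :: real^'n. unit_bump x \<noteq> 0}"
      by (simp add: AE_iff_null_sets negligible_iff_null_sets eventually_ae_filter)
        (metis (mono_tags, lifting) completion.complete2)
    moreover have "{x :: real^'n. unit_bump x \<noteq> 0} = ?B"
      using bump_pos_iff[of 1 "\<chi> i. - 1" "\<chi> i. 1"] by (auto simp: unit_bump_def)
    moreover have "0 \<in> ?B" by (simp add: mem_box_cart)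
    ultimately show False using open_not_negligible[OF open_box] by (metis empty_iff)
  qed
  then show ?thesis using nn by (simp add: less_le integral_nonneg)
qed

lemma mollifier_nonneg: "0 \<le> mollifier 1 x" for x :: "real^'n"
  using unit_bump_integral_pos[where 'n = 'n]
  by (simp add: mollifier_def unit_bump_def bump_bounds(1) less_imp_le)

lemma mollifier_test_function: "mollifier 1 \<in> test_functions (UNIV :: (real^'n) set)"
proof -
  have "{x :: real^'n. mollifier 1 x \<noteq> 0} \<subseteq> cbox (\<chi> i. - 1) (\<chi> i. 1)" using mollifier_outside by blast
  then have "compact (closure {x :: real^'n. mollifier 1 x \<noteq> 0})"
    using bounded_subset[OF bounded_cbox] by (simp add: compact_closure)
  then show ?thesis by (simp add: test_functions_def smooth_mollifier)
qed

lemma mollifier_integral: "(\<integral>x. mollifier 1 (x :: real^'n) \<partial>lebesgue) = 1"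
  using unit_bump_integral_pos[where 'n = 'n] by (simp add: mollifier_def)

text \<open>Integration by parts against the constant 1.\<close>

lemma mollifier_moment_0: "(\<integral>x. partial_deriv j (mollifier 1) (x :: real^'n) \<partial>lebesgue) = 0"
proof -
  have p: "partial_deriv j (\<lambda>_ :: real^'n. 1 :: real) = (\<lambda>_. 0)" for j
    using partial_deriv_eq[OF has_derivative_const] by (intro ext) auto
  have "(LINT x:UNIV|lebesgue. 1 * partial_deriv j (mollifier 1) (x :: real^'n)) =
      - (LINT x:UNIV|lebesgue. partial_deriv j (\<lambda>_ :: real^'n. 1) x * mollifier 1 x)"
    by (rule classical_integral_by_parts[OF open_UNIV _ _ mollifier_test_function]) (simp_all add: p)
  then show ?thesis by (simp add: p set_lebesgue_integral_def)
qed

text \<open>Integration by parts against a coordinate function. These moments turn averages of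
  difference quotients into partial derivatives.\<close>

lemma mollifier_moment_1:
  "(\<integral>x. x $ i * partial_deriv j (mollifier 1) (x :: real^'n) \<partial>lebesgue) = - (if i = j then 1 else 0)"
proof -
  have d: "((\<lambda>x :: real^'n. x $ i) has_derivative (\<lambda>h. h $ i)) (at x)" for x
    by (rule bounded_linear_imp_has_derivative[OF bounded_linear_vec_nth])
  have p: "partial_deriv j (\<lambda>x :: real^'n. x $ i) = (\<lambda>_. if i = j then 1 else 0)" for j
    using partial_deriv_eq[OF d] by (intro ext) (auto simp: axis_def)
  have "(LINT x:UNIV|lebesgue. x $ i * partial_deriv j (mollifier 1) (x :: real^'n)) =
      - (LINT x:UNIV|lebesgue. partial_deriv j (\<lambda>x :: real^'n. x $ i) x * mollifier 1 x)"
    using d by (intro classical_integral_by_parts[OF open_UNIV _ _ mollifier_test_function])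
      (auto simp: p differentiable_def)
  then show ?thesis
    by (simp add: p set_lebesgue_integral_def mollifier_integral)
qed

lemma mollifier_partial:
  fixes x :: "real^'n"
  assumes "0 < m"
  shows "partial_deriv j (mollifier m) x = m ^ CARD('n) * (m * partial_deriv j (mollifier 1) (m *\<^sub>R x))"
proof -
  have der: "((\<lambda>x :: real^'n. m ^ CARD('n) * mollifier 1 (m *\<^sub>R x)) has_derivative
      (\<lambda>h. m ^ CARD('n) * (\<Sum>i\<in>UNIV. (m *\<^sub>R h) $ i * partial_deriv i (mollifier 1) (m *\<^sub>R x)))) (at x)"
    by (intro has_derivative_mult_right has_derivative_compose[OF _ smooth_derivative[OF smooth_mollifier]])
      (auto intro!: derivative_eq_intros)
  have eq: "(\<lambda>x :: real^'n. m ^ CARD('n) * mollifier 1 (m *\<^sub>R x)) = mollifier m"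
    by (intro ext) (rule mollifier_scale[symmetric])
  have "partial_deriv j (mollifier m) x =
      m ^ CARD('n) * (\<Sum>i\<in>UNIV. (m *\<^sub>R (axis j 1 :: real^'n)) $ i * partial_deriv i (mollifier 1) (m *\<^sub>R x))"
    by (rule partial_deriv_eq[OF der, unfolded eq])
  also have "(\<Sum>i\<in>UNIV. (m *\<^sub>R (axis j 1 :: real^'n)) $ i * partial_deriv i (mollifier 1) (m *\<^sub>R x)) =
      (\<Sum>i\<in>UNIV. if i = j then m * partial_deriv i (mollifier 1) (m *\<^sub>R x) else 0)"
    by (intro sum.cong) (auto simp: axis_def)
  also have "\<dots> = m * partial_deriv j (mollifier 1) (m *\<^sub>R x)" by simp
  finally show ?thesis .
qed

text \<open>The substitution of \<open>x - y / m\<close> for the integration variable absorbs the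
  normalising power of \<open>m\<close>.\<close>

lemma convolve_scaled:
  fixes w f :: "real^'n \<Rightarrow> real"
  assumes w: "continuous_on UNIV w" and f: "continuous_on UNIV f" and m: "0 < m"
  shows "convolve w (\<lambda>x. m ^ CARD('n) * f (m *\<^sub>R x)) x = (\<integral>y. w (x + (- (1 / m)) *\<^sub>R y) * f y \<partial>lebesgue)"
proof -
  let ?F = "\<lambda>z. w z * (m ^ CARD('n) * f (m *\<^sub>R (x - z)))"
  have "continuous_on UNIV ?F"
    by (intro continuous_intros w continuous_on_compose2[OF f]) auto
  then have "?F \<in> borel_measurable borel" by (rule borel_measurable_continuous_onI)
  then have "convolve w (\<lambda>x. m ^ CARD('n) * f (m *\<^sub>R x)) x =
      \<bar>- (1 / m)\<bar> ^ CARD('n) * (\<integral>y. ?F (x + (- (1 / m)) *\<^sub>R y) \<partial>lebesgue)"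
    using lebesgue_integral_affine[of ?F "- (1 / m)" x] m by (simp add: convolve_def)
  also have "\<dots> = (\<integral>y. \<bar>- (1 / m)\<bar> ^ CARD('n) * ?F (x + (- (1 / m)) *\<^sub>R y) \<partial>lebesgue)" by simp
  also have "\<dots> = (\<integral>y. w (x + (- (1 / m)) *\<^sub>R y) * f y \<partial>lebesgue)"
    using m by (intro Bochner_Integration.integral_cong) (auto simp: power_one_over)
  finally show ?thesis .
qed

lemma norm_unit_cbox: "y \<in> cbox (\<chi> i. - 1) (\<chi> i. 1) \<Longrightarrow> norm y \<le> CARD('n)" for y :: "real^'n"
proof -
  assume "y \<in> cbox (\<chi> i. - 1) (\<chi> i. 1)"
  then have "\<bar>y $ i\<bar> \<le> 1" for i by (simp add: mem_box_cart abs_le_iff minus_le_iff)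
  then have "(\<Sum>i\<in>UNIV. \<bar>y $ i\<bar>) \<le> (\<Sum>i\<in>(UNIV :: 'n set). 1)" by (intro sum_mono) auto
  then show ?thesis using norm_le_l1_cart[of y] by simp
qed

section \<open>Mollification of a Lipschitz function with compact support\<close>

context
  fixes w :: "real^'n \<Rightarrow> real" and L :: real and C N :: "(real^'n) set"
  assumes lip: "L-lipschitz_on UNIV w" and C: "compact C" "\<And>x. x \<notin> C \<Longrightarrow> w x = 0"
begin

lemma mollify_eq:
  assumes "0 < m"
  shows "convolve w (mollifier m) x = (\<integral>y. w (x + (- (1 / m)) *\<^sub>R y) * mollifier 1 y \<partial>lebesgue)"
proof -
  have "convolve w (mollifier m) x = convolve w (\<lambda>x. m ^ CARD('n) * mollifier 1 (m *\<^sub>R x)) x"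
    by (intro arg_cong[where f = "\<lambda>f. convolve w f x"] ext) (rule mollifier_scale)
  then show ?thesis
    using convolve_scaled[OF lipschitz_on_continuous_on[OF lip] smooth_D(3)[OF smooth_mollifier] assms] by simp
qed

lemma shift_cont: "continuous_on UNIV (\<lambda>y. w (x + c *\<^sub>R y))"
  by (intro continuous_on_compose2[OF lipschitz_on_continuous_on[OF lip]] continuous_intros) auto

text \<open>The error is at most the Lipschitz constant times the first absolute moment of the
  kernel, divided by \<open>m\<close>; neither factor depends on \<open>x\<close>.\<close>

lemma mollify_close:
  "\<exists>M. \<forall>x m. 0 < m \<longrightarrow> \<bar>convolve w (mollifier m) x - w x\<bar> \<le> M / m"
proof (intro exI allI impI)
  fix x m assume m: "0 < (m :: real)"
  have i1: "integrable lebesgue (\<lambda>y. w (x + (- (1 / m)) *\<^sub>R y) * mollifier 1 y)"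
    by (rule integrable_mult_mollifier(1)[OF shift_cont])
  have i2: "integrable lebesgue (\<lambda>y. w x * mollifier 1 y)"
    by (rule integrable_mult_mollifier(1)[OF continuous_on_const])
  have i3: "integrable lebesgue (\<lambda>y :: real^'n. (L / m) * (norm y * mollifier 1 y))"
    by (intro integrable_mult_right integrable_mult_mollifier(1) continuous_intros)
  have "w x = (\<integral>y. w x * mollifier 1 y \<partial>lebesgue)" by (simp add: mollifier_integral)
  then have "convolve w (mollifier m) x - w x =
      (\<integral>y. w (x + (- (1 / m)) *\<^sub>R y) * mollifier 1 y - w x * mollifier 1 y \<partial>lebesgue)"
    unfolding Bochner_Integration.integral_diff[OF i1 i2] mollify_eq[OF m] by simp
  also have "\<bar>\<dots>\<bar> \<le> (\<integral>y. (L / m) * (norm y * mollifier 1 y) \<partial>(lebesgue :: (real^'n) measure))"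
  proof (rule integral_abs_bound_integral[OF Bochner_Integration.integrable_diff[OF i1 i2] i3])
    fix y
    have "\<bar>w (x + (- (1 / m)) *\<^sub>R y) - w x\<bar> \<le> L * (norm y / m)"
      using lipschitz_onD[OF lip, of "x + (- (1 / m)) *\<^sub>R y" x] m by (simp add: dist_norm)
    then have "\<bar>w (x + (- (1 / m)) *\<^sub>R y) - w x\<bar> * mollifier 1 y \<le> L * (norm y / m) * mollifier 1 y"
      by (rule mult_right_mono[OF _ mollifier_nonneg])
    then show "\<bar>w (x + (- (1 / m)) *\<^sub>R y) * mollifier 1 y - w x * mollifier 1 y\<bar> \<le> (L / m) * (norm y * mollifier 1 y)"
      using mollifier_nonneg[of y] by (simp add: left_diff_distrib[symmetric] abs_mult)
  qed
  also have "\<dots> = (\<integral>y. L * (norm (y :: real^'n) * mollifier 1 y) \<partial>lebesgue) / m" by simp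
  finally show "\<bar>convolve w (mollifier m) x - w x\<bar> \<le> (\<integral>y. L * (norm (y :: real^'n) * mollifier 1 y) \<partial>lebesgue) / m" .
qed

lemma w_outside_cbox: "\<exists>a b. \<forall>z. z \<notin> cbox a b \<longrightarrow> w z = 0"
proof -
  obtain a where "C \<subseteq> cbox (- a) a"
    using bounded_subset_cbox_symmetric[OF compact_imp_bounded[OF C(1)]] .
  then show ?thesis using C(2) by (intro exI[of _ "- a"] exI[of _ a]) auto
qed

lemma smooth_mollify: "smooth (convolve w (mollifier m))"
proof -
  obtain a b where "\<And>z. z \<notin> cbox a b \<Longrightarrow> w z = 0" using w_outside_cbox by auto
  then show ?thesis by (rule smooth_convolve[OF lipschitz_on_continuous_on[OF lip] _ smooth_mollifier])
qed

text \<open>The kernel lives on a cube whose points have norm at most \<open>CARD('n)\<close>, so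
  \<open>w\<close> is sampled only within the distance \<open>CARD('n) / m\<close>.\<close>

lemma mollify_outside:
  assumes "0 < m" "\<And>y. y \<in> C \<Longrightarrow> CARD('n) / m < dist x y"
  shows "convolve w (mollifier m) x = 0"
proof -
  have "w (x + (- (1 / m)) *\<^sub>R y) * mollifier 1 y = 0" for y :: "real^'n"
  proof (cases "y \<in> cbox (\<chi> i. - 1) (\<chi> i. 1)")
    case True
    have "dist x (x + (- (1 / m)) *\<^sub>R y) = norm y / m" using assms(1) by (simp add: dist_norm)
    also have "\<dots> \<le> CARD('n) / m" using norm_unit_cbox[OF True] assms(1) by (intro divide_right_mono) auto
    finally have "x + (- (1 / m)) *\<^sub>R y \<notin> C" using assms(2) by force
    then show ?thesis using C(2) by simp
  qed (simp add: mollifier_outside)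
  then show ?thesis unfolding mollify_eq[OF assms(1)] by (simp only: Bochner_Integration.integral_zero)
qed

text \<open>As the integral of the derivative of the kernel vanishes, the derivative of the mollified function
  becomes an average of difference quotients. It converges at every point of differentiability.\<close>

lemma partial_mollify:
  assumes m: "0 < m"
  shows "partial_deriv j (convolve w (mollifier m)) x =
    (\<integral>y. (m * (w (x + (- (1 / m)) *\<^sub>R y) - w x)) * partial_deriv j (mollifier 1) y \<partial>lebesgue)"
proof -
  have cm: "continuous_on UNIV (partial_deriv j (mollifier 1 :: real^'n \<Rightarrow> real))"
    by (rule smooth_D(3)[OF smooth_D(2)[OF smooth_mollifier]])
  obtain a b where ab: "\<And>z. z \<notin> cbox a b \<Longrightarrow> w z = 0" using w_outside_cbox by auto
  have i1: "integrable lebesgue (\<lambda>y. w (x + (- (1 / m)) *\<^sub>R y) * partial_deriv j (mollifier 1) y)"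
    by (rule integrable_mult_mollifier(2)[OF shift_cont])
  have i2: "integrable lebesgue (\<lambda>y. w x * partial_deriv j (mollifier 1) y)"
    by (rule integrable_mult_mollifier(2)[OF continuous_on_const])
  have "partial_deriv j (convolve w (mollifier m)) x = convolve w (partial_deriv j (mollifier m)) x"
    by (rule convolve_derivative(2)[OF lipschitz_on_continuous_on[OF lip] ab smooth_mollifier])
  also have "\<dots> = convolve w (\<lambda>x. m ^ CARD('n) * (m * partial_deriv j (mollifier 1) (m *\<^sub>R x))) x"
    by (intro arg_cong[where f = "\<lambda>f. convolve w f x"] ext) (rule mollifier_partial[OF m])
  also have "\<dots> = (\<integral>y. w (x + (- (1 / m)) *\<^sub>R y) * (m * partial_deriv j (mollifier 1) y) \<partial>lebesgue)"
    by (rule convolve_scaled[OF lipschitz_on_continuous_on[OF lip] _ m]) (intro continuous_intros cm)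
  also have "\<dots> = m * (\<integral>y. w (x + (- (1 / m)) *\<^sub>R y) * partial_deriv j (mollifier 1) y \<partial>lebesgue)"
    by (simp add: mult.left_commute)
  also have "(\<integral>y. w (x + (- (1 / m)) *\<^sub>R y) * partial_deriv j (mollifier 1) y \<partial>lebesgue) =
      (\<integral>y. w (x + (- (1 / m)) *\<^sub>R y) * partial_deriv j (mollifier 1) y - w x * partial_deriv j (mollifier 1) y \<partial>lebesgue)"
    using i1 i2 by (simp only: Bochner_Integration.integral_diff integral_mult_right_zero mollifier_moment_0)
  also have "m * \<dots> = (\<integral>y. m * (w (x + (- (1 / m)) *\<^sub>R y) * partial_deriv j (mollifier 1) y
      - w x * partial_deriv j (mollifier 1) y) \<partial>lebesgue)" by simp
  also have "\<dots> = (\<integral>y. (m * (w (x + (- (1 / m)) *\<^sub>R y) - w x)) * partial_deriv j (mollifier 1) y \<partial>lebesgue)"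
    by (simp add: algebra_simps)
  finally show ?thesis .
qed

lemma difference_bound:
  assumes "0 < m"
  shows "\<bar>m * (w (x + (- (1 / m)) *\<^sub>R y) - w x)\<bar> \<le> L * norm y"
proof -
  have "\<bar>w (x + (- (1 / m)) *\<^sub>R y) - w x\<bar> \<le> L * (norm y / m)"
    using lipschitz_onD[OF lip, of "x + (- (1 / m)) *\<^sub>R y" x] assms by (simp add: dist_norm)
  then have "m * \<bar>w (x + (- (1 / m)) *\<^sub>R y) - w x\<bar> \<le> m * (L * (norm y / m))"
    using assms by (intro mult_left_mono) auto
  then show ?thesis using assms unfolding abs_mult by simp
qed

lemma dominating_integrable:
  "integrable lebesgue (\<lambda>y :: real^'n. (L * norm y) * \<bar>partial_deriv j (mollifier 1) y\<bar>)"
  by (intro integrable_mult_mollifier(3) continuous_intros)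

lemma partial_integrand_integrable:
  "integrable lebesgue (\<lambda>y. (m * (w (x + (- (1 / m)) *\<^sub>R y) - w x)) * partial_deriv j (mollifier 1) y)"
  by (intro integrable_mult_mollifier(2) continuous_intros shift_cont)

text \<open>By \<open>partial_mollify\<close> only difference quotients of \<open>w\<close> enter,
  and these are at most \<open>L * norm y\<close> for all \<open>x\<close> and
  \<open>m\<close>.\<close>

lemma partial_mollify_bound:
  "\<exists>B. \<forall>x m. 0 < m \<longrightarrow> \<bar>partial_deriv j (convolve w (mollifier m)) x\<bar> \<le> B"
proof (intro exI allI impI)
  fix x m assume m: "0 < (m :: real)"
  show "\<bar>partial_deriv j (convolve w (mollifier m)) x\<bar> \<le>
      (\<integral>y. (L * norm y) * \<bar>partial_deriv j (mollifier 1) (y :: real^'n)\<bar> \<partial>lebesgue)"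
    unfolding partial_mollify[OF m]
  proof (rule integral_abs_bound_integral[OF partial_integrand_integrable dominating_integrable])
    show "\<bar>m * (w (x + (- (1 / m)) *\<^sub>R y) - w x) * partial_deriv j (mollifier 1) y\<bar>
        \<le> L * norm y * \<bar>partial_deriv j (mollifier 1) y\<bar>" for y
      unfolding abs_mult[of "m * _"] by (rule mult_right_mono[OF difference_bound[OF m]]) simp
  qed
qed

text \<open>The quotients tend to minus the derivative of \<open>w\<close> in the direction
  \<open>y\<close>, and the first moments of the differentiated kernel pick out the coordinate
  \<open>j\<close> with another minus sign.\<close>

lemma partial_mollify_tendsto:
  assumes d: "w differentiable (at x)"
  shows "(\<lambda>n. partial_deriv j (convolve w (mollifier (real n + 1))) x) \<longlonglongrightarrow> partial_deriv j w x"
proof -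
  \<comment> \<open>Negative steps, because the convolution samples \<open>w\<close> at
    \<open>x - y / m\<close>.\<close>
  let ?h = "\<lambda>n :: nat. - (1 / (real n + 1))"
  have h: "?h \<longlonglongrightarrow> 0" "?h n \<noteq> 0" for n
    using tendsto_minus[OF LIMSEQ_inverse_real_of_nat] by (auto simp: inverse_eq_divide add.commute)
  have "(\<lambda>n. \<integral>y. ((real n + 1) * (w (x + (- (1 / (real n + 1))) *\<^sub>R y) - w x)) * partial_deriv j (mollifier 1) y \<partial>lebesgue)
      \<longlonglongrightarrow> (\<integral>y. - (\<Sum>i\<in>UNIV. y $ i * partial_deriv i w x) * partial_deriv j (mollifier 1) y \<partial>lebesgue)"
  proof (rule integral_dominated_convergence[OF _ _ dominating_integrable[of j]])
    show "AE y in lebesgue. (\<lambda>n. ((real n + 1) * (w (x + (- (1 / (real n + 1))) *\<^sub>R y) - w x)) * partial_deriv j (mollifier 1) y)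
      \<longlonglongrightarrow> - (\<Sum>i\<in>UNIV. y $ i * partial_deriv i w x) * partial_deriv j (mollifier 1) y"
    proof (intro AE_I2 tendsto_mult tendsto_const)
      fix y
      have "(\<lambda>n. - ((w (x + ?h n *\<^sub>R y) - w x) / ?h n)) \<longlonglongrightarrow> - frechet_derivative w (at x) y"
        using d by (intro tendsto_minus difference_quotient_tendsto[OF _ h]) (simp add: frechet_derivative_works)
      moreover have "- ((w (x + ?h n *\<^sub>R y) - w x) / ?h n) = (real n + 1) * (w (x + ?h n *\<^sub>R y) - w x)" for n
        by simp
      ultimately show "(\<lambda>n. (real n + 1) * (w (x + ?h n *\<^sub>R y) - w x)) \<longlonglongrightarrow> - (\<Sum>i\<in>UNIV. y $ i * partial_deriv i w x)"
        unfolding frechet_eq_partial[OF d] by (simp only:)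
    qed
    show "(\<lambda>y. - (\<Sum>i\<in>UNIV. y $ i * partial_deriv i w x) * partial_deriv j (mollifier 1) y) \<in> borel_measurable lebesgue"
      by (intro continuous_imp_measurable_lebesgue continuous_intros smooth_D(3)[OF smooth_D(2)[OF smooth_mollifier]])
    show "(\<lambda>y. ((real n + 1) * (w (x + (- (1 / (real n + 1))) *\<^sub>R y) - w x)) * partial_deriv j (mollifier 1) y)
        \<in> borel_measurable lebesgue" for n
      using partial_integrand_integrable by blast
    show "AE y in lebesgue. norm (((real n + 1) * (w (x + (- (1 / (real n + 1))) *\<^sub>R y) - w x)) * partial_deriv j (mollifier 1) y)
        \<le> (L * norm y) * \<bar>partial_deriv j (mollifier 1) y\<bar>" for n
      unfolding real_norm_def abs_mult[of "_ * _"]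
      by (intro AE_I2 mult_right_mono[OF difference_bound]) auto
  qed
  also have "(\<integral>y. - (\<Sum>i\<in>UNIV. y $ i * partial_deriv i w x) * partial_deriv j (mollifier 1) y \<partial>lebesgue) =
      (\<integral>y. (\<Sum>i\<in>UNIV. - partial_deriv i w x * (y $ i * partial_deriv j (mollifier 1) y)) \<partial>lebesgue)"
    by (simp add: sum_distrib_right sum_distrib_left sum_negf mult_ac)
  also have "\<dots> = (\<Sum>i\<in>UNIV. - partial_deriv i w x * (\<integral>y. y $ i * partial_deriv j (mollifier 1) y \<partial>lebesgue))"
  proof (subst Bochner_Integration.integral_sum)
    show "integrable lebesgue (\<lambda>y. - partial_deriv i w x * (y $ i * partial_deriv j (mollifier 1) y))" for i
      by (intro integrable_mult_right integrable_mult_mollifier(2) continuous_intros)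
  qed simp
  also have "\<dots> = partial_deriv j w x"
    by (simp add: mollifier_moment_1 if_distrib cong: if_cong)
  finally show ?thesis by (simp add: partial_mollify add_nonneg_pos)
qed

end

lemma differentiable_vec:
  fixes f :: "'a::euclidean_space \<Rightarrow> real^'m"
  assumes "\<And>i. (\<lambda>x. f x $ i) differentiable (at x)"
  shows "f differentiable (at x)"
  unfolding differentiable_componentwise_within[of f]
  using assms by (auto simp: Basis_vec_def inner_axis)

lemma set_integrable_support:
  fixes F :: "'a \<Rightarrow> real"
  assumes "integrable M F" "\<And>x. x \<notin> \<Omega> \<Longrightarrow> F x = 0"
  shows "set_integrable M \<Omega> F"
proof -
  have "(\<lambda>x. indicator \<Omega> x *\<^sub>R F x) = F"
  proof
    show "indicator \<Omega> x *\<^sub>R F x = F x" for x using assms(2)[of x] by (cases "x \<in> \<Omega>") auto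
  qed
  then show ?thesis using assms(1) by (simp add: set_integrable_def)
qed

text \<open>Each component is mollified. The values converge uniformly, the gradients converge
  almost everywhere with a common bound, and all supports lie in one compact set, so both integrals
  tend to 0. Integrability belongs to the conclusion because the integral of a function that is not
  integrable is 0 by convention, so that smallness alone would say nothing.\<close>

lemma test_function_approximation:
  fixes v :: "real^'n \<Rightarrow> real^'m"
  assumes lip: "L-lipschitz_on UNIV v" and C: "compact C" "C \<subseteq> \<Omega>" "\<And>x. x \<notin> C \<Longrightarrow> v x = 0"
    and \<Omega>: "open \<Omega>" and N: "negligible N" "\<And>x. x \<notin> N \<Longrightarrow> v differentiable (at x)" and e: "0 < e"
  obtains \<psi> :: "real^'n \<Rightarrow> real^'m" where "\<And>i. (\<lambda>x. \<psi> x $ i) \<in> test_functions \<Omega>"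
    "set_integrable lebesgue \<Omega> (\<lambda>x. norm (v x - \<psi> x))"
    "set_integrable lebesgue \<Omega> (\<lambda>x. norm (jacobian v (at x) - jacobian \<psi> (at x)))"
    "(LINT x:\<Omega>|lebesgue. norm (v x - \<psi> x)) < e"
    "(LINT x:\<Omega>|lebesgue. norm (jacobian v (at x) - jacobian \<psi> (at x))) < e"
proof -
  obtain d where d: "0 < d" "(\<Union>x\<in>C. cball x d) \<subseteq> \<Omega>"
    using compact_subset_open_imp_cball_epsilon_subset[OF C(1) \<Omega> C(2)] by blast
  \<comment> \<open>A compact neighbourhood of \<open>C\<close> inside \<Omega> that will contain
    the supports of all approximations.\<close>
  define K where "K = (\<Union>x\<in>C. cball x d)"
  have K: "compact K" "K \<subseteq> \<Omega>" unfolding K_def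
    using compact_minkowski_sum_cball[OF C(1)] d(2) by auto
  have CK: "C \<subseteq> K" using d(1) by (force simp: K_def)
  \<comment> \<open>Skips the indices for which a mollified component might not vanish outside
    \<open>K\<close>.\<close>
  obtain n0 :: nat where n0: "CARD('n) / d < n0" using reals_Archimedean2 by blast
  define m where "m n = real (n + n0) + 1" for n
  have m: "0 < m n" "1 \<le> m n" "CARD('n) / m n < d" for n
  proof -
    show "0 < m n" "1 \<le> m n" by (simp_all add: m_def)
    have "CARD('n) < n0 * d" using n0 d(1) by (simp add: divide_less_eq)
    also have "\<dots> \<le> m n * d" using d(1) by (intro mult_right_mono) (simp_all add: m_def)
    finally show "CARD('n) / m n < d" by (simp add: divide_less_eq mult.commute m_def add_nonneg_pos)
  qed
  let ?w = "\<lambda>i x. v x $ i"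
  have wl: "L-lipschitz_on UNIV (?w i)" for i by (rule lipschitz_component[OF lip])
  have w0: "?w i x = 0" if "x \<notin> C" for i x using C(3)[OF that] by simp
  define \<psi> where "\<psi> n x = (\<chi> i. convolve (?w i) (mollifier (m n)) x)" for n x
  have \<psi>i: "(\<lambda>x. \<psi> n x $ i) = convolve (?w i) (mollifier (m n))" for n i
    by (simp add: \<psi>_def)
  have sm: "smooth (\<lambda>x. \<psi> n x $ i)" for n i
    unfolding \<psi>i by (rule smooth_mollify[OF wl C(1) w0])
  have out: "\<psi> n x = 0" if "x \<notin> K" for n x
  proof -
    have far: "CARD('n) / m n < dist x y" if "y \<in> C" for y
      using \<open>x \<notin> K\<close> that m(3)[of n] by (force simp: K_def dist_commute)
    have "convolve (?w i) (mollifier (m n)) x = 0" for i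
      by (rule mollify_outside[OF wl C(1) w0 m(1) far])
    then show ?thesis by (simp add: \<psi>_def vec_eq_iff)
  qed
  have test: "(\<lambda>x. \<psi> n x $ i) \<in> test_functions \<Omega>" for n i
  proof -
    have "{x. \<psi> n x $ i \<noteq> 0} \<subseteq> K" using out[of _ n] by fastforce
    then have cl: "closure {x. \<psi> n x $ i \<noteq> 0} \<subseteq> K" by (rule closure_minimal[OF _ compact_imp_closed[OF K(1)]])
    then have "compact (closure {x. \<psi> n x $ i \<noteq> 0})"
      using bounded_subset[OF compact_imp_bounded[OF K(1)]] by (simp add: compact_eq_bounded_closed)
    then show ?thesis using cl K(2) sm unfolding test_functions_def by blast
  qed
  have \<psi>d: "\<psi> n differentiable (at x)" for n x
    by (rule differentiable_vec) (rule smooth_D(1)[OF sm])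
  have jac: "jacobian (\<psi> n) (at x) $ i $ j = partial_deriv j (convolve (?w i) (mollifier (m n))) x" for n x i j
    using partial_deriv_component(1)[OF \<psi>d, of j n i x] by (simp add: \<psi>i)
  have AEN: "AE x in lebesgue. x \<notin> N" using N(1) by (simp add: AE_not_in negligible_iff_null_sets)
  have Km: "K \<in> lmeasurable" using K(1) by (rule lmeasurable_compact)
  have dom: "integrable lebesgue (\<lambda>x. B * indicator K x :: real)" for B
    using Km by (intro integrable_mult_right integrable_real_indicator) (auto simp: fmeasurable_def)

  have "\<forall>i. \<exists>M. \<forall>x m. 0 < m \<longrightarrow> \<bar>convolve (?w i) (mollifier m) x - ?w i x\<bar> \<le> M / m"
    using mollify_close[OF wl C(1) w0] by blast
  then obtain M where M: "\<And>i x m. 0 < m \<Longrightarrow> \<bar>convolve (?w i) (mollifier m) x - ?w i x\<bar> \<le> M i / m" by metis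
  have cl: "norm (v x - \<psi> n x) \<le> (\<Sum>i\<in>UNIV. \<bar>M i\<bar>) / m n" for n x
  proof -
    have "norm (v x - \<psi> n x) \<le> (\<Sum>i\<in>UNIV. \<bar>(v x - \<psi> n x) $ i\<bar>)" by (rule norm_le_l1_cart)
    also have "\<dots> \<le> (\<Sum>i\<in>UNIV. \<bar>M i\<bar> / m n)"
    proof (rule sum_mono)
      fix i
      have "\<bar>(v x - \<psi> n x) $ i\<bar> \<le> M i / m n"
        using M[OF m(1)[of n], of i x] by (simp add: \<psi>_def abs_minus_commute)
      also have "\<dots> \<le> \<bar>M i\<bar> / m n" using m(1) by (intro divide_right_mono) (auto simp: less_imp_le)
      finally show "\<bar>(v x - \<psi> n x) $ i\<bar> \<le> \<bar>M i\<bar> / m n" .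
    qed
    finally show ?thesis by (simp add: sum_divide_distrib)
  qed
  have mlim: "(\<lambda>n. B / m n) \<longlonglongrightarrow> 0" for B
  proof -
    have "(\<lambda>n. B * inverse (real (Suc (n + n0)))) \<longlonglongrightarrow> B * 0"
      by (intro tendsto_intros LIMSEQ_ignore_initial_segment[OF LIMSEQ_inverse_real_of_nat])
    then show ?thesis by (simp add: m_def divide_inverse add.commute)
  qed
  have cv: "continuous_on UNIV v" by (rule lipschitz_on_continuous_on[OF lip])
  have c\<psi>: "continuous_on UNIV (\<psi> n)" for n
    using \<psi>d by (intro differentiable_imp_continuous_on) (simp add: differentiable_on_def)
  have ms1: "(\<lambda>x. norm (v x - \<psi> n x)) \<in> borel_measurable lebesgue" for n
    by (intro continuous_imp_measurable_lebesgue continuous_intros cv c\<psi>)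
  have bd1: "AE x in lebesgue. norm (norm (v x - \<psi> n x)) \<le> norm ((\<Sum>i\<in>UNIV. \<bar>M i\<bar>) * indicator K x)" for n
  proof (intro AE_I2)
    fix x
    show "norm (norm (v x - \<psi> n x)) \<le> norm ((\<Sum>i\<in>UNIV. \<bar>M i\<bar>) * indicator K x)"
    proof (cases "x \<in> K")
      case True
      have "(\<Sum>i\<in>UNIV. \<bar>M i\<bar>) / m n \<le> (\<Sum>i\<in>UNIV. \<bar>M i\<bar>) / 1"
        using m(2)[of n] by (intro divide_left_mono) (auto intro: sum_nonneg)
      then show ?thesis using True cl[of x n] by simp
    next
      case False
      then have "v x = 0" using CK C(3) by blast
      then show ?thesis using False out by simp
    qed
  qed
  have z1: "norm (v x - \<psi> n x) = 0" if "x \<notin> \<Omega>" for x n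
  proof -
    have "x \<notin> K" "x \<notin> C" using that K(2) C(2) by blast+
    then show ?thesis using out C(3) by simp
  qed
  have int1: "set_integrable lebesgue \<Omega> (\<lambda>x. norm (v x - \<psi> n x))" for n
    by (rule set_integrable_support[OF Bochner_Integration.integrable_bound[OF dom ms1 bd1] z1])
  have "(\<lambda>n. \<integral>x. norm (v x - \<psi> n x) \<partial>lebesgue) \<longlonglongrightarrow> (\<integral>x. 0 \<partial>(lebesgue :: (real^'n) measure))"
  proof (rule integral_dominated_convergence[OF _ ms1 integrable_norm[OF dom] _ bd1])
    show "AE x in lebesgue. (\<lambda>n. norm (v x - \<psi> n x)) \<longlonglongrightarrow> 0"
      by (intro AE_I2 tendsto_sandwich[OF _ _ tendsto_const mlim[of "\<Sum>i\<in>UNIV. \<bar>M i\<bar>"]] always_eventually allI)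
        (auto simp: cl)
  qed auto
  then have lim1: "(\<lambda>n. LINT x:\<Omega>|lebesgue. norm (v x - \<psi> n x)) \<longlonglongrightarrow> 0"
    by (simp add: set_lebesgue_integral_support[of \<Omega> "\<lambda>x. norm (v x - \<psi> n x)" for n, OF z1])

  have "\<forall>i j. \<exists>B. \<forall>x m. 0 < m \<longrightarrow> \<bar>partial_deriv j (convolve (?w i) (mollifier m)) x\<bar> \<le> B"
    using partial_mollify_bound[OF wl C(1) w0] by blast
  then obtain B where B: "\<And>i j x m. 0 < m \<Longrightarrow> \<bar>partial_deriv j (convolve (?w i) (mollifier m)) x\<bar> \<le> B i j" by metis
  define B1 where "B1 = (\<Sum>i\<in>UNIV. \<Sum>j\<in>UNIV. \<bar>B i j\<bar>)"
  have BB1: "B i j \<le> B1" for i j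
  proof -
    have "B i j \<le> \<bar>B i j\<bar>" by simp
    also have "\<dots> \<le> (\<Sum>j\<in>UNIV. \<bar>B i j\<bar>)" by (rule member_le_sum) auto
    also have "\<dots> \<le> B1" unfolding B1_def by (rule member_le_sum[of i UNIV "\<lambda>i. \<Sum>j\<in>UNIV. \<bar>B i j\<bar>"]) (auto intro: sum_nonneg)
    finally show ?thesis .
  qed
  define B2 where "B2 = (\<Sum>b\<in>(Basis :: (real^'n^'m) set). B1)"
  have jb: "norm (jacobian (\<psi> n) (at x)) \<le> B2" for n x
    unfolding B2_def by (rule norm_matrix_le) (unfold jac, rule order_trans[OF B[OF m(1)] BB1])
  obtain B3 where B3: "AE x in lebesgue. norm (jacobian v (at x)) \<le> B3"
    using lipschitz_jacobian(2)[OF lip compact_imp_bounded[OF C(1)] C(3) N] by blast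
  have j0: "jacobian v (at x) = 0" "jacobian (\<psi> n) (at x) = 0" if x: "x \<notin> K" for x n
  proof -
    have "x \<in> - K" "open (- K)" using x K(1) by (auto simp: compact_imp_closed)
    have "(v has_derivative (\<lambda>h. 0 *v h)) (at x)"
      by (rule has_derivative_transform_within_open[of "\<lambda>_. 0" _ _ _ "- K"])
        (use \<open>x \<in> - K\<close> \<open>open (- K)\<close> CK C(3) in auto)
    then show "jacobian v (at x) = 0" by (rule jacobian_eq)
    have "(\<psi> n has_derivative (\<lambda>h. 0 *v h)) (at x)"
      by (rule has_derivative_transform_within_open[of "\<lambda>_. 0" _ _ _ "- K"])
        (use \<open>x \<in> - K\<close> \<open>open (- K)\<close> out in auto)
    then show "jacobian (\<psi> n) (at x) = 0" by (rule jacobian_eq)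
  qed
  have ms2: "(\<lambda>x. norm (jacobian v (at x) - jacobian (\<psi> n) (at x))) \<in> borel_measurable lebesgue" for n
  proof -
    have "(\<lambda>x. jacobian (\<psi> n) (at x)) \<in> borel_measurable lebesgue"
      by (rule borel_measurable_matrixI)
        (simp add: jac \<psi>i[symmetric] continuous_imp_measurable_lebesgue smooth_D(3)[OF smooth_D(2)[OF sm]])
    then show ?thesis
      using lipschitz_jacobian(1)[OF lip compact_imp_bounded[OF C(1)] C(3) N] by measurable
  qed
  have bd2: "AE x in lebesgue. norm (norm (jacobian v (at x) - jacobian (\<psi> n) (at x))) \<le>
      norm ((B3 + B2) * indicator K x)" for n
    using B3
  proof eventually_elim
    case (elim x)
    show ?case
    proof (cases "x \<in> K")
      case True
      have "norm (jacobian v (at x) - jacobian (\<psi> n) (at x)) \<le> B3 + B2"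
        using norm_triangle_ineq4[of "jacobian v (at x)" "jacobian (\<psi> n) (at x)"] jb[of n x] elim by linarith
      then show ?thesis using True by simp
    qed (simp add: j0)
  qed
  have z2: "norm (jacobian v (at x) - jacobian (\<psi> n) (at x)) = 0" if "x \<notin> \<Omega>" for x n
  proof -
    have "x \<notin> K" using that K(2) by blast
    then show ?thesis by (simp add: j0)
  qed
  have int2: "set_integrable lebesgue \<Omega> (\<lambda>x. norm (jacobian v (at x) - jacobian (\<psi> n) (at x)))" for n
    by (rule set_integrable_support[OF Bochner_Integration.integrable_bound[OF dom ms2 bd2] z2])
  have "(\<lambda>n. \<integral>x. norm (jacobian v (at x) - jacobian (\<psi> n) (at x)) \<partial>lebesgue) \<longlonglongrightarrow> (\<integral>x. 0 \<partial>(lebesgue :: (real^'n) measure))"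
  proof (rule integral_dominated_convergence[OF _ ms2 integrable_norm[OF dom] _ bd2])
    show "AE x in lebesgue. (\<lambda>n. norm (jacobian v (at x) - jacobian (\<psi> n) (at x))) \<longlonglongrightarrow> 0"
      using AEN
    proof eventually_elim
      case (elim x)
      have "(\<lambda>n. jacobian (\<psi> n) (at x)) \<longlonglongrightarrow> jacobian v (at x)"
      proof (intro vec_tendstoI)
        fix i j
        have "(\<lambda>n. partial_deriv j (convolve (?w i) (mollifier (real n + 1))) x) \<longlonglongrightarrow> partial_deriv j (?w i) x"
          by (rule partial_mollify_tendsto[OF wl C(1) w0 partial_deriv_component(2)[OF N(2)[OF elim]]])
        from LIMSEQ_ignore_initial_segment[OF this, of n0]
        show "(\<lambda>n. jacobian (\<psi> n) (at x) $ i $ j) \<longlonglongrightarrow> jacobian v (at x) $ i $ j"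
          unfolding jac m_def partial_deriv_component(1)[OF N(2)[OF elim], symmetric] .
      qed
      from tendsto_norm[OF tendsto_diff[OF tendsto_const[of "jacobian v (at x)"] this]] show ?case by simp
    qed
  qed auto
  then have lim2: "(\<lambda>n. LINT x:\<Omega>|lebesgue. norm (jacobian v (at x) - jacobian (\<psi> n) (at x))) \<longlonglongrightarrow> 0"
    by (simp add: set_lebesgue_integral_support[of \<Omega> "\<lambda>x. norm (jacobian v (at x) - jacobian (\<psi> n) (at x))" for n, OF z2])
  have "\<forall>\<^sub>F n in sequentially. (LINT x:\<Omega>|lebesgue. norm (v x - \<psi> n x)) < e \<and>
      (LINT x:\<Omega>|lebesgue. norm (jacobian v (at x) - jacobian (\<psi> n) (at x))) < e"
    using order_tendstoD(2)[OF lim1 e] order_tendstoD(2)[OF lim2 e] by (rule eventually_conj)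
  then obtain n where "(LINT x:\<Omega>|lebesgue. norm (v x - \<psi> n x)) < e"
      "(LINT x:\<Omega>|lebesgue. norm (jacobian v (at x) - jacobian (\<psi> n) (at x))) < e"
    by (auto simp: eventually_sequentially)
  then show ?thesis by (rule that[OF test int1 int2])
qed

section \<open>Uniqueness of the weak gradient\<close>

text \<open>Lebesgue differentiation over shrinking cubes: almost every value of \<open>h\<close> is
  a limit of mean values, and these are 0.\<close>

lemma AE_zero_if_integral_cbox_zero:
  fixes h :: "'a::euclidean_space \<Rightarrow> real"
  assumes U: "open U"
    and int: "\<And>a b. cbox a b \<subseteq> U \<Longrightarrow> h integrable_on cbox a b"
    and zero: "\<And>a b. cbox a b \<subseteq> U \<Longrightarrow> integral (cbox a b) h = 0"
  shows "negligible {x \<in> U. h x \<noteq> 0}"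
proof -
  obtain \<D> where \<D>: "countable \<D>" "\<D> \<subseteq> Pow U" "\<And>X. X \<in> \<D> \<Longrightarrow> \<exists>a b. X = cbox a b" "\<Union>\<D> = U"
    using open_countable_Union_open_cbox[OF U] by blast
  have "negligible {x \<in> X. h x \<noteq> 0}" if "X \<in> \<D>" for X
  proof -
    obtain c d where X: "X = cbox c d" "cbox c d \<subseteq> U" using \<D> \<open>X \<in> \<D>\<close> by blast
    \<comment> \<open>The differentiation theorem asks for integrability over every box, which
      \<open>h\<close> has only inside \<open>U\<close>; so \<open>h\<close> is cut off to one box
      of a countable cover.\<close>
    define H where "H x = (if x \<in> cbox c d then h x else 0)" for x
    have HU: "H integrable_on cbox a b" for a b
    proof -
      have "h integrable_on cbox c d \<inter> cbox a b"
      proof -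
        obtain p q where pq: "cbox c d \<inter> cbox a b = cbox p q" using Int_interval by blast
        then have "cbox p q \<subseteq> U" using X(2) by blast
        then show ?thesis unfolding pq by (rule int)
      qed
      then show ?thesis
        unfolding H_def using integrable_restrict_Int[of "cbox c d" h "cbox a b"] by (simp add: Int_commute)
    qed
    obtain N where N: "negligible N"
       "\<And>x e. \<lbrakk>x \<notin> N; 0 < e\<rbrakk> \<Longrightarrow> \<exists>d>0. \<forall>t. 0 < t \<and> t < d \<longrightarrow>
           norm (integral (cbox x (x + t *\<^sub>R One)) H /\<^sub>R t ^ DIM('a) - H x) < e"
      using integrable_ccontinuous_explicit[of H] HU by blast
    have "h x = 0" if x: "x \<in> box c d" "x \<notin> N" for x
    proof (rule ccontr)
      assume "h x \<noteq> 0"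
      then have pos: "0 < norm (H x)" using x(1) box_subset_cbox by (auto simp: H_def)
      obtain \<delta> where \<delta>: "0 < \<delta>" "\<And>t. 0 < t \<Longrightarrow> t < \<delta> \<Longrightarrow>
          norm (integral (cbox x (x + t *\<^sub>R One)) H /\<^sub>R t ^ DIM('a) - H x) < norm (H x)"
        using N(2)[OF x(2) pos] by blast
      obtain r where r: "0 < r" "cball x r \<subseteq> box c d" using x(1) open_box open_contains_cball by blast
      \<comment> \<open>Below the threshold of the differentiation theorem, and so small that the
        cube with corner \<open>x\<close> stays in the ball of radius \<open>r\<close>.\<close>
      define s where "s = min (\<delta> / 2) (r / DIM('a))"
      have D: "0 < real DIM('a)" by simp
      have s: "0 < s" "s < \<delta>" "s * DIM('a) \<le> r"
      proof -
        show "0 < s" "s < \<delta>" using \<delta>(1) r(1) D by (auto simp: s_def)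
        have "s \<le> r / DIM('a)" by (simp add: s_def)
        then show "s * DIM('a) \<le> r" using D by (simp add: le_divide_eq)
      qed
      have sub: "cbox x (x + s *\<^sub>R One) \<subseteq> cball x r"
      proof
        fix y assume y: "y \<in> cbox x (x + s *\<^sub>R One)"
        have "norm (y - x) \<le> (\<Sum>b\<in>Basis. \<bar>(y - x) \<bullet> b\<bar>)" by (rule norm_le_l1)
        also have "\<dots> \<le> (\<Sum>b\<in>(Basis :: 'a set). s)"
        proof (rule sum_mono)
          fix b :: 'a assume b: "b \<in> Basis"
          then have "x \<bullet> b \<le> y \<bullet> b" "y \<bullet> b \<le> x \<bullet> b + s" using y
            by (auto simp: mem_box inner_add_left)
          then show "\<bar>(y - x) \<bullet> b\<bar> \<le> s" by (simp add: inner_diff_left)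
        qed
        also have "\<dots> \<le> r" using s(3) by (simp add: mult.commute)
        finally show "y \<in> cball x r" by (simp add: dist_norm norm_minus_commute)
      qed
      then have subX: "cbox x (x + s *\<^sub>R One) \<subseteq> cbox c d" using r(2) box_subset_cbox by blast
      then have "integral (cbox x (x + s *\<^sub>R One)) H = integral (cbox x (x + s *\<^sub>R One)) h"
        by (intro integral_cong) (auto simp: H_def)
      also have "\<dots> = 0" using subX X(2) by (intro zero) auto
      finally show False using \<delta>(2)[OF s(1,2)] by simp
    qed
    then have "{x \<in> X. h x \<noteq> 0} \<subseteq> N \<union> (cbox c d - box c d)" unfolding X(1) by blast
    then show ?thesis
      using negligible_subset[OF negligible_Un[OF N(1) negligible_frontier_interval]] by blast
  qed
  then have "negligible (\<Union>X\<in>\<D>. {x \<in> X. h x \<noteq> 0})"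
    using \<D>(1) by (intro negligible_countable_Union) auto
  moreover have "{x \<in> U. h x \<noteq> 0} = (\<Union>X\<in>\<D>. {x \<in> X. h x \<noteq> 0})" using \<D>(4) by blast
  ultimately show ?thesis by simp
qed

text \<open>The bumps on a box are test functions that tend boundedly to the indicator of its
  interior, and the boundary of a box is a null set; so \<open>h\<close> has integral 0 over every
  box in \<open>U\<close>.\<close>

lemma fundamental_lemma:
  fixes h :: "real^'n \<Rightarrow> real"
  assumes U: "open U"
    and int: "\<And>C. compact C \<Longrightarrow> C \<subseteq> U \<Longrightarrow> h absolutely_integrable_on C"
    and zero: "\<And>f. f \<in> test_functions U \<Longrightarrow> (LINT x:U|lebesgue. h x * f x) = 0"
  shows "negligible {x \<in> U. h x \<noteq> 0}"
proof (rule AE_zero_if_integral_cbox_zero[OF U])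
  fix a b assume ab: "cbox a b \<subseteq> U"
  have hi: "h absolutely_integrable_on cbox a b" by (rule int[OF compact_cbox ab])
  then show "h integrable_on cbox a b" by (rule set_lebesgue_integral_eq_integral(1))
  let ?H = "\<lambda>x. indicator (cbox a b) x *\<^sub>R h x"
  have Hi: "integrable lebesgue ?H" using hi by (simp add: set_integrable_def)
  then have Hm: "?H \<in> borel_measurable lebesgue" by blast
  have bm: "bump a b s \<in> borel_measurable lebesgue" for s
    by (rule continuous_imp_measurable_lebesgue[OF smooth_D(3)[OF smooth_bump]])
  have z: "(\<integral>x. ?H x * bump a b (real n + 1) x \<partial>lebesgue) = 0" for n
  proof -
    have pos: "0 < real n + 1" by simp
    have "(LINT x:U|lebesgue. h x * bump a b (real n + 1) x) = 0"
      by (rule zero[OF bump_test_function[OF pos ab]])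
    moreover have "(LINT x:U|lebesgue. h x * bump a b (real n + 1) x) = (\<integral>x. ?H x * bump a b (real n + 1) x \<partial>lebesgue)"
      unfolding set_lebesgue_integral_def
    proof (rule Bochner_Integration.integral_cong[OF refl])
      fix x
      have "bump a b (real n + 1) x = 0" if "x \<notin> cbox a b"
        using bump_pos_iff[OF pos, of a b x] that box_subset_cbox by blast
      then show "indicator U x *\<^sub>R (h x * bump a b (real n + 1) x) = ?H x * bump a b (real n + 1) x"
        using ab by (cases "x \<in> cbox a b") auto
    qed
    ultimately show ?thesis by simp
  qed
  have "(\<lambda>n. \<integral>x. ?H x * bump a b (real n + 1) x \<partial>lebesgue) \<longlonglongrightarrow> (\<integral>x. ?H x * indicator (box a b) x \<partial>lebesgue)"
  proof (rule integral_dominated_convergence[OF _ _ integrable_norm[OF Hi]])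
    show "(\<lambda>x. ?H x * indicator (box a b) x) \<in> borel_measurable lebesgue"
      using Hm by (intro borel_measurable_times borel_measurable_indicator) auto
    show "(\<lambda>x. ?H x * bump a b (real n + 1) x) \<in> borel_measurable lebesgue" for n
      using Hm bm by (intro borel_measurable_times)
    show "AE x in lebesgue. (\<lambda>n. ?H x * bump a b (real n + 1) x) \<longlonglongrightarrow> ?H x * indicator (box a b) x"
      by (intro AE_I2 tendsto_mult tendsto_const bump_tendsto_indicator)
    show "AE x in lebesgue. norm (?H x * bump a b (real n + 1) x) \<le> norm (?H x)" for n
    proof (intro AE_I2)
      fix x
      have "norm (?H x) * norm (bump a b (real n + 1) x) \<le> norm (?H x)"
        using bump_bounds[of a b "real n + 1" x] by (intro mult_right_le_one_le) auto
      then show "norm (?H x * bump a b (real n + 1) x) \<le> norm (?H x)" by (simp only: norm_mult)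
    qed
  qed
  then have "(\<integral>x. ?H x * indicator (box a b) x \<partial>lebesgue) = 0"
    using z LIMSEQ_unique[OF _ tendsto_const] by auto
  moreover have "(\<integral>x. ?H x * indicator (box a b) x \<partial>lebesgue) = (\<integral>x. ?H x \<partial>lebesgue)"
  proof (rule integral_cong_AE)
    show "(\<lambda>x. ?H x * indicator (box a b) x) \<in> borel_measurable lebesgue"
      using Hm by (intro borel_measurable_times borel_measurable_indicator) auto
    have "AE x in lebesgue. x \<notin> cbox a b - box a b"
      using negligible_frontier_interval[of a b] unfolding negligible_iff_null_sets by (rule AE_not_in)
    then show "AE x in lebesgue. ?H x * indicator (box a b) x = ?H x"
      by eventually_elim (auto simp: indicator_def)
  qed (rule Hm)
  moreover have "(\<integral>x. ?H x \<partial>lebesgue) = integral (cbox a b) h"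
    using set_lebesgue_integral_eq_integral(2)[OF hi] by (simp add: set_lebesgue_integral_def)
  ultimately show "integral (cbox a b) h = 0" by simp
qed

lemma test_functions_mono: "f \<in> test_functions U \<Longrightarrow> U \<subseteq> \<Omega> \<Longrightarrow> f \<in> test_functions \<Omega>"
  unfolding test_functions_def by blast

lemma set_lebesgue_integral_subset_support:
  fixes F :: "'a \<Rightarrow> real"
  assumes "U \<subseteq> \<Omega>" "\<And>x. x \<notin> U \<Longrightarrow> F x = 0"
  shows "(LINT x:\<Omega>|M. F x) = (LINT x:U|M. F x)"
  unfolding set_lebesgue_integral_def
  by (rule Bochner_Integration.integral_cong) (use assms in \<open>auto simp: indicator_def\<close>)

lemma set_integrable_mult_continuous:
  fixes h f :: "'a::euclidean_space \<Rightarrow> real"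
  assumes h: "h absolutely_integrable_on C" and C: "compact C" "C \<subseteq> \<Omega>"
    and f: "continuous_on UNIV f" "\<And>x. x \<notin> C \<Longrightarrow> f x = 0"
  shows "set_integrable lebesgue \<Omega> (\<lambda>x. h x * f x)"
proof -
  obtain B where B: "\<And>x. norm (f x) \<le> B" "0 \<le> B"
    using bounded_support_imp_bounded[OF f(1) compact_imp_bounded[OF C(1)] f(2)] by blast
  have dom: "integrable lebesgue (\<lambda>x. B * norm (indicator C x *\<^sub>R h x))"
    using h by (intro integrable_mult_right integrable_norm) (simp add: set_integrable_def)
  have eq: "indicator \<Omega> x *\<^sub>R (h x * f x) = (indicator C x *\<^sub>R h x) * f x" for x
    using C(2) f(2)[of x] by (cases "x \<in> C") auto
  have meas: "(\<lambda>x. (indicator C x *\<^sub>R h x) * f x) \<in> borel_measurable lebesgue"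
    by (rule borel_measurable_times[OF borel_measurable_integrable[OF h[unfolded set_integrable_def]]
          continuous_imp_measurable_lebesgue[OF f(1)]])
  show ?thesis
    unfolding set_integrable_def eq
  proof (rule Bochner_Integration.integrable_bound[OF dom meas], intro AE_I2)
    fix x
    have "norm ((indicator C x *\<^sub>R h x) * f x) \<le> norm (indicator C x *\<^sub>R h x) * B"
      unfolding norm_mult by (intro mult_left_mono B(1)) auto
    then show "norm ((indicator C x *\<^sub>R h x) * f x) \<le> norm (B * norm (indicator C x *\<^sub>R h x))"
      using B(2) by (simp only: mult.commute[of B] real_norm_def abs_mult abs_abs abs_of_nonneg)
  qed
qed

text \<open>Tested with functions supported in \<open>U\<close>, the weak and the classical gradient
  satisfy the same integration by parts, so the fundamental lemma applies entrywise to their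
  difference. This transfers the pointwise hypothesis on a given weak gradient to the classical
  one.\<close>

lemma weak_gradient_eq_jacobian:
  fixes \<phi> :: "real^'n \<Rightarrow> real^'m"
  assumes G: "has_weak_gradient \<Omega> \<phi> G" and U: "open U" "U \<subseteq> \<Omega>"
    and d: "\<And>x. x \<in> U \<Longrightarrow> \<phi> differentiable (at x)" and c: "continuous_on U (\<lambda>x. jacobian \<phi> (at x))"
  shows "negligible {x \<in> U. G x \<noteq> jacobian \<phi> (at x)}"
proof -
  have "negligible {x \<in> U. G x $ i $ j - jacobian \<phi> (at x) $ i $ j \<noteq> 0}" for i j
  proof (rule fundamental_lemma[OF U(1)])
    have cj: "continuous_on U (\<lambda>x. jacobian \<phi> (at x) $ i $ j)" for j
      by (intro continuous_intros c)
    have Gi: "(\<lambda>x. G x $ i $ j) absolutely_integrable_on C"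
      and ji: "(\<lambda>x. jacobian \<phi> (at x) $ i $ j) absolutely_integrable_on C" if C: "compact C" "C \<subseteq> U" for C
    proof -
      have "G absolutely_integrable_on C"
        using G C U(2) by (auto simp: has_weak_gradient_def locally_integrable_on_def)
      from absolutely_integrable_component[OF this, of "axis i (axis j 1)"]
      show "(\<lambda>x. G x $ i $ j) absolutely_integrable_on C" by (simp add: inner_axis)
      have "integrable lborel (\<lambda>x. indicator C x *\<^sub>R (jacobian \<phi> (at x) $ i $ j))"
        by (rule borel_integrable_compact[OF C(1) continuous_on_subset[OF cj C(2)]])
      then show "(\<lambda>x. jacobian \<phi> (at x) $ i $ j) absolutely_integrable_on C"
        unfolding set_integrable_def by (subst integrable_completion) (auto dest: borel_measurable_integrable)
    qed
    show "(\<lambda>x. G x $ i $ j - jacobian \<phi> (at x) $ i $ j) absolutely_integrable_on C"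
      if "compact C" "C \<subseteq> U" for C
      by (rule set_integral_diff(1)[OF Gi[OF that] ji[OF that]])
    fix f assume f: "f \<in> test_functions U"
    note tf = test_function_D[OF f]
    let ?C = "closure {x. f x \<noteq> 0}"
    have fU: "f x = 0" "partial_deriv j f x = 0" if "x \<notin> U" for x
    proof -
      have "x \<notin> ?C" using that tf(3) by blast
      then show "f x = 0" "partial_deriv j f x = 0" using tf(4,5) by blast+
    qed
    note int = set_integrable_mult_continuous[OF _ tf(2,3) smooth_D(3)[OF tf(1)] tf(4)]
    have "(LINT x:\<Omega>|lebesgue. \<phi> x $ i * partial_deriv j f x) = - (LINT x:\<Omega>|lebesgue. G x $ i $ j * f x)"
      using G test_functions_mono[OF f U(2)] unfolding has_weak_gradient_def by blast
    moreover have "(LINT x:\<Omega>|lebesgue. \<phi> x $ i * partial_deriv j f x) = (LINT x:U|lebesgue. \<phi> x $ i * partial_deriv j f x)"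
      by (rule set_lebesgue_integral_subset_support[OF U(2)]) (simp add: fU)
    moreover have "(LINT x:\<Omega>|lebesgue. G x $ i $ j * f x) = (LINT x:U|lebesgue. G x $ i $ j * f x)"
      by (rule set_lebesgue_integral_subset_support[OF U(2)]) (simp add: fU)
    moreover have "(LINT x:U|lebesgue. \<phi> x $ i * partial_deriv j f x) =
        - (LINT x:U|lebesgue. partial_deriv j (\<lambda>x. \<phi> x $ i) x * f x)"
    proof (rule classical_integral_by_parts[OF U(1) partial_deriv_component(2)[OF d] _ f])
      show "continuous_on U (partial_deriv j (\<lambda>x. \<phi> x $ i))" for j
        by (rule continuous_on_eq[OF cj]) (simp add: partial_deriv_component(1)[OF d])
    qed
    moreover have "(LINT x:U|lebesgue. partial_deriv j (\<lambda>x. \<phi> x $ i) x * f x) =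
        (LINT x:U|lebesgue. jacobian \<phi> (at x) $ i $ j * f x)"
      unfolding set_lebesgue_integral_def
      by (rule Bochner_Integration.integral_cong) (auto simp: indicator_def partial_deriv_component(1)[OF d])
    ultimately have "(LINT x:U|lebesgue. G x $ i $ j * f x) = (LINT x:U|lebesgue. jacobian \<phi> (at x) $ i $ j * f x)"
      by simp
    moreover have "(LINT x:U|lebesgue. G x $ i $ j * f x - jacobian \<phi> (at x) $ i $ j * f x) =
        (LINT x:U|lebesgue. G x $ i $ j * f x) - (LINT x:U|lebesgue. jacobian \<phi> (at x) $ i $ j * f x)"
      by (rule set_integral_diff(2)[OF int[OF Gi[OF tf(2,3)]] int[OF ji[OF tf(2,3)]]])
    ultimately show "(LINT x:U|lebesgue. (G x $ i $ j - jacobian \<phi> (at x) $ i $ j) * f x) = 0"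
      by (simp add: left_diff_distrib)
  qed
  then have "negligible (\<Union>i. \<Union>j. {x \<in> U. G x $ i $ j - jacobian \<phi> (at x) $ i $ j \<noteq> 0})"
    by (intro negligible_countable_Union) auto
  moreover have "{x \<in> U. G x \<noteq> jacobian \<phi> (at x)} \<subseteq>
      (\<Union>i. \<Union>j. {x \<in> U. G x $ i $ j - jacobian \<phi> (at x) $ i $ j \<noteq> 0})"
    by (auto simp: vec_eq_iff)
  ultimately show ?thesis by (rule negligible_subset)
qed

section \<open>Passage to the limit\<close>

text \<open>Multiplied by a continuous function with compact support, bounded sequences that
  converge almost everywhere have convergent integrals; this applies to both sides of the defining
  identity.\<close>

lemma weak_gradient_limit:
  fixes v :: "nat \<Rightarrow> real^'n \<Rightarrow> real^'m"
  assumes wg: "\<And>n. has_weak_gradient \<Omega> (v n) (G n)"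
    and meas: "\<And>n. v n \<in> borel_measurable lebesgue" "\<And>n. G n \<in> borel_measurable lebesgue"
      "w \<in> borel_measurable lebesgue" "H \<in> borel_measurable lebesgue"
    and lim: "AE x in lebesgue. (\<lambda>n. v n x) \<longlonglongrightarrow> w x" "AE x in lebesgue. (\<lambda>n. G n x) \<longlonglongrightarrow> H x"
    and bd: "\<And>n. AE x in lebesgue. norm (v n x) \<le> B" "\<And>n. AE x in lebesgue. norm (G n x) \<le> B"
      "AE x in lebesgue. norm (w x) \<le> B" "AE x in lebesgue. norm (H x) \<le> B"
  shows "has_weak_gradient \<Omega> w H"
  unfolding has_weak_gradient_def locally_integrable_on_def
proof (intro conjI allI impI ballI)
  show "w absolutely_integrable_on C" if "compact C \<and> C \<subseteq> \<Omega>" for C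
    using that by (intro bounded_absolutely_integrable_on[OF meas(3) bd(3)]) (auto intro: lmeasurable_compact)
  show "H absolutely_integrable_on C" if "compact C \<and> C \<subseteq> \<Omega>" for C
    using that by (intro bounded_absolutely_integrable_on[OF meas(4) bd(4)]) (auto intro: lmeasurable_compact)
next
  fix f i j assume f: "f \<in> test_functions \<Omega>"
  note tf = test_function_D[OF f]
  have out: "x \<notin> closure {x. f x \<noteq> 0}" if "x \<notin> \<Omega>" for x using that tf(3) by blast
  have cf: "continuous_on UNIV f" "continuous_on UNIV (partial_deriv j f)"
    by (rule smooth_D(3)[OF tf(1)], rule smooth_D(3)[OF smooth_D(2)[OF tf(1)]])
  have conv: "(\<lambda>n. LINT x:\<Omega>|lebesgue. a n x * g x) \<longlonglongrightarrow> (LINT x:\<Omega>|lebesgue. b x * g x)"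
    if ab: "\<And>n. a n \<in> borel_measurable lebesgue" "b \<in> borel_measurable lebesgue"
      "AE x in lebesgue. (\<lambda>n. a n x) \<longlonglongrightarrow> b x" "\<And>n. AE x in lebesgue. \<bar>a n x\<bar> \<le> B"
      and g: "continuous_on UNIV g" "\<And>x. x \<notin> closure {x. f x \<noteq> 0} \<Longrightarrow> g x = 0"
    for a b and g :: "real^'n \<Rightarrow> real"
  proof -
    have z: "a n x * g x = 0" "b x * g x = 0" if "x \<notin> \<Omega>" for n x using g(2)[OF out[OF that]] by simp_all
    have gm: "g \<in> borel_measurable lebesgue" by (rule continuous_imp_measurable_lebesgue[OF g(1)])
    have gi: "integrable lebesgue g"
      by (rule integrable_continuous_bounded_support[OF g(1) compact_imp_bounded[OF tf(2)] g(2)])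
    have "(\<lambda>n. \<integral>x. a n x * g x \<partial>lebesgue) \<longlonglongrightarrow> (\<integral>x. b x * g x \<partial>lebesgue)"
    proof (rule integral_dominated_convergence)
      show "(\<lambda>x. b x * g x) \<in> borel_measurable lebesgue" "(\<lambda>x. a n x * g x) \<in> borel_measurable lebesgue" for n
        using ab(1,2) gm by (auto intro: borel_measurable_times)
      show "integrable lebesgue (\<lambda>x. B * norm (g x))" using gi by (intro integrable_mult_right integrable_norm)
      show "AE x in lebesgue. (\<lambda>n. a n x * g x) \<longlonglongrightarrow> b x * g x"
        using ab(3) by eventually_elim (intro tendsto_intros)
      show "AE x in lebesgue. norm (a n x * g x) \<le> B * norm (g x)" for n
        using ab(4)[of n] by eventually_elim (auto simp: abs_mult intro: mult_right_mono)
    qed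
    moreover have "(LINT x:\<Omega>|lebesgue. a n x * g x) = (\<integral>x. a n x * g x \<partial>lebesgue)" for n
      by (rule set_lebesgue_integral_support) (rule z)
    moreover have "(LINT x:\<Omega>|lebesgue. b x * g x) = (\<integral>x. b x * g x \<partial>lebesgue)"
      by (rule set_lebesgue_integral_support) (rule z)
    ultimately show ?thesis by simp
  qed
  have cw: "(\<lambda>x. z x $ i) \<in> borel_measurable lebesgue" if "z \<in> borel_measurable lebesgue"
    for z :: "real^'n \<Rightarrow> 'a::euclidean_space ^'m" and i
    by (rule borel_measurable_continuous_on[OF _ that, of "\<lambda>y. y $ i"]) (intro continuous_intros)
  have l1: "(\<lambda>n. LINT x:\<Omega>|lebesgue. v n x $ i * partial_deriv j f x) \<longlonglongrightarrow>
      (LINT x:\<Omega>|lebesgue. w x $ i * partial_deriv j f x)"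
  proof (rule conv[OF cw[OF meas(1)] cw[OF meas(3)] _ _ cf(2) tf(5)])
    show "AE x in lebesgue. (\<lambda>n. v n x $ i) \<longlonglongrightarrow> w x $ i"
      using lim(1) by eventually_elim (rule tendsto_vec_nth)
    show "AE x in lebesgue. \<bar>v n x $ i\<bar> \<le> B" for n
      using bd(1)[of n] by eventually_elim (rule order_trans[OF component_le_norm_cart])
  qed
  have l2: "(\<lambda>n. LINT x:\<Omega>|lebesgue. G n x $ i $ j * f x) \<longlonglongrightarrow> (LINT x:\<Omega>|lebesgue. H x $ i $ j * f x)"
  proof (rule conv[OF _ _ _ _ cf(1) tf(4)])
    show "(\<lambda>x. G n x $ i $ j) \<in> borel_measurable lebesgue" for n
      by (rule borel_measurable_continuous_on[OF _ meas(2), of "\<lambda>y. y $ i $ j"]) (intro continuous_intros)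
    show "(\<lambda>x. H x $ i $ j) \<in> borel_measurable lebesgue"
      by (rule borel_measurable_continuous_on[OF _ meas(4), of "\<lambda>y. y $ i $ j"]) (intro continuous_intros)
    show "AE x in lebesgue. (\<lambda>n. G n x $ i $ j) \<longlonglongrightarrow> H x $ i $ j"
      using lim(2) by eventually_elim (intro tendsto_vec_nth)
    show "AE x in lebesgue. \<bar>G n x $ i $ j\<bar> \<le> B" for n
      using bd(2)[of n]
    proof eventually_elim
      case (elim x)
      have "\<bar>G n x $ i $ j\<bar> \<le> norm (G n x $ i)" by (rule component_le_norm_cart)
      also have "\<dots> \<le> norm (G n x)" by (rule Finite_Cartesian_Product.norm_nth_le)
      finally show ?case using elim by simp
    qed
  qed
  have "(LINT x:\<Omega>|lebesgue. v n x $ i * partial_deriv j f x) = - (LINT x:\<Omega>|lebesgue. G n x $ i $ j * f x)" for n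
    using wg[of n] f unfolding has_weak_gradient_def by blast
  then have "(\<lambda>n. LINT x:\<Omega>|lebesgue. v n x $ i * partial_deriv j f x) \<longlonglongrightarrow> - (LINT x:\<Omega>|lebesgue. H x $ i $ j * f x)"
    using tendsto_minus[OF l2] by simp
  then show "(LINT x:\<Omega>|lebesgue. w x $ i * partial_deriv j f x) = - (LINT x:\<Omega>|lebesgue. H x $ i $ j * f x)"
    by (rule LIMSEQ_unique[OF l1])
qed

text \<open>The integrals may be split because the support of a test function is compact and all
  four maps are integrable on it.\<close>

lemma has_weak_gradient_add:
  fixes u v :: "real^'n \<Rightarrow> real^'m"
  assumes u: "has_weak_gradient \<Omega> u G" and v: "has_weak_gradient \<Omega> v H"
  shows "has_weak_gradient \<Omega> (\<lambda>x. u x + v x) (\<lambda>x. G x + H x)"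
  unfolding has_weak_gradient_def
proof (intro conjI ballI allI)
  show "locally_integrable_on (\<lambda>x. u x + v x) \<Omega>" "locally_integrable_on (\<lambda>x. G x + H x) \<Omega>"
    using u v unfolding has_weak_gradient_def locally_integrable_on_def by (auto intro: set_integral_add)
  fix f i j assume f: "f \<in> test_functions \<Omega>"
  note tf = test_function_D[OF f]
  let ?C = "closure {x. f x \<noteq> 0}"
  have ac: "u absolutely_integrable_on ?C" "v absolutely_integrable_on ?C"
    "G absolutely_integrable_on ?C" "H absolutely_integrable_on ?C"
    using u v tf(2,3) unfolding has_weak_gradient_def locally_integrable_on_def by auto
  have c1: "(\<lambda>x. z x $ i) absolutely_integrable_on ?C" if "z absolutely_integrable_on ?C" for z :: "real^'n \<Rightarrow> real^'m"
    using absolutely_integrable_component[OF that, of "axis i 1"] by (simp add: inner_axis)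
  have c2: "(\<lambda>x. z x $ i $ j) absolutely_integrable_on ?C" if "z absolutely_integrable_on ?C" for z :: "real^'n \<Rightarrow> real^'n^'m"
    using absolutely_integrable_component[OF that, of "axis i (axis j 1)"] by (simp add: inner_axis)
  note i1 = set_integrable_mult_continuous[OF c1 tf(2,3) smooth_D(3)[OF smooth_D(2)[OF tf(1)]] tf(5)]
  note i2 = set_integrable_mult_continuous[OF c2 tf(2,3) smooth_D(3)[OF tf(1)] tf(4)]
  have "(LINT x:\<Omega>|lebesgue. (u x + v x) $ i * partial_deriv j f x) =
      (LINT x:\<Omega>|lebesgue. u x $ i * partial_deriv j f x) + (LINT x:\<Omega>|lebesgue. v x $ i * partial_deriv j f x)"
    using set_integral_add(2)[OF i1[OF ac(1)] i1[OF ac(2)]] by (simp add: distrib_right)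
  also have "\<dots> = - (LINT x:\<Omega>|lebesgue. G x $ i $ j * f x) + - (LINT x:\<Omega>|lebesgue. H x $ i $ j * f x)"
    using u v f unfolding has_weak_gradient_def by simp
  also have "\<dots> = - (LINT x:\<Omega>|lebesgue. (G x + H x) $ i $ j * f x)"
    using set_integral_add(2)[OF i2[OF ac(3)] i2[OF ac(4)]] by (simp add: distrib_right)
  finally show "(LINT x:\<Omega>|lebesgue. (u x + v x) $ i * partial_deriv j f x) =
      - (LINT x:\<Omega>|lebesgue. (G x + H x) $ i $ j * f x)" .
qed

lemma bounded_convergence_L1:
  fixes f :: "nat \<Rightarrow> 'a::euclidean_space \<Rightarrow> 'b::euclidean_space"
  assumes meas: "\<And>n. f n \<in> borel_measurable lebesgue" "g \<in> borel_measurable lebesgue"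
    and lim: "AE x in lebesgue. (\<lambda>n. f n x) \<longlonglongrightarrow> g x"
    and bd: "\<And>n. AE x in lebesgue. norm (f n x) \<le> B" "AE x in lebesgue. norm (g x) \<le> B"
    and \<Omega>: "\<Omega> \<in> lmeasurable"
  shows "(\<lambda>n. LINT x:\<Omega>|lebesgue. norm (g x - f n x)) \<longlonglongrightarrow> 0"
    "set_integrable lebesgue \<Omega> (\<lambda>x. norm (g x - f n x))"
proof -
  have dom: "integrable lebesgue (\<lambda>x. 2 * B * indicator \<Omega> x :: real)"
    using \<Omega> by (intro integrable_mult_right integrable_real_indicator) (auto simp: fmeasurable_def)
  have ms: "(\<lambda>x. indicator \<Omega> x *\<^sub>R norm (g x - f n x)) \<in> borel_measurable lebesgue" for n
    using meas \<Omega> by (intro borel_measurable_scaleR borel_measurable_indicator borel_measurable_norm borel_measurable_diff)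
      (auto simp: fmeasurableD)
  have bb: "AE x in lebesgue. norm (indicator \<Omega> x *\<^sub>R norm (g x - f n x)) \<le> 2 * B * indicator \<Omega> x" for n
    using bd(1)[of n] bd(2)
  proof eventually_elim
    case (elim x)
    then have "norm (g x - f n x) \<le> 2 * B" using norm_triangle_ineq4[of "g x" "f n x"] by linarith
    then show ?case by (auto simp: indicator_def)
  qed
  show "set_integrable lebesgue \<Omega> (\<lambda>x. norm (g x - f n x))"
    unfolding set_integrable_def
    by (rule Bochner_Integration.integrable_bound[OF dom ms]) (use bb[of n] in \<open>eventually_elim, auto\<close>)
  have "(\<lambda>n. \<integral>x. indicator \<Omega> x *\<^sub>R norm (g x - f n x) \<partial>lebesgue) \<longlonglongrightarrow> (\<integral>x. 0 \<partial>(lebesgue :: 'a measure))"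
  proof (rule integral_dominated_convergence[OF _ ms dom _ bb])
    show "AE x in lebesgue. (\<lambda>n. indicator \<Omega> x *\<^sub>R norm (g x - f n x)) \<longlonglongrightarrow> 0"
      using lim
    proof eventually_elim
      case (elim x)
      have "(\<lambda>n. indicator \<Omega> x *\<^sub>R norm (g x - f n x)) \<longlonglongrightarrow> indicator \<Omega> x *\<^sub>R norm (g x - g x)"
        by (intro tendsto_intros elim)
      then show ?case by simp
    qed
  qed auto
  then show "(\<lambda>n. LINT x:\<Omega>|lebesgue. norm (g x - f n x)) \<longlonglongrightarrow> 0"
    by (simp add: set_lebesgue_integral_def)
qed

lemma set_integral_norm_triangle:
  fixes f g h :: "'a \<Rightarrow> 'b::real_normed_vector"
  assumes "set_integrable M \<Omega> (\<lambda>x. norm (f x - g x))" "set_integrable M \<Omega> (\<lambda>x. norm (g x - h x))"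
  shows "(LINT x:\<Omega>|M. norm (f x - h x)) \<le> (LINT x:\<Omega>|M. norm (f x - g x)) + (LINT x:\<Omega>|M. norm (g x - h x))"
proof -
  have "(LINT x:\<Omega>|M. norm (f x - h x)) \<le> (LINT x:\<Omega>|M. norm (f x - g x) + norm (g x - h x))"
    unfolding set_lebesgue_integral_def
  proof (rule integral_mono')
    show "integrable M (\<lambda>x. indicator \<Omega> x *\<^sub>R (norm (f x - g x) + norm (g x - h x)))"
      using set_integral_add(1)[OF assms] by (simp add: set_integrable_def)
    show "indicator \<Omega> x *\<^sub>R norm (f x - h x) \<le> indicator \<Omega> x *\<^sub>R (norm (f x - g x) + norm (g x - h x))" for x
      using norm_triangle_ineq[of "f x - g x" "g x - h x"] by (auto simp: indicator_def)
  qed (auto simp: indicator_def)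
  then show ?thesis using set_integral_add(2)[OF assms] by simp
qed


lemma L1_approximation:
  fixes f h :: "nat \<Rightarrow> 'a \<Rightarrow> 'b::real_normed_vector"
  assumes fg: "\<And>n. set_integrable M \<Omega> (\<lambda>x. norm (g x - f n x))" "(\<lambda>n. LINT x:\<Omega>|M. norm (g x - f n x)) \<longlonglongrightarrow> 0"
    and fh: "\<And>n. set_integrable M \<Omega> (\<lambda>x. norm (f n x - h n x))"
      "\<And>n. (LINT x:\<Omega>|M. norm (f n x - h n x)) < inverse (real (Suc n))"
  shows "(\<lambda>n. LINT x:\<Omega>|M. norm (g x - h n x)) \<longlonglongrightarrow> 0"
proof (rule tendsto_sandwich[OF _ _ tendsto_const])
  show "\<forall>\<^sub>F n in sequentially. 0 \<le> (LINT x:\<Omega>|M. norm (g x - h n x))"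
    unfolding set_lebesgue_integral_def
    by (intro always_eventually allI Bochner_Integration.integral_nonneg) (auto simp: indicator_def)
  show "\<forall>\<^sub>F n in sequentially. (LINT x:\<Omega>|M. norm (g x - h n x)) \<le>
      (LINT x:\<Omega>|M. norm (g x - f n x)) + inverse (real (Suc n))"
  proof (intro always_eventually allI)
    show "(LINT x:\<Omega>|M. norm (g x - h n x)) \<le> (LINT x:\<Omega>|M. norm (g x - f n x)) + inverse (real (Suc n))" for n
      using set_integral_norm_triangle[OF fg(1)[of n] fh(1)[of n]] fh(2)[of n] by linarith
  qed
  show "(\<lambda>n. (LINT x:\<Omega>|M. norm (g x - f n x)) + inverse (real (Suc n))) \<longlonglongrightarrow> 0"
    using tendsto_add[OF fg(2) LIMSEQ_inverse_real_of_nat] by simp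
qed

lemma jacobian_diff:
  fixes u \<phi> :: "real^'n \<Rightarrow> real^'m"
  assumes "(u has_derivative (\<lambda>h. A *v h)) (at x)" "(\<phi> has_derivative (\<lambda>h. B *v h)) (at x)"
  shows "((\<lambda>x. u x - \<phi> x) has_derivative (\<lambda>h. (A - B) *v h)) (at x)"
  using has_derivative_diff[OF assms] by (simp add: matrix_vector_mult_diff_rdistrib)

text \<open>Both maps have the same derivatives at \<open>x\<close>, so the choice operator behind
  \<open>jacobian\<close> picks the same one; this also covers points without a derivative.\<close>

lemma jacobian_transform:
  fixes u w :: "real^'n \<Rightarrow> real^'m"
  assumes "open S" "x \<in> S" "\<And>y. y \<in> S \<Longrightarrow> u y = w y"
  shows "jacobian u (at x) = jacobian w (at x)"
proof -
  have "(u has_derivative f') (at x) \<longleftrightarrow> (w has_derivative f') (at x)" for f'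
    using has_derivative_transform_within_open[OF _ assms(1,2), of u f' UNIV w]
      has_derivative_transform_within_open[OF _ assms(1,2), of w f' UNIV u] assms(3) by auto
  then show ?thesis by (simp add: jacobian_def frechet_derivative_def)
qed

text \<open>Bounded convergence on a set of finite measure makes values and gradients converge in
  the mean. Each \<open>v n\<close> is replaced by test functions within
  \<open>inverse (real (Suc n))\<close>, and this diagonal sequence proves membership in
  \<open>W11_0\<close>.\<close>

lemma W1_inf_0I:
  fixes w :: "real^'n \<Rightarrow> real^'m"
  assumes \<Omega>: "open \<Omega>" "\<Omega> \<in> lmeasurable"
    and v: "\<And>n. \<exists>L. L-lipschitz_on UNIV (v n)" "\<And>n. \<exists>C. compact C \<and> C \<subseteq> \<Omega> \<and> (\<forall>x. x \<notin> C \<longrightarrow> v n x = 0)"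
      "\<And>n. \<exists>N. negligible N \<and> (\<forall>x. x \<notin> N \<longrightarrow> v n differentiable (at x))"
    and lim: "\<And>x. (\<lambda>n. v n x) \<longlonglongrightarrow> w x" "AE x in lebesgue. (\<lambda>n. jacobian (v n) (at x)) \<longlonglongrightarrow> H x"
    and H: "H \<in> borel_measurable lebesgue"
    and bd: "\<And>n x. norm (v n x) \<le> B" "\<And>n. AE x in lebesgue. norm (jacobian (v n) (at x)) \<le> B"
  shows "w \<in> W1_inf_0 \<Omega>" "has_weak_gradient \<Omega> w H"
proof -
  let ?J = "\<lambda>n x. jacobian (v n) (at x)"
  obtain C where C: "\<And>n. compact (C n)" "\<And>n. C n \<subseteq> \<Omega>" "\<And>n x. x \<notin> C n \<Longrightarrow> v n x = 0"
    using v(2) by metis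
  obtain N where N: "\<And>n. negligible (N n)" "\<And>n x. x \<notin> N n \<Longrightarrow> v n differentiable (at x)"
    using v(3) by metis
  obtain L where L: "\<And>n. (L n)-lipschitz_on UNIV (v n)" using v(1) by metis
  have vm: "v n \<in> borel_measurable lebesgue" for n
    by (rule continuous_imp_measurable_lebesgue[OF lipschitz_on_continuous_on[OF L]])
  have Jm: "?J n \<in> borel_measurable lebesgue" for n
    by (rule lipschitz_jacobian(1)[OF L compact_imp_bounded[OF C(1)] C(3) N])
  have wm: "w \<in> borel_measurable lebesgue"
    by (rule borel_measurable_LIMSEQ_metric[OF vm lim(1)])
  have wb: "norm (w x) \<le> B" for x
    by (rule LIMSEQ_le_const2[OF tendsto_norm[OF lim(1)]]) (use bd(1) in auto)
  have "AE x in lebesgue. \<forall>n. norm (?J n x) \<le> B" using bd(2) by (simp add: AE_all_countable)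
  then have Hb: "AE x in lebesgue. norm (H x) \<le> B"
    using lim(2)
  proof eventually_elim
    case (elim x)
    show ?case by (rule LIMSEQ_le_const2[OF tendsto_norm[OF elim(2)]]) (use elim(1) in auto)
  qed
  have wg: "has_weak_gradient \<Omega> (v n) (?J n)" for n
    by (rule lipschitz_has_weak_gradient[OF L compact_imp_bounded[OF C(1)] C(3) N])
  show wgw: "has_weak_gradient \<Omega> w H"
    by (rule weak_gradient_limit[OF wg vm Jm wm H AE_I2[OF lim(1)] lim(2) AE_I2[OF bd(1)] bd(2) AE_I2[OF wb] Hb])
  have ess: "ess_bounded_on g \<Omega>"
    if "g \<in> borel_measurable lebesgue" "AE x in lebesgue. norm (g x) \<le> B" for g :: "real^'n \<Rightarrow> 'c::euclidean_space"
    unfolding ess_bounded_on_def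
  proof (intro conjI exI)
    show "g \<in> borel_measurable (lebesgue_on \<Omega>)" using that(1) by (rule measurable_restrict_space1)
    have "AE x in lebesgue. x \<in> \<Omega> \<longrightarrow> norm (g x) \<le> B" using that(2) by eventually_elim simp
    then show "AE x in lebesgue_on \<Omega>. norm (g x) \<le> B"
      using \<Omega> by (subst AE_restrict_space_iff) (auto simp: fmeasurableD)
  qed
  have "w \<in> W1_inf \<Omega>"
    unfolding W1_inf_def using ess[OF wm AE_I2[OF wb]] ess[OF H Hb] wgw by blast
  moreover have "w \<in> W11_0 \<Omega>"
  proof -
    define Q where "Q n \<psi> \<longleftrightarrow> (\<forall>i. (\<lambda>x. \<psi> x $ i) \<in> test_functions \<Omega>) \<and>
      set_integrable lebesgue \<Omega> (\<lambda>x. norm (v n x - \<psi> x)) \<and>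
      set_integrable lebesgue \<Omega> (\<lambda>x. norm (?J n x - jacobian \<psi> (at x))) \<and>
      (LINT x:\<Omega>|lebesgue. norm (v n x - \<psi> x)) < inverse (real (Suc n)) \<and>
      (LINT x:\<Omega>|lebesgue. norm (?J n x - jacobian \<psi> (at x))) < inverse (real (Suc n))"
      for n and \<psi> :: "real^'n \<Rightarrow> real^'m"
    have "\<exists>\<psi>. Q n \<psi>" for n
    proof -
      have "0 < inverse (real (Suc n))" by simp
      from test_function_approximation[OF L C(1,2,3) \<Omega>(1) N this, of n] show ?thesis
        unfolding Q_def by blast
    qed
    then obtain \<psi> where "\<And>n. Q n (\<psi> n)" by metis
    then have \<psi>: "\<And>n i. (\<lambda>x. \<psi> n x $ i) \<in> test_functions \<Omega>"
      "\<And>n. set_integrable lebesgue \<Omega> (\<lambda>x. norm (v n x - \<psi> n x))"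
      "\<And>n. set_integrable lebesgue \<Omega> (\<lambda>x. norm (?J n x - jacobian (\<psi> n) (at x)))"
      "\<And>n. (LINT x:\<Omega>|lebesgue. norm (v n x - \<psi> n x)) < inverse (real (Suc n))"
      "\<And>n. (LINT x:\<Omega>|lebesgue. norm (?J n x - jacobian (\<psi> n) (at x))) < inverse (real (Suc n))"
      unfolding Q_def by simp_all
    note c1 = bounded_convergence_L1[OF vm wm AE_I2[OF lim(1)] AE_I2[OF bd(1)] AE_I2[OF wb] \<Omega>(2)]
    note c2 = bounded_convergence_L1[OF Jm H lim(2) bd(2) Hb \<Omega>(2)]
    have "(\<lambda>n. LINT x:\<Omega>|lebesgue. norm (w x - \<psi> n x)) \<longlonglongrightarrow> 0"
      by (rule L1_approximation[OF c1(2,1) \<psi>(2,4)])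
    moreover have "(\<lambda>n. LINT x:\<Omega>|lebesgue. norm (H x - jacobian (\<psi> n) (at x))) \<longlonglongrightarrow> 0"
      by (rule L1_approximation[OF c2(2,1) \<psi>(3,5)])
    moreover have "w absolutely_integrable_on \<Omega>" "H absolutely_integrable_on \<Omega>"
      using bounded_absolutely_integrable_on[OF wm AE_I2[OF wb] \<Omega>(2)]
        bounded_absolutely_integrable_on[OF H Hb \<Omega>(2)] by auto
    ultimately show ?thesis
      unfolding W11_0_def mem_Collect_eq using wgw \<psi>(1)
      by (intro conjI exI[of _ H] exI[of _ \<psi>]) auto
  qed
  ultimately show "w \<in> W1_inf_0 \<Omega>" by (simp add: W1_inf_0_def)
qed

text \<open>The conclusion speaks of the correction \<open>w\<close> and its gradient
  \<open>H\<close> instead of the solution, because \<phi> is controlled only on \<open>U\<close>,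
  whereas the correction is controlled on the whole space.\<close>

lemma convex_integration:
  fixes E K :: "(real^2^2) set" and \<phi> :: "real^2 \<Rightarrow> real^2"
  assumes K: "open K"
    and lam: "\<And>\<xi>. \<xi> \<in> K \<Longrightarrow> \<exists>a. \<xi> + outer a (axis 1 1) \<in> E \<and> \<xi> - outer ((1/2) *\<^sub>R a) (axis 1 1) \<in> K"
    and bdd: "\<And>\<xi>. \<xi> \<in> K \<union> E \<Longrightarrow> norm \<xi> \<le> R" "0 \<le> R"
    and \<Omega>: "open \<Omega>" "bounded \<Omega>" and U: "open U" "U \<subseteq> \<Omega>" and \<phi>: "C1_in U \<phi> K"
  obtains w H where "w \<in> W1_inf_0 \<Omega>" "has_weak_gradient \<Omega> w H"
    "\<And>x. x \<notin> U \<Longrightarrow> H x = 0" "negligible {x \<in> U. H x + jacobian \<phi> (at x) \<notin> E}"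
proof -
  have Ub: "bounded U" using \<Omega>(2) U(2) by (rule bounded_subset)
  obtain u V S where st: "\<And>n. stage E K \<phi> U (u n) (V n) (S n)" and neg: "negligible (U - (\<Union>n. S n))"
    and step: "\<And>n x. norm (u (Suc n) x - u n x) \<le> (1/2) ^ n"
    and const: "\<And>n m x. n \<le> m \<Longrightarrow> x \<in> S n \<Longrightarrow> u m x = u n x"
    using stage_sequence[OF K lam U(1) Ub \<phi>] by blast
  have S: "open (S n)" "S n \<subseteq> U" "V n \<subseteq> U" and NV: "negligible (U - (V n \<union> S n))"
    and SE: "\<And>x. x \<in> S n \<Longrightarrow> \<exists>M\<in>E. (u n has_derivative (\<lambda>h. M *v h)) (at x)"
    and VK: "C1_in (V n) (u n) K" for n
    using st[of n] by (auto simp: stage_def)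
  define v where "v n x = u n x - \<phi> x" for n x
  let ?J = "\<lambda>n x. jacobian (v n) (at x)"
  have lip: "\<exists>L. L-lipschitz_on UNIV (v n)" for n
    using st[of n] unfolding stage_def v_def[abs_def] by blast
  have "\<exists>C. compact C \<and> C \<subseteq> U \<and> (\<forall>x. x \<notin> C \<longrightarrow> v n x = 0)" for n
    using st[of n] unfolding stage_def v_def by auto
  then obtain C where C: "\<And>n. compact (C n)" "\<And>n. C n \<subseteq> U" "\<And>n x. x \<notin> C n \<Longrightarrow> v n x = 0" by metis
  note \<phi>' = C1_in_derivative[OF \<phi>]
  \<comment> \<open>The support of \<open>v n\<close> is a compact subset of \<open>U\<close>, so
    \<open>v n\<close> vanishes near every point outside \<open>U\<close>, including the boundary
    points.\<close>
  have out: "(v n has_derivative (\<lambda>h. 0 *v h)) (at x)" if x: "x \<notin> U" for x n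
  proof (rule has_derivative_transform_within_open[of "\<lambda>_. 0" _ _ _ "- C n"])
    show "open (- C n)" using C(1) by (simp add: compact_imp_closed open_Compl)
    show "x \<in> - C n" using C(2) x by blast
    show "0 = v n y" if "y \<in> - C n" for y using C(3) that by simp
  qed simp
  have inner: "\<exists>M\<in>K \<union> E. (u n has_derivative (\<lambda>h. M *v h)) (at x)" if "x \<in> V n \<union> S n" for x n
    using that SE[of x n] C1_in_derivative[OF VK[of n], of x] VK[of n] by (auto simp: C1_in_def)
  \<comment> \<open>The gradient of \<open>v n\<close> is the difference of two gradients of norm at
    most \<open>R\<close>, hence the bound \<open>R + R\<close>.\<close>
  have der: "\<exists>M. (v n has_derivative (\<lambda>h. M *v h)) (at x) \<and> norm M \<le> R + R" if xn: "x \<notin> U - (V n \<union> S n)" for x n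
  proof (cases "x \<in> U")
    case True
    then obtain M where M: "M \<in> K \<union> E" "(u n has_derivative (\<lambda>h. M *v h)) (at x)"
      using inner[of x n] xn by blast
    have "jacobian \<phi> (at x) \<in> K" using \<phi> True by (simp add: C1_in_def)
    then have "norm (M - jacobian \<phi> (at x)) \<le> R + R"
      using bdd(1)[OF M(1)] bdd(1)[of "jacobian \<phi> (at x)"] norm_triangle_ineq4[of M "jacobian \<phi> (at x)"]
      by simp
    then show ?thesis using jacobian_diff[OF M(2) \<phi>'[OF True]] unfolding v_def[abs_def] by blast
  next
    case False
    then show ?thesis using out[OF False, of n] bdd(2) by (intro exI[of _ 0]) simp
  qed
  have AEN: "AE x in lebesgue. x \<notin> U - (V n \<union> S n)" for n
    using NV[of n] unfolding negligible_iff_null_sets by (rule AE_not_in)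
  have Jb: "AE x in lebesgue. norm (?J n x) \<le> R + R" for n
    using AEN[of n] by eventually_elim (use der jacobian_eq in blast)
  have diff: "v n differentiable (at x)" if "x \<notin> U - (V n \<union> S n)" for n x
    using der[OF that] by (auto simp: differentiable_def)
  have vconst: "v n x = v k x" if "k \<le> n" "x \<in> S k" for k n x
    using const[OF that] by (simp add: v_def)
  have Jconst: "?J n x = ?J k x" if "k \<le> n" "x \<in> S k" for k n x
    by (rule jacobian_transform[OF S(1)[of k] that(2)]) (rule vconst[OF that(1)])
  have J0: "?J n x = 0" if "x \<notin> U" for n x by (rule jacobian_eq[OF out[OF that]])
  have limS: "(\<lambda>n. ?J n x) \<longlonglongrightarrow> ?J k x" if "x \<in> S k" for k x
  proof (rule tendsto_eventually)
    show "\<forall>\<^sub>F n in sequentially. ?J n x = ?J k x"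
      using eventually_ge_at_top[of k] by eventually_elim (rule Jconst[OF _ that])
  qed
  \<comment> \<open>At every point of some \<open>S k\<close> the gradients are eventually constant,
    and off \<open>U\<close> they are 0, so the limit exists almost everywhere; elsewhere the value
    is arbitrary.\<close>
  define H where "H x = lim (\<lambda>n. ?J n x)" for x
  have HS: "H x = ?J k x" if "x \<in> S k" for k x
    unfolding H_def by (rule limI[OF limS[OF that]])
  have H0: "H x = 0" if "x \<notin> U" for x
    unfolding H_def J0[OF that] by simp
  have AES: "AE x in lebesgue. x \<notin> U - (\<Union>n. S n)"
    using neg unfolding negligible_iff_null_sets by (rule AE_not_in)
  have limH: "AE x in lebesgue. (\<lambda>n. ?J n x) \<longlonglongrightarrow> H x"
    using AES
  proof eventually_elim
    case (elim x)
    show ?case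
    proof (cases "x \<in> U")
      case True
      then obtain k where k: "x \<in> S k" using elim by blast
      show ?thesis unfolding HS[OF k] by (rule limS[OF k])
    qed (simp add: H0 J0)
  qed
  obtain L where L: "\<And>n. (L n)-lipschitz_on UNIV (v n)" using lip by metis
  have Hm: "H \<in> borel_measurable lebesgue"
    unfolding H_def[abs_def]
    by (intro borel_measurable_lim_metric lipschitz_jacobian(1)[OF L compact_imp_bounded[OF C(1)] C(3) NV diff])
  have vstep: "norm (v (Suc n) x - v n x) \<le> (1/2) ^ n" for n x
    using step[of n x] by (simp add: v_def)
  \<comment> \<open>The limit of \<open>v n\<close> written as a telescoping series, which is
    dominated by the geometric series.\<close>
  define w where "w x = v 0 x + (\<Sum>k. v (Suc k) x - v k x)" for x
  have limw: "(\<lambda>n. v n x) \<longlonglongrightarrow> w x" for x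
  proof -
    have "summable (\<lambda>k. v (Suc k) x - v k x)"
      by (rule summable_comparison_test[OF _ summable_geometric[of "1/2 :: real"]]) (use vstep in auto)
    from summable_LIMSEQ[OF this] have "(\<lambda>n. v n x - v 0 x) \<longlonglongrightarrow> (\<Sum>k. v (Suc k) x - v k x)"
      unfolding sum_lessThan_telescope[of "\<lambda>n. v n x"] .
    from tendsto_add[OF tendsto_const[of "v 0 x"] this] show ?thesis by (simp add: w_def)
  qed
  obtain B0 where B0: "\<And>x. norm (v 0 x) \<le> B0"
    using bounded_support_imp_bounded[OF lipschitz_on_continuous_on[OF L] compact_imp_bounded[OF C(1)] C(3), of 0] by blast
  have vb: "norm (v n x) \<le> max (B0 + 2) (R + R)" for n x
  proof -
    \<comment> \<open>The subtracted term is the unspent part of the geometric series with sum 2; it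
      makes the induction close.\<close>
    have "norm (v n x) \<le> B0 + 2 - 2 * (1/2) ^ n"
    proof (induction n)
      case 0
      then show ?case using B0 by simp
    next
      case (Suc n)
      have "norm (v (Suc n) x) \<le> norm (v n x) + norm (v (Suc n) x - v n x)" by (rule norm_triangle_sub)
      then show ?case using Suc vstep[of n x] by simp
    qed
    also have "\<dots> \<le> B0 + 2" by simp
    finally show ?thesis by simp
  qed
  have fin: "w \<in> W1_inf_0 \<Omega> \<and> has_weak_gradient \<Omega> w H"
  proof (rule conjI; rule W1_inf_0I[OF \<Omega>(1) lmeasurable_open[OF \<Omega>(2,1)] lip _ _ limw limH Hm vb])
    show "\<exists>D. compact D \<and> D \<subseteq> \<Omega> \<and> (\<forall>x. x \<notin> D \<longrightarrow> v n x = 0)" for n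
      using C U(2) by (intro exI[of _ "C n"]) blast
    then show "\<exists>D. compact D \<and> D \<subseteq> \<Omega> \<and> (\<forall>x. x \<notin> D \<longrightarrow> v n x = 0)" for n .
    show N: "\<exists>N. negligible N \<and> (\<forall>x. x \<notin> N \<longrightarrow> v n differentiable (at x))" for n
      using NV[of n] diff[of _ n] by blast
    then show "\<exists>N. negligible N \<and> (\<forall>x. x \<notin> N \<longrightarrow> v n differentiable (at x))" for n .
    show J: "AE x in lebesgue. norm (?J n x) \<le> max (B0 + 2) (R + R)" for n
      using Jb[of n] by eventually_elim simp
    then show "AE x in lebesgue. norm (?J n x) \<le> max (B0 + 2) (R + R)" for n .
  qed
  have "{x \<in> U. H x + jacobian \<phi> (at x) \<notin> E} \<subseteq> U - (\<Union>n. S n)"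
  proof -
    have "H x + jacobian \<phi> (at x) \<in> E" if xU: "x \<in> U" and xk: "x \<in> S k" for x k
    proof -
      obtain M where M: "M \<in> E" "(u k has_derivative (\<lambda>h. M *v h)) (at x)" using SE[OF xk] by blast
      have "?J k x = M - jacobian \<phi> (at x)"
        using jacobian_eq[OF jacobian_diff[OF M(2) \<phi>'[OF xU]]] unfolding v_def[abs_def] .
      then show ?thesis using M(1) HS[OF xk] by simp
    qed
    then show ?thesis by blast
  qed
  then have "negligible {x \<in> U. H x + jacobian \<phi> (at x) \<notin> E}" by (rule negligible_subset[OF neg])
  with fin show ?thesis using that H0 by blast
qed

text \<open>The construction runs only where the classical gradient lies in \<open>Klam\<close>.
  Elsewhere almost every gradient is already in \<open>E\<close>, because it lies in
  \<open>E \<union> K\<close> and \<open>K \<subseteq> Klam\<close>. Points whose gradient is in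
  both \<open>E\<close> and \<open>Klam\<close> are changed too, without harm.\<close>

theorem theorem4p11:
  fixes E K :: "(real^2^2) set"
    and \<Lambda>E \<Lambda>K \<Gamma> relint\<Gamma> :: "(real \<times> real) set"
    and a1 a2 b1 b2 :: real
    and \<Omega> :: "(real^2) set"
    and \<phi> :: "real^2 \<Rightarrow> real^2"
    and D\<phi> :: "real^2 \<Rightarrow> real^2^2"
  assumes E_eq: "E = {\<xi>. (sing_val1 \<xi>, sing_val2 \<xi>) \<in> \<Lambda>E \<and> det \<xi> > 0}"
    and \<Lambda>E_subset: "\<Lambda>E \<subseteq> {(x1, x2). 0 < x1 \<and> x1 \<le> x2}"
    and \<Gamma>_eq: "\<Gamma> = {(a1 + t * (b1 - a1), a2 + t * (b2 - a2)) |t. t \<in> {0..1}}"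
    and \<Gamma>_subset: "\<Gamma> \<subseteq> \<Lambda>E"
    and ab: "a1 < b1" "a2 < b2" "a1 < a2 \<or> b1 < b2"
    and relint_eq: "relint\<Gamma> = {(a1 + t * (b1 - a1), a2 + t * (b2 - a2)) |t. t \<in> {0<..<1}}"
    and \<Lambda>K_eq: "\<Lambda>K = (\<Union>(\<alpha>1, \<alpha>2)\<in>relint\<Gamma>.
                    {(x1, x2). x1 * x2 = \<alpha>1 * \<alpha>2 \<and> 0 < x1 \<and> x1 \<le> x2 \<and> x2 < \<alpha>2})"
    and K_eq: "K = {\<xi>. (sing_val1 \<xi>, sing_val2 \<xi>) \<in> \<Lambda>K \<and> det \<xi> > 0}"
    and \<Omega>: "bounded \<Omega>" "open \<Omega>"
    and \<phi>: "\<phi> \<in> C1_piec \<Omega>"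
    and D\<phi>: "has_weak_gradient \<Omega> \<phi> D\<phi>"
    and D\<phi>_in: "AE x in lebesgue_on \<Omega>. D\<phi> x \<in> E \<union> K"
  shows "\<exists>u Du. (\<lambda>x. u x - \<phi> x) \<in> W1_inf_0 \<Omega> \<and> has_weak_gradient \<Omega> u Du \<and>
           (AE x in lebesgue_on \<Omega>. Du x \<in> E)"
proof -
  \<comment> \<open>The parameters 0 and 1 show that both endpoints belong to \<Gamma>, which
    provides the positivity and ordering of their coordinates.\<close>
  have "(a1, a2) \<in> \<Gamma>" "(b1, b2) \<in> \<Gamma>"
    unfolding \<Gamma>_eq by (auto intro: exI[of _ 0] exI[of _ 1])
  then have "(a1, a2) \<in> {(x1, x2). 0 < x1 \<and> x1 \<le> x2}" "(b1, b2) \<in> {(x1, x2). 0 < x1 \<and> x1 \<le> x2}"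
    using \<Gamma>_subset \<Lambda>E_subset by blast+
  then interpret segment a1 a2 b1 b2 using ab by unfold_locales auto
  have EE: "Elam \<subseteq> E"
  proof
    fix \<xi> assume "\<xi> \<in> Elam"
    then obtain s where s: "s \<in> {0<..<1}" "det \<xi> > 0" "sing_val1 \<xi> = \<alpha>1 s" "sing_val2 \<xi> = \<alpha>2 s"
      by (rule Elam_sing_val)
    then have "(sing_val1 \<xi>, sing_val2 \<xi>) \<in> \<Gamma>"
      unfolding \<Gamma>_eq \<alpha>1_def \<alpha>2_def by (auto intro!: exI[of _ s])
    then show "\<xi> \<in> E" using \<Gamma>_subset s(2) unfolding E_eq by blast
  qed
  have KK: "K \<subseteq> Klam"
  proof
    fix \<xi> assume "\<xi> \<in> K"
    then have d: "det \<xi> > 0" and "(sing_val1 \<xi>, sing_val2 \<xi>) \<in> \<Lambda>K" by (auto simp: K_eq)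
    then obtain s where "s \<in> {0<..<1}" "sing_val1 \<xi> * sing_val2 \<xi> = \<alpha>1 s * \<alpha>2 s" "sing_val2 \<xi> < \<alpha>2 s"
      unfolding \<Lambda>K_eq relint_eq by (auto simp: \<alpha>1_def \<alpha>2_def)
    with d show "\<xi> \<in> Klam" by (rule Klam_ge)
  qed
  obtain \<D> where \<D>: "countable \<D>" "\<And>U. U \<in> \<D> \<Longrightarrow> open U" "\<And>U. U \<in> \<D> \<Longrightarrow> U \<subseteq> \<Omega>"
    "negligible (\<Omega> - \<Union>\<D>)" "\<And>U. U \<in> \<D> \<Longrightarrow> \<phi> \<in> C1_closure U"
    using \<phi> unfolding C1_piec_def by auto
  have C1: "C1_in U \<phi> UNIV" if U: "U \<in> \<D>" for U
  proof -
    obtain G :: "real^2 \<Rightarrow> real^2^2" where G: "continuous_on (closure U) G"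
      "\<And>x. x \<in> U \<Longrightarrow> (\<phi> has_derivative (\<lambda>h. G x *v h)) (at x)"
      using \<D>(5)[OF U] unfolding C1_closure_def by auto
    show ?thesis
      by (rule C1_inI[OF G(2)]) (auto intro: continuous_on_subset[OF G(1) closure_subset])
  qed
  let ?V = "\<lambda>U. U \<inter> (\<lambda>x. jacobian \<phi> (at x)) -` Klam"
  \<comment> \<open>Taken with the classical gradient, which is continuous on each open piece, this
    set is open; the weak gradient is determined only up to null sets.\<close>
  define W where "W = (\<Union>U\<in>\<D>. ?V U)"
  have oV: "open (?V U)" if "U \<in> \<D>" for U
    using C1[OF that] \<D>(2)[OF that] open_Klam
    by (intro continuous_open_preimage) (auto simp: C1_in_def)
  have oW: "open W" unfolding W_def by (intro open_UN ballI oV)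
  have W\<Omega>: "W \<subseteq> \<Omega>" using \<D>(3) by (auto simp: W_def)
  have WK: "C1_in W \<phi> Klam"
    unfolding W_def
  proof (rule C1_in_UN[OF oV])
    fix U assume U: "U \<in> \<D>"
    have "C1_in (?V U) \<phi> UNIV" by (rule C1_in_subset[OF C1[OF U]]) auto
    then show "C1_in (?V U) \<phi> Klam" by (auto simp: C1_in_def)
  qed
  have lam: "\<exists>a. \<xi> + outer a (axis 1 1) \<in> Elam \<and> \<xi> - outer ((1/2) *\<^sub>R a) (axis 1 1) \<in> Klam"
    if "\<xi> \<in> Klam" for \<xi>
    using Klam_laminate[OF that] by blast
  have R: "0 \<le> b1 + b2" using a1 less by simp
  obtain w H where w: "w \<in> W1_inf_0 \<Omega>" "has_weak_gradient \<Omega> w H"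
    and H0: "\<And>x. x \<notin> W \<Longrightarrow> H x = 0" and neg: "negligible {x \<in> W. H x + jacobian \<phi> (at x) \<notin> Elam}"
    using convex_integration[OF open_Klam lam norm_bound R \<Omega>(2,1) oW W\<Omega> WK] by blast
  define u where "u x = w x + \<phi> x" for x
  define Du where "Du x = H x + D\<phi> x" for x
  have "(\<lambda>x. u x - \<phi> x) \<in> W1_inf_0 \<Omega>" using w(1) by (simp add: u_def)
  moreover have "has_weak_gradient \<Omega> u Du"
    unfolding u_def[abs_def] Du_def[abs_def] by (rule has_weak_gradient_add[OF w(2) D\<phi>])
  moreover have "AE x in lebesgue_on \<Omega>. Du x \<in> E"
  proof -
    have "negligible {x \<in> U. D\<phi> x \<noteq> jacobian \<phi> (at x)}" if "U \<in> \<D>" for U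
      using C1[OF that] by (intro weak_gradient_eq_jacobian[OF D\<phi> \<D>(2,3)]) (auto simp: C1_in_def that)
    then have "negligible (\<Union>U\<in>\<D>. {x \<in> U. D\<phi> x \<noteq> jacobian \<phi> (at x)})"
      using \<D>(1) by (intro negligible_countable_Union) auto
    then have n: "negligible ((\<Union>U\<in>\<D>. {x \<in> U. D\<phi> x \<noteq> jacobian \<phi> (at x)}) \<union> (\<Omega> - \<Union>\<D>)
        \<union> {x \<in> W. H x + jacobian \<phi> (at x) \<notin> Elam})" (is "negligible ?N")
      using \<D>(4) neg by (intro negligible_Un)
    have AEN: "AE x in lebesgue. x \<notin> ?N"
      using n unfolding negligible_iff_null_sets by (rule AE_not_in)
    have \<Omega>s: "\<Omega> \<inter> space lebesgue \<in> sets lebesgue"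
      using fmeasurableD[OF lmeasurable_open[OF \<Omega>]] by simp
    have "AE x in lebesgue. x \<in> \<Omega> \<longrightarrow> D\<phi> x \<in> E \<union> K"
      using D\<phi>_in unfolding AE_restrict_space_iff[OF \<Omega>s] .
    then have "AE x in lebesgue. x \<in> \<Omega> \<longrightarrow> Du x \<in> E"
      using AEN
    proof eventually_elim
      case (elim x)
      show ?case
      proof
        assume x: "x \<in> \<Omega>"
        then obtain U where U: "U \<in> \<D>" "x \<in> U" using elim(2) by blast
        have D: "D\<phi> x = jacobian \<phi> (at x)" using elim(2) U by blast
        show "Du x \<in> E"
        proof (cases "x \<in> W")
          case True
          then have "H x + jacobian \<phi> (at x) \<in> Elam" using elim(2) by blast
          then show ?thesis using EE D by (auto simp: Du_def)
        next
          case False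
          then have "jacobian \<phi> (at x) \<notin> Klam" using U by (auto simp: W_def)
          then show ?thesis using elim(1) x KK D H0[OF False] by (auto simp: Du_def)
        qed
      qed
    qed
    then show ?thesis unfolding AE_restrict_space_iff[OF \<Omega>s] .
  qed
  ultimately show ?thesis by blast
qed

end
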